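(* Let $d,n\ge1$, let $f\in H^\infty(\mathbb{B}_d)$, let $T$ be a $d$-tuple of commuting $n\times n$ complex matrices whose joint spectrum is contained in $\mathbb{B}_d$, and let $a>0$. Then there exists a function $g\in\mathrm{Mult}(\mathcal{D}_a(\mathbb{B}_d))$ with $f(T)=g(T)$ and $$\|g\|_{\mathrm{Mult}(\mathcal{D}_a(\mathbb{B}_d))}\le\bigl(2\min(C(d)\sqrt d,\,C(n')\sqrt{n'})\max(1,a^{-1/2})\bigr)^{n-1}\|f\|_\infty,$$ where $n'=\lfloor n^2/4\rfloor+1$.
   Context: $\mathbb{B}_d$ is the open Euclidean unit ball of $\mathbb{C}^d$; $H^\infty(\mathbb{B}_d)$ is the algebra of bounded holomorphic functions on $\mathbb{B}_d$ with supremum norm $\|\cdot\|_\infty$. $\mathcal{D}_a(\mathbb{B}_d)$ is the reproducing kernel Hilbert space on $\mathbb{B}_d$ with kernel $\frac{1}{(1-\langle z,w\rangle)^a}$; $\mathrm{Mult}(\mathcal{D}_a(\mathbb{B}_d))$ is its multiplier algebra, normed by the operator norm of multiplication operators. The joint spectrum of a commuting tuple $T=(T_1,\ldots,T_d)$ of $n\times n$ matrices is the set of points $(\langle T_1v_i,v_i\rangle,\ldots,\langle T_dv_i,v_i\rangle)$, $i=1,\ldots,n$, where $(v_i)$ is an orthonormal basis in which all $T_j$ are upper triangular. If the joint spectrum lies in $\mathbb{B}_d$, $f\mapsto f(T)$ denotes the unique continuous homomorphism from $\mathcal{O}(\mathbb{B}_d)$ (holomorphic functions on $\mathbb{B}_d$,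 with locally uniform convergence) to $M_n$ extending the polynomial functional calculus $p\mapsto p(T)$. For each integer $k\ge1$, $C(k)>0$ denotes a constant (such constants exist) such that for every $f\in H^\infty(\mathbb{B}_k)$ with $f(0)=0$ there exist $f_1,\ldots,f_k\in H^\infty(\mathbb{B}_k)$ with $f=\sum_{i=1}^kz_if_i$ and $\|f_i\|_\infty\le C(k)\|f\|_\infty$ for all $i$. *)

theory Defs
  imports "HOL-Analysis.Analysis" "Jordan_Normal_Form.Matrix" "Jordan_Normal_Form.Conjugate"
begin

section \<open>The unit ball and its holomorphic functions\<close>

text \<open>
  Points of $\mathbb{C}^d$ are the sequences that vanish from index \<open>d\<close> on, so that the
  dimension can be a variable. On this set the library's (product) topology of
  \<^typ>\<open>nat \<Rightarrow> complex\<close> is the Euclidean one.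
\<close>

definition cspace :: "nat \<Rightarrow> (nat \<Rightarrow> complex) set" where
  "cspace d = {z. \<forall>i\<ge>d. z i = 0}"

definition cnorm :: "nat \<Rightarrow> (nat \<Rightarrow> complex) \<Rightarrow> real" where
  "cnorm d z = L2_set (\<lambda>i. cmod (z i)) {..<d}"

definition cinner :: "nat \<Rightarrow> (nat \<Rightarrow> complex) \<Rightarrow> (nat \<Rightarrow> complex) \<Rightarrow> complex" where
  "cinner d z w = (\<Sum>i<d. z i * cnj (w i))"

definition unit_ball :: "nat \<Rightarrow> (nat \<Rightarrow> complex) set" where
  "unit_ball d = {z \<in> cspace d. cnorm d z < 1}"

text \<open>
  Holomorphic means complex (Frechet) differentiable at every point of the ball. Values outside
  the ball play no role.
\<close>

definition holo :: "nat \<Rightarrow> ((nat \<Rightarrow> complex) \<Rightarrow> complex) set" where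
  "holo d = {f. \<forall>z\<in>unit_ball d. \<exists>L :: nat \<Rightarrow> complex.
     ((\<lambda>w. (f w - f z - (\<Sum>i<d. L i * (w i - z i))) / of_real (cnorm d (\<lambda>i. w i - z i)))
        \<longlongrightarrow> 0) (at z within unit_ball d)}"

definition Hinf :: "nat \<Rightarrow> ((nat \<Rightarrow> complex) \<Rightarrow> complex) set" where
  "Hinf d = {f \<in> holo d. bounded (f ` unit_ball d)}"

definition supnorm :: "nat \<Rightarrow> ((nat \<Rightarrow> complex) \<Rightarrow> complex) \<Rightarrow> real" where
  "supnorm d f = (SUP z\<in>unit_ball d. cmod (f z))"

definition gleason_constant :: "nat \<Rightarrow> real \<Rightarrow> bool" where
  "gleason_constant k c \<longleftrightarrow> c > 0 \<and>
     (\<forall>f\<in>Hinf k. f (\<lambda>_. 0) = 0 \<longrightarrow>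
        (\<exists>F :: nat \<Rightarrow> (nat \<Rightarrow> complex) \<Rightarrow> complex.
           (\<forall>i<k. F i \<in> Hinf k \<and> supnorm k (F i) \<le> c * supnorm k f) \<and>
           (\<forall>z\<in>unit_ball k. f z = (\<Sum>i<k. z i * F i z))))"


section \<open>Reproducing kernel Hilbert spaces and multipliers\<close>

definition ip_norm :: "(('x \<Rightarrow> complex) \<Rightarrow> ('x \<Rightarrow> complex) \<Rightarrow> complex) \<Rightarrow> ('x \<Rightarrow> complex) \<Rightarrow> real" where
  "ip_norm ip h = sqrt (Re (ip h h))"

text \<open>
  \<open>(H, ip)\<close> is the Hilbert function space on \<open>X\<close> with reproducing kernel \<open>K\<close>. A function on \<open>X\<close>
  is represented by its extension by zero. The inner product is linear in its first argument.
  By the Moore-Aronszajn theorem \<open>X\<close> and \<open>K\<close> determine \<open>H\<close> and the restriction of \<open>ip\<close>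
  to \<open>H\<close> uniquely, and the space exists whenever \<open>K\<close> is positive semidefinite.
\<close>

locale rkhs =
  fixes X :: "'x set"
    and K :: "'x \<Rightarrow> 'x \<Rightarrow> complex"
    and H :: "('x \<Rightarrow> complex) set"
    and ip :: "('x \<Rightarrow> complex) \<Rightarrow> ('x \<Rightarrow> complex) \<Rightarrow> complex"
  assumes off_domain: "h \<in> H \<Longrightarrow> x \<notin> X \<Longrightarrow> h x = 0"
    and zero_mem: "(\<lambda>_. 0) \<in> H"
    and add_mem: "g \<in> H \<Longrightarrow> h \<in> H \<Longrightarrow> (\<lambda>x. g x + h x) \<in> H"
    and scale_mem: "h \<in> H \<Longrightarrow> (\<lambda>x. c * h x) \<in> H"
    and ip_commute: "g \<in> H \<Longrightarrow> h \<in> H \<Longrightarrow> ip h g = cnj (ip g h)"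
    and ip_add: "f \<in> H \<Longrightarrow> g \<in> H \<Longrightarrow> h \<in> H \<Longrightarrow> ip (\<lambda>x. f x + g x) h = ip f h + ip g h"
    and ip_scale: "g \<in> H \<Longrightarrow> h \<in> H \<Longrightarrow> ip (\<lambda>x. c * g x) h = c * ip g h"
    and ip_pos: "h \<in> H \<Longrightarrow> h \<noteq> (\<lambda>_. 0) \<Longrightarrow> Re (ip h h) > 0"
    and complete: "\<lbrakk>\<And>m. u m \<in> H;
        \<forall>e>0. \<exists>N. \<forall>m\<ge>N. \<forall>k\<ge>N. ip_norm ip (\<lambda>x. u m x - u k x) < e\<rbrakk>
        \<Longrightarrow> \<exists>h\<in>H. (\<lambda>m. ip_norm ip (\<lambda>x. u m x - h x)) \<longlonglongrightarrow> 0"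
    and kernel_mem: "w \<in> X \<Longrightarrow> (\<lambda>x. if x \<in> X then K x w else 0) \<in> H"
    and reproducing: "h \<in> H \<Longrightarrow> w \<in> X \<Longrightarrow> ip h (\<lambda>x. if x \<in> X then K x w else 0) = h w"

definition Mult :: "('x \<Rightarrow> complex) set \<Rightarrow> ('x \<Rightarrow> complex) set" where
  "Mult H = {g. \<forall>h\<in>H. (\<lambda>x. g x * h x) \<in> H}"

text \<open>
  The operator norm of multiplication by \<open>g\<close>. For \<open>g\<close> in \<^const>\<open>Mult\<close> of a reproducing kernel
  Hilbert space the supremum is finite by the closed graph theorem.
\<close>

definition mult_norm :: "('x \<Rightarrow> complex) set \<Rightarrow> (('x \<Rightarrow> complex) \<Rightarrow> ('x \<Rightarrow> complex) \<Rightarrow> complex)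
    \<Rightarrow> ('x \<Rightarrow> complex) \<Rightarrow> real" where
  "mult_norm H ip g = (SUP h\<in>{h\<in>H. ip_norm ip h \<le> 1}. ip_norm ip (\<lambda>x. g x * h x))"

text \<open>
  The kernel of $\mathcal{D}_a(\mathbb{B}_d)$. On the ball $1 - \langle z, w\rangle$ has positive
  real part, and the power is the principal one.
\<close>

definition Da_kernel :: "real \<Rightarrow> nat \<Rightarrow> (nat \<Rightarrow> complex) \<Rightarrow> (nat \<Rightarrow> complex) \<Rightarrow> complex" where
  "Da_kernel a d z w = 1 / (1 - cinner d z w) powr complex_of_real a"


section \<open>Commuting matrices: joint spectrum and functional calculus\<close>

definition commuting_tuple :: "nat \<Rightarrow> nat \<Rightarrow> (nat \<Rightarrow> complex mat) \<Rightarrow> bool" where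
  "commuting_tuple d n T \<longleftrightarrow>
     (\<forall>j<d. T j \<in> carrier_mat n n) \<and> (\<forall>i<d. \<forall>j<d. T i * T j = T j * T i)"

definition onb :: "nat \<Rightarrow> (nat \<Rightarrow> complex Matrix.vec) \<Rightarrow> bool" where
  "onb n v \<longleftrightarrow> (\<forall>i<n. v i \<in> carrier_vec n) \<and>
     (\<forall>i<n. \<forall>k<n. v i \<bullet>c v k = (if i = k then 1 else 0))"

definition mat_in_basis :: "nat \<Rightarrow> (nat \<Rightarrow> complex Matrix.vec) \<Rightarrow> complex mat \<Rightarrow> complex mat" where
  "mat_in_basis n v A = Matrix.mat n n (\<lambda>(k, i). (A *\<^sub>v v i) \<bullet>c v k)"

text \<open>
  A commuting tuple has a triangularizing orthonormal basis, and all of them give the same set of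
  points; the union over all of them therefore is the set obtained from any one of them.
\<close>

definition joint_spectrum :: "nat \<Rightarrow> nat \<Rightarrow> (nat \<Rightarrow> complex mat) \<Rightarrow> (nat \<Rightarrow> complex) set" where
  "joint_spectrum d n T =
     {(\<lambda>j. if j < d then (T j *\<^sub>v v i) \<bullet>c v i else 0) | v i.
        onb n v \<and> (\<forall>j<d. upper_triangular (mat_in_basis n v (T j))) \<and> i < n}"

text \<open>
  A polynomial in \<open>d\<close> variables is given by a finite set \<open>A\<close> of multi-indices and coefficients
  \<open>c\<close>.
\<close>

definition poly_fun :: "nat \<Rightarrow> (nat \<Rightarrow> nat) set \<Rightarrow> ((nat \<Rightarrow> nat) \<Rightarrow> complex)
    \<Rightarrow> (nat \<Rightarrow> complex) \<Rightarrow> complex" where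
  "poly_fun d A c z = (\<Sum>\<alpha>\<in>A. c \<alpha> * (\<Prod>i<d. z i ^ \<alpha> i))"

definition mat_monomial :: "nat \<Rightarrow> nat \<Rightarrow> (nat \<Rightarrow> complex mat) \<Rightarrow> (nat \<Rightarrow> nat) \<Rightarrow> complex mat" where
  "mat_monomial d n T \<alpha> = foldr (\<lambda>i B. (T i ^\<^sub>m \<alpha> i) * B) [0..<d] (1\<^sub>m n)"

definition poly_mat :: "nat \<Rightarrow> nat \<Rightarrow> (nat \<Rightarrow> complex mat) \<Rightarrow> (nat \<Rightarrow> nat) set
    \<Rightarrow> ((nat \<Rightarrow> nat) \<Rightarrow> complex) \<Rightarrow> complex mat" where
  "poly_mat d n T A c = Matrix.mat n n (\<lambda>(r, s). \<Sum>\<alpha>\<in>A. c \<alpha> * mat_monomial d n T \<alpha> $$ (r, s))"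

text \<open>
  \<open>\<Phi>\<close> is the functional calculus \<open>f \<mapsto> f(T)\<close>: a continuous algebra homomorphism from the
  holomorphic functions on the ball, with locally uniform convergence, to the matrices, extending
  the polynomial calculus. The topology of locally uniform convergence is metrizable, so
  sequential continuity is continuity. Applied to constant sequences the last clause also makes
  the value of \<open>\<Phi>\<close> at \<open>f\<close> depend only on the restriction of \<open>f\<close> to the ball. Such a \<open>\<Phi>\<close> exists
  if the joint spectrum lies in the ball, and its values on \<^term>\<open>holo d\<close> are unique.
\<close>

definition functional_calculus :: "nat \<Rightarrow> nat \<Rightarrow> (nat \<Rightarrow> complex mat)
    \<Rightarrow> (((nat \<Rightarrow> complex) \<Rightarrow> complex) \<Rightarrow> complex mat) \<Rightarrow> bool" where
  "functional_calculus d n T \<Phi> \<longleftrightarrow>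
     (\<forall>f\<in>holo d. \<Phi> f \<in> carrier_mat n n) \<and>
     (\<forall>f\<in>holo d. \<forall>g\<in>holo d. \<Phi> (\<lambda>z. f z + g z) = \<Phi> f + \<Phi> g) \<and>
     (\<forall>f\<in>holo d. \<forall>g\<in>holo d. \<Phi> (\<lambda>z. f z * g z) = \<Phi> f * \<Phi> g) \<and>
     (\<forall>c. \<forall>f\<in>holo d. \<Phi> (\<lambda>z. c * f z) = c \<cdot>\<^sub>m \<Phi> f) \<and>
     (\<forall>A c. finite A \<longrightarrow> \<Phi> (poly_fun d A c) = poly_mat d n T A c) \<and>
     (\<forall>u. \<forall>f\<in>holo d. (\<forall>m. u m \<in> holo d) \<and>
        (\<forall>S. compact S \<and> S \<subseteq> unit_ball d \<longrightarrow> uniform_limit S u f sequentially) \<longrightarrow>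
        (\<forall>r<n. \<forall>s<n. (\<lambda>m. \<Phi> (u m) $$ (r, s)) \<longlonglongrightarrow> \<Phi> f $$ (r, s)))"

end

theory Submission
  imports Defs "HOL-Computational_Algebra.Fundamental_Theorem_Algebra"
begin

text \<open>
  The joint spectrum is processed one point at a time. All matrices \<open>\<Phi> f\<close> commute, so in a
  suitable basis they are upper triangular. Let \<open>ann m\<close> be the ideal of those \<open>f\<close> for
  which \<open>\<Phi> f\<close> kills the first \<open>m\<close> basis vectors; \<open>ann n\<close> is the kernel of the calculus. The
  \<open>m\<close>-th diagonal entry is a character, on bounded functions it is evaluation at a point \<open>\<lambda>\<close> of the
  ball, and a function with character value 0 multiplies \<open>ann m\<close> into \<open>ann (Suc m)\<close>. By induction
  on \<open>m\<close>, every \<open>f\<close> with \<open>\<bar>f\<bar> \<le> 1\<close> on the ball agrees modulo \<open>ann m\<close> with a multiplier of norm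
  at most \<open>q ^ (m - 1)\<close>, where \<open>q\<close> is the base of the power in the theorem.

  For the induction step suppose first that \<open>f\<close> vanishes at \<open>\<lambda>\<close>. A division
  \<open>f = (\<Sum>i<k. \<psi> i * F i)\<close> with \<open>\<psi> i\<close> vanishing at \<open>\<lambda>\<close> is available, with
  \<open>\<bar>F i\<bar> \<le> C k\<close>: compose with the automorphism of the ball that exchanges \<open>\<lambda>\<close> and 0, and divide at 0.
  Replacing each \<open>F i\<close> by a multiplier \<open>G i\<close> that agrees with it modulo \<open>ann m\<close> changes the sum only by
  an element of \<open>ann (Suc m)\<close>. The column of the \<open>G i\<close> costs a factor \<open>sqrt k\<close>, and the row of the \<open>\<psi> i\<close>
  has norm at most \<open>max 1 (a powr (-1/2))\<close>.

  For general \<open>f\<close>, subtracting \<open>f \<lambda>\<close> and adding it back would destroy the product form of the bound.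
  Instead, with \<open>Q\<close> the bound that is aimed at, a Moebius map of the unit disc moves the
  value of \<open>f / Q\<close> at \<open>\<lambda>\<close> to 0. The resulting function is at most \<open>2 / Q\<close> on the ball, which is where
  the factor 2 per step comes from, so the previous case turns it into a contractive multiplier; and
  the inverse Moebius map sends contractive multipliers to contractive multipliers. The result times
  \<open>Q\<close> is the multiplier wanted (\<open>approximation_step\<close>).

  The number \<open>k\<close> of variables in the division can be taken to be \<open>d\<close>, or \<open>n\<^sup>2 div 4 + 1\<close>: no more than
  that many commuting \<open>n \<times> n\<close> matrices are linearly independent (\<open>card_commuting_upper_indep_le\<close>,
  a theorem of Schur), so that in suitable orthonormal coordinates all but that many coordinates of
  the automorphism lie in the kernel of the calculus. Setting these coordinates to 0 is a holomorphic
  retraction \<open>\<theta>\<close> of the ball, and \<open>f\<close> and \<open>f \<circ> \<theta>\<close> have the same image under the calculus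
  (\<open>retraction_kernel\<close>).

  Multiplier norms are handled through the kernel: \<open>g\<close> has norm at most \<open>R\<close> if the form with kernel
  \<open>(R\<^sup>2 - g z * cnj (g w)) * K z w\<close> is positive semidefinite. This makes the Moebius step and the
  row-times-column step algebraic, and the Hilbert space itself enters only
  through \<open>mult_bound_imp_Mult\<close>. Positivity for the row of an automorphism
  (\<open>kquad_row_le\<close>) comes from the signs of the Taylor coefficients of \<open>(M\<^sup>2 - t) / (1 - t) powr a\<close>.
\<close>

section \<open>Linearly independent families of functions\<close>

text \<open>
  Linear independence of an indexed family rather than of a set of vectors, so that repetitions count
  and no ambient vector space has to be fixed.
\<close>

definition indep_fam :: "'k set \<Rightarrow> ('k \<Rightarrow> 'i \<Rightarrow> complex) \<Rightarrow> bool" where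
  "indep_fam I u \<longleftrightarrow> (\<forall>a. (\<forall>x. (\<Sum>i\<in>I. a i * u i x) = 0) \<longrightarrow> (\<forall>i\<in>I. a i = 0))"

lemma indep_famI:
  assumes "\<And>a i. (\<And>x. (\<Sum>i\<in>I. a i * u i x) = 0) \<Longrightarrow> i \<in> I \<Longrightarrow> a i = 0"
  shows "indep_fam I u"
  using assms unfolding indep_fam_def by blast

lemma indep_famD:
  assumes "indep_fam I u" "\<And>x. (\<Sum>i\<in>I. a i * u i x) = 0" "i \<in> I"
  shows "a i = 0"
  using assms unfolding indep_fam_def by blast

text \<open>
  Gaussian elimination: subtracting multiples of one member clears a coordinate of all the others.
\<close>

lemma card_indep_fam_le:
  assumes "finite X" "finite I" "indep_fam I u" "\<And>i x. i \<in> I \<Longrightarrow> x \<notin> X \<Longrightarrow> u i x = 0"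
  shows "card I \<le> card X"
  using assms
proof (induction X arbitrary: I u rule: finite_induct)
  case empty
  have "I = {}"
  proof (rule ccontr)
    assume "I \<noteq> {}" then obtain i where i: "i \<in> I" by auto
    have "(1::complex) = 0"
      by (rule indep_famD[OF empty(2) _ i, of "\<lambda>_. 1"]) (simp add: empty)
    thus False by simp
  qed
  thus ?case by simp
next
  case (insert x X)
  show ?case
  proof (cases "\<forall>i\<in>I. u i x = 0")
    case True
    have "card I \<le> card X"
      by (rule insert.IH[OF insert.prems(1,2)]) (use True insert.prems(3) in force)
    thus ?thesis using insert.hyps by simp
  next
    case False
    then obtain k where k: "k \<in> I" "u k x \<noteq> 0" by auto
    define v where "v = (\<lambda>i y. u i y - (u i x / u k x) * u k y)"
    have "card (I - {k}) \<le> card X"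
    proof (rule insert.IH[where u = v])
      show "finite (I - {k})" using insert.prems by auto
      show "indep_fam (I - {k}) v"
      proof (rule indep_famI)
        fix a i assume z: "\<And>y. (\<Sum>i\<in>I - {k}. a i * v i y) = 0" and i: "i \<in> I - {k}"
        define b where "b = (\<lambda>i. if i = k then - (\<Sum>j\<in>I-{k}. a j * (u j x / u k x)) else a i)"
        have "(\<Sum>i\<in>I. b i * u i y) = 0" for y
        proof -
          have "(\<Sum>i\<in>I. b i * u i y) = b k * u k y + (\<Sum>i\<in>I-{k}. b i * u i y)"
            using k insert.prems by (simp add: sum.remove)
          also have "(\<Sum>i\<in>I-{k}. b i * u i y) = (\<Sum>i\<in>I-{k}. a i * u i y)"
            by (rule sum.cong) (auto simp: b_def)
          also have "b k * u k y + \<dots> = (\<Sum>i\<in>I - {k}. a i * v i y)"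
            by (simp add: b_def v_def sum_distrib_right right_diff_distrib sum_subtractf mult.assoc)
          finally show ?thesis using z by simp
        qed
        from indep_famD[OF insert.prems(2) this, of i] i show "a i = 0" by (auto simp: b_def)
      qed
      fix i y assume "i \<in> I - {k}" "y \<notin> X"
      thus "v i y = 0" using insert.prems(3) k by (cases "y = x") (auto simp: v_def)
    qed
    thus ?thesis using k insert.hyps insert.prems by simp
  qed
qed

text \<open>
  The index set may be infinite. This is what later replaces the values of the calculus on all
  holomorphic functions by finitely many of them.
\<close>

lemma maximal_indep_subfamily:
  fixes u :: "'k \<Rightarrow> 'i \<Rightarrow> complex"
  assumes "finite X" "\<And>i x. i \<in> S \<Longrightarrow> x \<notin> X \<Longrightarrow> u i x = 0"
  obtains F where "finite F" "F \<subseteq> S" "indep_fam F u"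
    "\<And>i. i \<in> S \<Longrightarrow> \<exists>a. \<forall>x. u i x = (\<Sum>k\<in>F. a k * u k x)"
proof -
  define P where "P = (\<lambda>m. \<exists>F. finite F \<and> F \<subseteq> S \<and> indep_fam F u \<and> card F = m)"
  have "P 0" unfolding P_def by (intro exI[of _ "{}"]) (auto simp: indep_fam_def)
  moreover have "\<forall>m. P m \<longrightarrow> m \<le> card X"
    unfolding P_def by (auto intro!: card_indep_fam_le[OF assms(1)] simp: subset_eq assms(2))
  ultimately obtain m where m: "P m" "\<And>j. P j \<Longrightarrow> j \<le> m"
    using Greatest_le_nat[of P _ "card X"] GreatestI_nat[of P 0 "card X"] by metis
  from m(1) obtain F where F: "finite F" "F \<subseteq> S" "indep_fam F u" "card F = m"
    unfolding P_def by auto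
  have "\<exists>a. \<forall>x. u i x = (\<Sum>k\<in>F. a k * u k x)" if i: "i \<in> S" for i
  proof (cases "i \<in> F")
    case True
    show ?thesis
      by (rule exI[of _ "\<lambda>k. if k = i then 1 else 0"]) (use True F(1) in \<open>simp add: if_distrib[of "\<lambda>c. c * _"] cong: if_cong\<close>)
  next
    case False
    have "\<not> indep_fam (insert i F) u"
    proof
      assume "indep_fam (insert i F) u"
      hence "P (Suc m)" unfolding P_def using F i False
        by (intro exI[of _ "insert i F"]) auto
      from m(2)[OF this] show False by simp
    qed
    then obtain a j where a: "\<And>x. (\<Sum>k\<in>insert i F. a k * u k x) = 0" "j \<in> insert i F" "a j \<noteq> 0"
      unfolding indep_fam_def by blast
    have s: "a i * u i x + (\<Sum>k\<in>F. a k * u k x) = 0" for x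
      using a(1)[of x] False F by simp
    have ai: "a i \<noteq> 0"
    proof
      assume 0: "a i = 0"
      hence "(\<Sum>k\<in>F. a k * u k x) = 0" for x using s[of x] by simp
      from indep_famD[OF F(3) this] a(2,3) 0 show False by auto
    qed
    show ?thesis
    proof (intro exI[of _ "\<lambda>k. - a k / a i"] allI)
      fix x
      have "u i x = - (\<Sum>k\<in>F. a k * u k x) / a i"
        using s[of x] ai by (simp add: field_simps eq_neg_iff_add_eq_0)
      also have "\<dots> = (\<Sum>k\<in>F. - a k / a i * u k x)"
        by (simp add: sum_divide_distrib sum_negf)
      finally show "u i x = (\<Sum>k\<in>F. - a k / a i * u k x)" .
    qed
  qed
  with F that show thesis by blast
qed

lemma card_indep_fam_le_combinations:
  assumes "finite I" "finite J" "indep_fam I u"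
    and "\<And>i. i \<in> I \<Longrightarrow> \<exists>a. \<forall>x. u i x = (\<Sum>j\<in>J. a j * w j x)"
  shows "card I \<le> card J"
proof -
  from assms(4) obtain c where c: "\<And>i x. i \<in> I \<Longrightarrow> u i x = (\<Sum>j\<in>J. c i j * w j x)" by metis
  show ?thesis
  proof (rule card_indep_fam_le[where u = "\<lambda>i j. if j \<in> J then c i j else 0"])
    show "indep_fam I (\<lambda>i j. if j \<in> J then c i j else 0)"
    proof (rule indep_famI)
      fix a i assume z: "\<And>j. (\<Sum>i\<in>I. a i * (if j \<in> J then c i j else 0)) = 0" and i: "i \<in> I"
      have "(\<Sum>i\<in>I. a i * u i x) = 0" for x
      proof -
        have "(\<Sum>i\<in>I. a i * u i x) = (\<Sum>i\<in>I. \<Sum>j\<in>J. a i * c i j * w j x)"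
          by (intro sum.cong) (auto simp: c sum_distrib_left mult.assoc)
        also have "\<dots> = (\<Sum>j\<in>J. (\<Sum>i\<in>I. a i * c i j) * w j x)"
          by (subst sum.swap) (simp add: sum_distrib_right)
        also have "\<dots> = (\<Sum>j\<in>J. 0 * w j x)"
        proof (rule sum.cong[OF refl])
          fix j assume "j \<in> J"
          with z[of j] show "(\<Sum>i\<in>I. a i * c i j) * w j x = 0 * w j x" by simp
        qed
        finally show ?thesis by simp
      qed
      from indep_famD[OF assms(3) this i] show "a i = 0" .
    qed
  qed (use assms(1,2) in auto)
qed

section \<open>Linear independence among commuting upper triangular matrices\<close>

text \<open>
  The matrices \<open>a i\<close> commute when cut down to the rows and columns from \<open>p\<close> to \<open>q - 1\<close>. For upper
  triangular matrices cutting down to such a diagonal block is multiplicative, which allows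
  induction over blocks.
\<close>

definition comm_block :: "nat \<Rightarrow> nat \<Rightarrow> ('k \<Rightarrow> nat \<times> nat \<Rightarrow> complex) \<Rightarrow> 'k set \<Rightarrow> bool" where
  "comm_block p q a I \<longleftrightarrow> 
    (\<forall>i\<in>I. \<forall>j\<in>I. \<forall>r\<in>{p..<q}. \<forall>s\<in>{p..<q}.
      (\<Sum>t\<in>{p..<q}. a i (r,t) * a j (t,s)) = (\<Sum>t\<in>{p..<q}. a j (r,t) * a i (t,s)))"

definition block :: "nat \<Rightarrow> nat \<Rightarrow> (nat \<times> nat \<Rightarrow> complex) \<Rightarrow> nat \<times> nat \<Rightarrow> complex" where
  "block p q m x = (if fst x \<in> {p..<q} \<and> snd x \<in> {p..<q} then m x else 0)"

definition upper :: "(nat \<times> nat \<Rightarrow> complex) \<Rightarrow> bool" where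
  "upper m \<longleftrightarrow> (\<forall>r s. s < r \<longrightarrow> m (r, s) = 0)"

text \<open>
  Rank and nullity of a linear map \<open>f\<close> in terms of families: \<open>F\<close> counts the rank of \<open>f\<close> on the family,
  and each remaining member is corrected by a combination of members of \<open>F\<close> so as to lie in the kernel.
\<close>

lemma indep_fam_eliminate:
  assumes fin: "finite I" "finite X" and ind: "indep_fam I u" and supp: "\<And>i x. x \<notin> X \<Longrightarrow> f (u i) x = 0"
    and lin: "\<And>(c :: 'k \<Rightarrow> complex) J x. J \<subseteq> I \<Longrightarrow> f (\<lambda>x. \<Sum>j\<in>J. c j * u j x) x = (\<Sum>j\<in>J. c j * f (u j) x)"
  shows "\<exists>F K v c. F \<subseteq> I \<and> K = I - F \<and> indep_fam F (\<lambda>i. f (u i)) \<and> indep_fam K v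
    \<and> (\<forall>i\<in>K. v i = (\<lambda>x. \<Sum>j\<in>I. c i j * u j x)) \<and> (\<forall>i\<in>K. \<forall>x. f (v i) x = 0)"
proof -
  obtain F where F: "finite F" "F \<subseteq> I" "indep_fam F (\<lambda>i. f (u i))"
    "\<And>i. i \<in> I \<Longrightarrow> \<exists>a. \<forall>x. f (u i) x = (\<Sum>k\<in>F. a k * f (u k) x)"
    using maximal_indep_subfamily[of X I "\<lambda>i. f (u i)"] fin(2) supp by metis
  then obtain a where a: "\<And>i x. i \<in> I \<Longrightarrow> f (u i) x = (\<Sum>k\<in>F. a i k * f (u k) x)" by metis
  define c where "c = (\<lambda>i j. if j = i then 1 else if j \<in> F then - a i j else 0)"
  define v where "v = (\<lambda>i x. \<Sum>j\<in>I. c i j * u j x)"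
  have exp: "(\<Sum>j\<in>I. c i j * g j) = g i - (\<Sum>j\<in>F. a i j * g j)" if "i \<in> I - F" for i and g :: "'k \<Rightarrow> complex"
  proof -
    have "(\<Sum>j\<in>I. c i j * g j) = c i i * g i + (\<Sum>j\<in>I-{i}. c i j * g j)"
      using that by (intro sum.remove fin) auto
    also have "(\<Sum>j\<in>I-{i}. c i j * g j) = (\<Sum>j\<in>F. c i j * g j)"
      using that fin F by (intro sum.mono_neutral_right) (auto simp: c_def)
    also have "\<dots> = (\<Sum>j\<in>F. - (a i j * g j))"
      using that by (intro sum.cong) (auto simp: c_def)
    finally show ?thesis by (simp add: c_def sum_negf)
  qed
  have 1: "f (v i) x = 0" if "i \<in> I - F" for i x
    unfolding v_def using lin[of I "c i" x] exp[OF that, of "\<lambda>j. f (u j) x"] a[of i x] that by simp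
  have 2: "indep_fam (I - F) v"
  proof (rule indep_famI)
    fix b i assume z: "\<And>x. (\<Sum>i\<in>I - F. b i * v i x) = 0" and i: "i \<in> I - F"
    define e where "e = (\<lambda>j. \<Sum>i\<in>I - F. b i * c i j)"
    have "(\<Sum>j\<in>I. e j * u j x) = 0" for x
    proof -
      have "(\<Sum>i\<in>I - F. b i * v i x) = (\<Sum>i\<in>I - F. \<Sum>j\<in>I. b i * c i j * u j x)"
        by (simp add: v_def sum_distrib_left mult.assoc)
      also have "\<dots> = (\<Sum>j\<in>I. e j * u j x)"
        by (subst sum.swap) (simp add: e_def sum_distrib_right)
      finally show ?thesis using z by simp
    qed
    from indep_famD[OF ind this, of i] i have "e i = 0" by auto
    also have "e i = (\<Sum>j\<in>I-F. if j = i then b j else 0)"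
      unfolding e_def using i by (intro sum.cong) (auto simp: c_def)
    also have "\<dots> = b i" using i fin by simp
    finally show "b i = 0" .
  qed
  show ?thesis
    by (rule exI[of _ F], rule exI[of _ "I - F"], rule exI[of _ v], rule exI[of _ c])
       (use F(2,3) 1 2 v_def in \<open>blast\<close>)
qed

lemma comm_block_combination:
  fixes a :: "'k \<Rightarrow> nat \<times> nat \<Rightarrow> complex"
  assumes "comm_block p q a I" "finite I"
    and "\<forall>i\<in>K. v i = (\<lambda>x. \<Sum>j\<in>I. c i j * a j x)" "\<forall>i\<in>L. w i = (\<lambda>x. \<Sum>j\<in>I. e i j * a j x)"
    and "i \<in> K" "j \<in> L" "r \<in> {p..<q}" "s \<in> {p..<q}"
  shows "(\<Sum>t\<in>{p..<q}. v i (r,t) * w j (t,s)) = (\<Sum>t\<in>{p..<q}. w j (r,t) * v i (t,s))"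
proof -
  have swap3: "(\<Sum>t\<in>{p..<q}. \<Sum>k\<in>I. \<Sum>l\<in>I. x k l * y t k l)
      = (\<Sum>k\<in>I. \<Sum>l\<in>I. x k l * (\<Sum>t\<in>{p..<q}. y t k l))" for x :: "'k \<Rightarrow> 'k \<Rightarrow> complex" and y
    unfolding sum_distrib_left by (subst sum.swap, rule sum.cong[OF refl], rule sum.swap)
  have "(\<Sum>t\<in>{p..<q}. v i (r,t) * w j (t,s))
      = (\<Sum>t\<in>{p..<q}. \<Sum>k\<in>I. \<Sum>l\<in>I. c i k * e j l * (a k (r,t) * a l (t,s)))"
  proof (rule sum.cong[OF refl])
    fix t
    have "v i (r,t) * w j (t,s) = (\<Sum>k\<in>I. c i k * a k (r,t)) * (\<Sum>l\<in>I. e j l * a l (t,s))"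
      using assms(3-6) by simp
    thus "v i (r,t) * w j (t,s) = (\<Sum>k\<in>I. \<Sum>l\<in>I. c i k * e j l * (a k (r,t) * a l (t,s)))"
      by (simp only: sum_product mult.assoc mult.left_commute mult.commute)
  qed
  also have "\<dots> = (\<Sum>k\<in>I. \<Sum>l\<in>I. c i k * e j l * (\<Sum>t\<in>{p..<q}. a k (r,t) * a l (t,s)))"
    by (rule swap3[of "\<lambda>k l. c i k * e j l" "\<lambda>t k l. a k (r,t) * a l (t,s)"])
  also have "\<dots> = (\<Sum>k\<in>I. \<Sum>l\<in>I. c i k * e j l * (\<Sum>t\<in>{p..<q}. a l (r,t) * a k (t,s)))"
  proof (intro sum.cong refl)
    fix k l assume "k \<in> I" "l \<in> I"
    with assms(1,7,8) have "(\<Sum>t\<in>{p..<q}. a k (r,t) * a l (t,s)) = (\<Sum>t\<in>{p..<q}. a l (r,t) * a k (t,s))"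
      unfolding comm_block_def by blast
    thus "c i k * e j l * (\<Sum>t\<in>{p..<q}. a k (r,t) * a l (t,s))
      = c i k * e j l * (\<Sum>t\<in>{p..<q}. a l (r,t) * a k (t,s))" by simp
  qed
  also have "\<dots> = (\<Sum>t\<in>{p..<q}. \<Sum>k\<in>I. \<Sum>l\<in>I. c i k * e j l * (a l (r,t) * a k (t,s)))"
    by (rule swap3[of "\<lambda>k l. c i k * e j l" "\<lambda>t k l. a l (r,t) * a k (t,s)", symmetric])
  also have "\<dots> = (\<Sum>t\<in>{p..<q}. w j (r,t) * v i (t,s))"
  proof (rule sum.cong[OF refl])
    fix t
    have "w j (r,t) * v i (t,s) = (\<Sum>l\<in>I. e j l * a l (r,t)) * (\<Sum>k\<in>I. c i k * a k (t,s))"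
      using assms(3-6) by simp
    also have "\<dots> = (\<Sum>l\<in>I. \<Sum>k\<in>I. c i k * e j l * (a l (r,t) * a k (t,s)))"
      unfolding sum_product by (simp only: mult_ac)
    finally have "w j (r,t) * v i (t,s) = (\<Sum>l\<in>I. \<Sum>k\<in>I. c i k * e j l * (a l (r,t) * a k (t,s)))" .
    thus "(\<Sum>k\<in>I. \<Sum>l\<in>I. c i k * e j l * (a l (r,t) * a k (t,s))) = w j (r,t) * v i (t,s)"
      by (subst sum.swap) simp
  qed
  finally show ?thesis .
qed

lemma quarter_square_step:
  fixes c m :: nat
  assumes "2 * c \<le> 2 * ((m + 1)\<^sup>2 div 4 + 1) + (m + 2)"
  shows "c \<le> (m + 2)\<^sup>2 div 4 + 1"
proof (cases "even m")
  case True
  then obtain j where j: "m = 2 * j" by (elim evenE)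
  have 1: "(m + 1)\<^sup>2 = 4 * (j\<^sup>2 + j) + 1" "(m + 2)\<^sup>2 = 4 * (j + 1)\<^sup>2"
    by (simp_all add: j power2_eq_square algebra_simps)
  have 2: "(m + 1)\<^sup>2 div 4 = j\<^sup>2 + j" "(m + 2)\<^sup>2 div 4 = (j + 1)\<^sup>2"
    unfolding 1 by simp_all
  show ?thesis using assms unfolding 2 by (simp add: j power2_eq_square)
next
  case False
  then obtain j where j: "m = 2 * j + 1" by (elim oddE)
  have 1: "(m + 1)\<^sup>2 = 4 * (j + 1)\<^sup>2" "(m + 2)\<^sup>2 = 4 * (j\<^sup>2 + 3 * j + 2) + 1"
    by (simp_all add: j power2_eq_square algebra_simps)
  have 2: "(m + 1)\<^sup>2 div 4 = (j + 1)\<^sup>2" "(m + 2)\<^sup>2 div 4 = j\<^sup>2 + 3 * j + 2"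
    unfolding 1 by simp_all
  show ?thesis using assms unfolding 2 by (simp add: j power2_eq_square)
qed

lemma comm_block_subset: "comm_block p q a I \<Longrightarrow> J \<subseteq> I \<Longrightarrow> comm_block p q a J"
  unfolding comm_block_def by blast

lemma comm_block_drop_first:
  assumes "comm_block p q a I" "\<And>i. i \<in> I \<Longrightarrow> upper (a i)"
  shows "comm_block (Suc p) q a I"
  unfolding comm_block_def
proof (intro ballI)
  fix i j r s assume i: "i \<in> I" and j: "j \<in> I" and r: "r \<in> {Suc p..<q}" and s: "s \<in> {Suc p..<q}"
  have *: "(\<Sum>t\<in>{Suc p..<q}. a i (r,t) * a j (t,s)) = (\<Sum>t\<in>{p..<q}. a i (r,t) * a j (t,s))"
    if "i \<in> I" "j \<in> I" for i j
    using r s assms(2)[OF that(1)] by (intro sum.mono_neutral_left) (auto simp: upper_def)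
  show "(\<Sum>t\<in>{Suc p..<q}. a i (r,t) * a j (t,s)) = (\<Sum>t\<in>{Suc p..<q}. a j (r,t) * a i (t,s))"
    unfolding *[OF i j] *[OF j i] using assms(1) i j r s unfolding comm_block_def by simp
qed

lemma comm_block_drop_last:
  assumes "comm_block p (Suc q) a I" "\<And>i. i \<in> I \<Longrightarrow> upper (a i)"
  shows "comm_block p q a I"
  unfolding comm_block_def
proof (intro ballI)
  fix i j r s assume i: "i \<in> I" and j: "j \<in> I" and r: "r \<in> {p..<q}" and s: "s \<in> {p..<q}"
  have *: "(\<Sum>t\<in>{p..<q}. a i (r,t) * a j (t,s)) = (\<Sum>t\<in>{p..<Suc q}. a i (r,t) * a j (t,s))"
    if "i \<in> I" "j \<in> I" for i j
    using r s assms(2)[OF that(2)] by (intro sum.mono_neutral_left) (auto simp: upper_def not_less)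
  show "(\<Sum>t\<in>{p..<q}. a i (r,t) * a j (t,s)) = (\<Sum>t\<in>{p..<q}. a j (r,t) * a i (t,s))"
    unfolding *[OF i j] *[OF j i] using assms(1) i j r s unfolding comm_block_def by simp
qed

lemma comm_block_block:
  assumes "comm_block p q a I"
  shows "comm_block p q (\<lambda>i. block p q (a i)) I"
  using assms unfolding comm_block_def block_def by simp

text \<open>
  Two subspaces that are orthogonal for the bilinear form \<open>\<Sum>t. v t * w t\<close>. Conjugating the first
  makes them orthogonal for the inner product, and their sum is then direct.
\<close>

lemma card_orthogonal_indep_le:
  fixes v :: "'k \<Rightarrow> nat \<Rightarrow> complex" and w :: "'l \<Rightarrow> nat \<Rightarrow> complex"
  assumes fin: "finite X" "finite K" "finite L" and ind: "indep_fam K v" "indep_fam L w"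
    and supp: "\<And>i t. i \<in> K \<Longrightarrow> t \<notin> X \<Longrightarrow> v i t = 0" "\<And>i t. i \<in> L \<Longrightarrow> t \<notin> X \<Longrightarrow> w i t = 0"
    and orth: "\<And>i j. i \<in> K \<Longrightarrow> j \<in> L \<Longrightarrow> (\<Sum>t\<in>X. v i t * w j t) = 0"
  shows "card K + card L \<le> card X"
proof -
  define g where "g = case_sum (\<lambda>i t. cnj (v i t)) w"
  have "card (K <+> L) \<le> card X"
  proof (rule card_indep_fam_le[OF fin(1), where u = g])
    show "finite (K <+> L)" using fin by simp
    show "g i x = 0" if "i \<in> K <+> L" "x \<notin> X" for i x
      using that supp by (auto simp: g_def)
    show "indep_fam (K <+> L) g"
    proof (rule indep_famI)
      fix a i assume z: "\<And>t. (\<Sum>i\<in>K <+> L. a i * g i t) = 0" and i: "i \<in> K <+> L"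
      define x where "x = (\<lambda>t. \<Sum>i\<in>K. a (Inl i) * cnj (v i t))"
      define y where "y = (\<lambda>t. \<Sum>j\<in>L. a (Inr j) * w j t)"
      have xy: "x t = - y t" for t
        using z[of t] fin by (simp add: sum.Plus g_def x_def y_def eq_neg_iff_add_eq_0)
      have "(\<Sum>t\<in>X. cnj (x t) * y t)
          = (\<Sum>t\<in>X. \<Sum>i\<in>K. \<Sum>j\<in>L. cnj (a (Inl i)) * a (Inr j) * (v i t * w j t))"
        unfolding x_def y_def cnj_sum sum_product by (simp add: mult_ac)
      also have "\<dots> = (\<Sum>i\<in>K. \<Sum>j\<in>L. cnj (a (Inl i)) * a (Inr j) * (\<Sum>t\<in>X. v i t * w j t))"
        unfolding sum_distrib_left by (subst sum.swap, rule sum.cong[OF refl], rule sum.swap)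
      also have "\<dots> = 0" by (simp add: orth)
      finally have "(\<Sum>t\<in>X. cnj (x t) * x t) = 0" by (simp add: xy sum_negf)
      also have "(\<Sum>t\<in>X. cnj (x t) * x t) = of_real (\<Sum>t\<in>X. (cmod (x t))\<^sup>2)"
        by (simp add: mult.commute[of "cnj _"] flip: complex_norm_square)
      finally have "(\<Sum>t\<in>X. (cmod (x t))\<^sup>2) = 0" using of_real_eq_0_iff by blast
      hence xX: "x t = 0" if "t \<in> X" for t
        using that fin(1) by (simp add: sum_nonneg_eq_0_iff)
      have x0: "x t = 0" for t
        by (cases "t \<in> X") (use xX supp(1) in \<open>auto simp: x_def intro!: sum.neutral\<close>)
      hence y0: "y t = 0" for t using xy[of t] by simp
      have "(\<Sum>i\<in>K. cnj (a (Inl i)) * v i t) = 0" for t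
        using arg_cong[OF x0[of t], of cnj] by (simp add: x_def)
      from indep_famD[OF ind(1) this] indep_famD[OF ind(2), of "\<lambda>j. a (Inr j)"] y0 i
      show "a i = 0" by (auto simp: y_def)
    qed
  qed
  thus ?thesis using fin by (simp add: card_Plus)
qed

text \<open>
  Schur's bound, by Mirzakhani's induction. Deleting the first row and column leaves a commuting family
  of smaller matrices, and what this loses is a space of matrices with
  only the first row nonzero. Likewise for the last row and column, with matrices that have only the last
  column nonzero. A product of the first kind with the second kind is a single
  corner entry, the product in the other order is 0, and the two commute; so these rows are orthogonal to these
  columns, and the two losses add up to at most the size of the block.
\<close>

theorem card_commuting_upper_indep_le:
  assumes "finite I" "comm_block p (p + n) a I" "\<And>i. i \<in> I \<Longrightarrow> upper (a i)"
    and "indep_fam I (\<lambda>i. block p (p + n) (a i))"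
  shows "card I \<le> n\<^sup>2 div 4 + 1"
  using assms
proof (induction n arbitrary: p I)
  case 0
  have "card I \<le> card ({} :: (nat \<times> nat) set)"
    by (rule card_indep_fam_le[OF _ 0(1,4)]) (auto simp: block_def)
  thus ?case by simp
next
  case (Suc n')
  show ?case
  proof (cases n')
    case 0
    have "card I \<le> card {(p,p)}"
      by (rule card_indep_fam_le[OF _ Suc.prems(1,4)]) (auto simp: block_def 0)
    thus ?thesis by simp
  next
    case (Suc m)
    define q where "q = p + n'"
    have q: "p + Suc n' = Suc q" "q = Suc (p + m)" using Suc by (auto simp: q_def)
    note fin = Suc.prems(1)
    define b where "b = (\<lambda>i. block p (Suc q) (a i))"
    have ind: "indep_fam I b" using Suc.prems(4) by (simp add: b_def q_def)
    have cb: "comm_block p (Suc q) b I"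
      using comm_block_block[OF Suc.prems(2)] by (simp add: b_def q_def)
    have ca: "comm_block p (Suc q) a I" using Suc.prems(2) by (simp add: q_def)
    have block_sum: "block p' q' (\<lambda>x. \<Sum>j\<in>J. c j * b j x) x = (\<Sum>j\<in>J. c j * block p' q' (b j) x)"
      for p' q' J c x by (cases "fst x \<in> {p'..<q'} \<and> snd x \<in> {p'..<q'}") (auto simp: block_def)
    have supp: "block p' q' (b i) x = 0" if "x \<notin> {p..<Suc q} \<times> {p..<Suc q}" for p' q' i x
      using that by (cases x) (auto simp: block_def b_def)
    have finX: "finite ({p..<Suc q} \<times> {p..<Suc q})" by simp
    obtain F K v c where 1: "F \<subseteq> I" "K = I - F" "indep_fam F (\<lambda>i. block (Suc p) (Suc q) (b i))"
        "indep_fam K v" "\<forall>i\<in>K. v i = (\<lambda>x. \<Sum>j\<in>I. c i j * b j x)"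
        "\<forall>i\<in>K. \<forall>x. block (Suc p) (Suc q) (v i) x = 0"
      using indep_fam_eliminate[of I _ b "block (Suc p) (Suc q)", OF fin finX ind supp block_sum] by blast
    obtain G L w e where 2: "G \<subseteq> I" "L = I - G" "indep_fam G (\<lambda>i. block p q (b i))"
        "indep_fam L w" "\<forall>i\<in>L. w i = (\<lambda>x. \<Sum>j\<in>I. e i j * b j x)"
        "\<forall>i\<in>L. \<forall>x. block p q (w i) x = 0"
      using indep_fam_eliminate[of I _ b "block p q", OF fin finX ind supp block_sum] by blast
    have finFG: "finite F" "finite G" using 1(1) 2(1) fin finite_subset by auto
    have bF: "(\<lambda>i. block (Suc p) (Suc q) (b i)) = (\<lambda>i. block (Suc p) (Suc p + n') (a i))"
      by (auto simp: b_def block_def fun_eq_iff q_def)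
    have bG: "(\<lambda>i. block p q (b i)) = (\<lambda>i. block p (p + n') (a i))"
      by (auto simp: b_def block_def fun_eq_iff q_def)
    have cF: "card F \<le> n'\<^sup>2 div 4 + 1"
    proof (rule Suc.IH[OF finFG(1), of "Suc p"])
      show "comm_block (Suc p) (Suc p + n') a F"
        using comm_block_subset[OF comm_block_drop_first[OF ca Suc.prems(3)] 1(1)] by (simp add: q_def)
    qed (use 1 Suc.prems(3) bF in auto)
    have cG: "card G \<le> n'\<^sup>2 div 4 + 1"
    proof (rule Suc.IH[OF finFG(2), of p])
      show "comm_block p (p + n') a G"
        using comm_block_subset[OF comm_block_drop_last[OF ca Suc.prems(3)] 2(1)] by (simp add: q_def)
    qed (use 2 Suc.prems(3) bG in auto)
    have v0: "v i (r, t) = 0" if "i \<in> K" "r \<noteq> p \<or> t \<notin> {p..<Suc q}" for i r t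
    proof (cases "r \<in> {Suc p..<Suc q} \<and> t \<in> {Suc p..<Suc q}")
      case True
      thus ?thesis using 1(6) that(1) by (auto simp: block_def split: if_splits)
    next
      case False
      have "b j (r, t) = 0" if "j \<in> I" for j
        using Suc.prems(3)[OF that] False \<open>r \<noteq> p \<or> _\<close> by (auto simp: b_def block_def upper_def)
      thus ?thesis using 1(5) that(1) by simp
    qed
    have w0: "w i (r, t) = 0" if "i \<in> L" "t \<noteq> q \<or> r \<notin> {p..<Suc q}" for i r t
    proof (cases "r \<in> {p..<q} \<and> t \<in> {p..<q}")
      case True
      thus ?thesis using 2(6) that(1) by (auto simp: block_def split: if_splits)
    next
      case False
      have "b j (r, t) = 0" if "j \<in> I" for j
        using Suc.prems(3)[OF that] False \<open>t \<noteq> q \<or> _\<close> by (auto simp: b_def block_def upper_def)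
      thus ?thesis using 2(5) that(1) by simp
    qed
    have "card K + card L \<le> card {p..<Suc q}"
    proof (rule card_orthogonal_indep_le)
      show "indep_fam K (\<lambda>i t. v i (p, t))"
      proof (rule indep_famI)
        fix a i assume z: "\<And>t. (\<Sum>i\<in>K. a i * v i (p, t)) = 0" and i: "i \<in> K"
        have "(\<Sum>i\<in>K. a i * v i x) = 0" for x
          using z[of "snd x"] v0 by (cases x; cases "fst x = p") (auto intro!: sum.neutral)
        from indep_famD[OF 1(4) this i] show "a i = 0" .
      qed
      show "indep_fam L (\<lambda>i t. w i (t, q))"
      proof (rule indep_famI)
        fix a i assume z: "\<And>t. (\<Sum>i\<in>L. a i * w i (t, q)) = 0" and i: "i \<in> L"
        have "(\<Sum>i\<in>L. a i * w i x) = 0" for x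
          using z[of "fst x"] w0 by (cases x; cases "snd x = q") (auto intro!: sum.neutral)
        from indep_famD[OF 2(4) this i] show "a i = 0" .
      qed
      fix i j assume i: "i \<in> K" and j: "j \<in> L"
      have "(\<Sum>t\<in>{p..<Suc q}. v i (p,t) * w j (t,q)) = (\<Sum>t\<in>{p..<Suc q}. w j (p,t) * v i (t,q))"
        by (rule comm_block_combination[OF cb fin 1(5) 2(5) i j]) (auto simp: q)
      also have "\<dots> = 0"
      proof (rule sum.neutral, intro ballI)
        fix t assume "t \<in> {p..<Suc q}"
        show "w j (p,t) * v i (t,q) = 0"
          using v0[OF i, of t q] w0[OF j, of t p] q(2) by (cases "t = p") auto
      qed
      finally show "(\<Sum>t\<in>{p..<Suc q}. v i (p,t) * w j (t,q)) = 0" .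
    qed (use v0 w0 fin 1(2) 2(2) in auto)
    hence "card K + card L \<le> m + 2" by (simp add: q)
    moreover have "card I = card F + card K" "card I = card G + card L"
      using 1(1,2) 2(1,2) fin finFG by (auto simp: card_Diff_subset card_mono)
    ultimately have "2 * card I \<le> 2 * ((m + 1)\<^sup>2 div 4 + 1) + (m + 2)"
      using cF cG Suc by simp
    from quarter_square_step[OF this] show ?thesis using Suc by simp
  qed
qed

section \<open>Simultaneous triangularization of commuting matrices\<close>

definition lin_subspace :: "('i \<Rightarrow> complex) set \<Rightarrow> bool" where
  "lin_subspace E \<longleftrightarrow> (\<lambda>_. 0) \<in> E \<and> (\<forall>x\<in>E. \<forall>y\<in>E. \<forall>a b. (\<lambda>i. a * x i + b * y i) \<in> E)"

definition lin_map :: "(('i \<Rightarrow> complex) \<Rightarrow> 'j \<Rightarrow> complex) \<Rightarrow> bool" where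
  "lin_map G \<longleftrightarrow> (\<forall>x y a b. G (\<lambda>i. a * x i + b * y i) = (\<lambda>i. a * G x i + b * G y i))"

lemma lin_subspace_combine:
  "lin_subspace E \<Longrightarrow> x \<in> E \<Longrightarrow> y \<in> E \<Longrightarrow> (\<lambda>i. a * x i + b * y i) \<in> E"
  unfolding lin_subspace_def by blast

lemma lin_subspace_scale:
  assumes "lin_subspace E" "x \<in> E"
  shows "(\<lambda>i. a * x i) \<in> E"
  using lin_subspace_combine[OF assms assms(2), of a 0] by simp

lemma lin_subspace_diff_scale:
  assumes "lin_subspace E" "x \<in> E" "y \<in> E"
  shows "(\<lambda>i. x i - c * y i) \<in> E"
  using lin_subspace_combine[OF assms, of 1 "-c"] by simp

lemma lin_subspace_sum:
  assumes "lin_subspace E" "\<And>k. k \<in> F \<Longrightarrow> x k \<in> E"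
  shows "(\<lambda>i. \<Sum>k\<in>F. a k * x k i) \<in> E"
  using assms(2)
proof (induction F rule: infinite_finite_induct)
  case (insert k F)
  have "(\<lambda>i. a k * x k i + 1 * (\<Sum>k\<in>F. a k * x k i)) \<in> E"
    by (rule lin_subspace_combine[OF assms(1)]) (use insert in auto)
  thus ?case using insert by simp
qed (use assms(1) in \<open>auto simp: lin_subspace_def\<close>)

lemma lin_mapD: "lin_map G \<Longrightarrow> G (\<lambda>i. a * x i + b * y i) = (\<lambda>i. a * G x i + b * G y i)"
  unfolding lin_map_def by blast

lemma lin_map_diff_scale: "lin_map G \<Longrightarrow> G (\<lambda>i. x i - c * y i) = (\<lambda>i. G x i - c * G y i)"
  using lin_mapD[of G 1 x "-c" y] by simp

lemma lin_map_funpow_diff_scale: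
  fixes G :: "('i \<Rightarrow> complex) \<Rightarrow> 'i \<Rightarrow> complex"
  shows "lin_map G \<Longrightarrow> (G ^^ k) (\<lambda>i. x i - c * y i) = (\<lambda>i. (G ^^ k) x i - c * (G ^^ k) y i)"
  by (induction k) (auto simp: lin_map_diff_scale)

definition poly_op :: "(('i \<Rightarrow> complex) \<Rightarrow> 'i \<Rightarrow> complex) \<Rightarrow> complex poly \<Rightarrow> ('i \<Rightarrow> complex) \<Rightarrow> 'i \<Rightarrow> complex"
  where "poly_op G p v = (\<lambda>i. \<Sum>k\<le>degree p. coeff p k * (G ^^ k) v i)"

lemma poly_op_bound:
  assumes "degree p \<le> N"
  shows "poly_op G p v i = (\<Sum>k\<le>N. coeff p k * (G ^^ k) v i)"
  unfolding poly_op_def using assms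
  by (intro sum.mono_neutral_left) (auto simp: coeff_eq_0)

text \<open>
  Splitting a linear factor off an annihilating polynomial replaces \<open>v\<close> by \<open>G v - c * v\<close>.
\<close>

lemma poly_op_linear_factor:
  assumes "lin_map G"
  shows "poly_op G ([:-c, 1:] * q) v = poly_op G q (\<lambda>i. G v i - c * v i)"
proof
  fix i
  let ?N = "degree q"
  have "poly_op G ([:-c, 1:] * q) v i
      = (\<Sum>k\<le>Suc ?N. coeff (pCons 0 q - Polynomial.smult c q) k * (G ^^ k) v i)"
  proof -
    have "degree ([:-c, 1:] * q) \<le> Suc ?N" by (rule order.trans[OF degree_mult_le]) simp
    moreover have "[:-c, 1:] * q = pCons 0 q - Polynomial.smult c q" by simp
    ultimately show ?thesis by (simp only: poly_op_bound)
  qed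
  also have "\<dots> = (\<Sum>k\<le>Suc ?N. coeff (pCons 0 q) k * (G ^^ k) v i)
      - c * (\<Sum>k\<le>Suc ?N. coeff q k * (G ^^ k) v i)"
    by (simp only: coeff_diff coeff_smult left_diff_distrib sum_subtractf sum_distrib_left mult.assoc)
  also have "(\<Sum>k\<le>Suc ?N. coeff (pCons 0 q) k * (G ^^ k) v i)
      = (\<Sum>k\<le>?N. coeff q k * (G ^^ k) (G v) i)"
    by (subst sum.atMost_Suc_shift) (simp add: funpow_swap1)
  also have "(\<Sum>k\<le>Suc ?N. coeff q k * (G ^^ k) v i) = (\<Sum>k\<le>?N. coeff q k * (G ^^ k) v i)"
    by (simp add: coeff_eq_0)
  also have "(\<Sum>k\<le>?N. coeff q k * (G ^^ k) (G v) i) - c * (\<Sum>k\<le>?N. coeff q k * (G ^^ k) v i)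
     = poly_op G q (\<lambda>i. G v i - c * v i) i"
    unfolding poly_op_def lin_map_funpow_diff_scale[OF assms]
    by (simp add: sum_distrib_left right_diff_distrib sum_subtractf mult_ac)
  finally show "poly_op G ([:-c, 1:] * q) v i = poly_op G q (\<lambda>i. G v i - c * v i) i" .
qed

text \<open>
  An eigenvector in the quotient \<open>E / W\<close>, without forming quotients: apply the linear
  factors of the polynomial one after the other until the vector drops into \<open>W\<close>.
\<close>

lemma eigenvector_mod_subspace_poly:
  assumes G: "lin_map G" and E: "lin_subspace E" "\<And>x. x \<in> E \<Longrightarrow> G x \<in> E" and W: "lin_subspace W"
  shows "p \<noteq> 0 \<Longrightarrow> v \<in> E \<Longrightarrow> v \<notin> W \<Longrightarrow> poly_op G p v \<in> W
    \<Longrightarrow> \<exists>u c. u \<in> E \<and> u \<notin> W \<and> (\<lambda>i. G u i - c * u i) \<in> W"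
proof (induction "degree p" arbitrary: p v)
  case 0
  then obtain a where a: "p = [:a:]" "a \<noteq> 0" by (metis degree_eq_zeroE pCons_0_0)
  from lin_subspace_scale[OF W 0(5), of "1/a"] have "v \<in> W"
    by (simp add: poly_op_def a)
  with 0 show ?case by simp
next
  case (Suc m)
  hence "\<not> constant (poly p)" by (simp add: constant_degree)
  then obtain c where "poly p c = 0" using fundamental_theorem_of_algebra by blast
  then obtain q where q: "p = [:-c, 1:] * q" by (auto simp: poly_eq_0_iff_dvd)
  hence q0: "q \<noteq> 0" using Suc.prems(1) by auto
  have dq: "degree q = m" using Suc.hyps(2) q0 unfolding q by (subst (asm) degree_mult_eq) auto
  show ?case
  proof (cases "(\<lambda>i. G v i - c * v i) \<in> W")
    case True thus ?thesis using Suc.prems by blast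
  next
    case False
    show ?thesis
    proof (rule Suc.hyps(1)[OF dq[symmetric] q0 _ False])
      show "(\<lambda>i. G v i - c * v i) \<in> E"
        by (rule lin_subspace_diff_scale[OF E(1)]) (use Suc.prems E in auto)
      show "poly_op G q (\<lambda>i. G v i - c * v i) \<in> W"
        using Suc.prems(4) unfolding q poly_op_linear_factor[OF G] .
    qed
  qed
qed

lemma eigenvector_mod_subspace:
  fixes E W :: "(nat \<Rightarrow> complex) set"
  assumes G: "lin_map G" and E: "lin_subspace E" "\<And>x. x \<in> E \<Longrightarrow> G x \<in> E" "E \<subseteq> cspace n"
    and W: "lin_subspace W" and v: "v \<in> E" "v \<notin> W"
  obtains u c where "u \<in> E" "u \<notin> W" "(\<lambda>i. G u i - c * u i) \<in> W"
proof -
  have GE: "(G ^^ k) v \<in> E" for k by (induction k) (use E v in auto)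
  have "\<not> indep_fam {..n} (\<lambda>k. (G ^^ k) v)"
  proof
    assume "indep_fam {..n} (\<lambda>k. (G ^^ k) v)"
    from card_indep_fam_le[OF _ _ this, of "{..<n}"] GE E(3) show False
      by (auto simp: cspace_def subset_eq)
  qed
  then obtain a j where a: "\<And>x. (\<Sum>k\<in>{..n}. a k * (G ^^ k) v x) = 0" "j \<le> n" "a j \<noteq> 0"
    unfolding indep_fam_def by auto
  define p where "p = (\<Sum>k\<le>n. monom (a k) k)"
  have cp: "coeff p k = (if k \<le> n then a k else 0)" for k
    unfolding p_def by (simp add: coeff_sum)
  have "coeff p j \<noteq> 0" using a cp by simp
  hence p0: "p \<noteq> 0" by auto
  have "degree p \<le> n" by (rule degree_le) (simp add: cp)
  hence "poly_op G p v = (\<lambda>_. 0)"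
    using a(1) by (auto simp: poly_op_bound cp fun_eq_iff)
  hence "poly_op G p v \<in> W" using W by (simp add: lin_subspace_def)
  from eigenvector_mod_subspace_poly[OF G E(1,2) W p0 v this] that show thesis by blast
qed

definition mat_vec :: "nat \<Rightarrow> (nat \<Rightarrow> nat \<Rightarrow> complex) \<Rightarrow> (nat \<Rightarrow> complex) \<Rightarrow> nat \<Rightarrow> complex" where
  "mat_vec n M x = (\<lambda>i. if i < n then \<Sum>j<n. M i j * x j else 0)"

lemma lin_map_mat_vec: "lin_map (mat_vec n M)"
  unfolding lin_map_def mat_vec_def
  by (auto simp: fun_eq_iff sum_distrib_left sum.distrib[symmetric] algebra_simps)

lemma mat_vec_cspace: "mat_vec n M x \<in> cspace n"
  by (simp add: mat_vec_def cspace_def)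

lemma lin_subspace_cspace: "lin_subspace (cspace n)"
  by (simp add: lin_subspace_def cspace_def)

lemma mat_vec_mat_vec:
  "mat_vec n M (mat_vec n N x) = (\<lambda>i. if i < n then \<Sum>k<n. (\<Sum>j<n. M i j * N j k) * x k else 0)"
proof
  fix i
  have "(\<Sum>j<n. M i j * (\<Sum>k<n. N j k * x k)) = (\<Sum>k<n. (\<Sum>j<n. M i j * N j k) * x k)"
    unfolding sum_distrib_left sum_distrib_right by (subst sum.swap) (simp add: mult.assoc)
  thus "mat_vec n M (mat_vec n N x) i = (if i < n then \<Sum>k<n. (\<Sum>j<n. M i j * N j k) * x k else 0)"
    by (simp add: mat_vec_def)
qed

locale commuting_family =
  fixes n :: nat and S :: "'f set" and A :: "'f \<Rightarrow> nat \<Rightarrow> nat \<Rightarrow> complex"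
  assumes commute: "f \<in> S \<Longrightarrow> g \<in> S \<Longrightarrow> i < n \<Longrightarrow> k < n
    \<Longrightarrow> (\<Sum>j<n. A f i j * A g j k) = (\<Sum>j<n. A g i j * A f j k)"
begin

abbreviation "ap f \<equiv> mat_vec n (A f)"

lemma ap_commute: "f \<in> S \<Longrightarrow> g \<in> S \<Longrightarrow> ap f (ap g x) = ap g (ap f x)"
  unfolding mat_vec_mat_vec by (auto simp: fun_eq_iff commute)

text \<open>
  The joint eigenspace of the operators treated so far, taken modulo \<open>W\<close>, is invariant under the next
  operator because they commute.
\<close>

lemma joint_eigenvector_mod_finite:
  assumes W: "lin_subspace W" "\<And>f x. f \<in> S \<Longrightarrow> x \<in> W \<Longrightarrow> ap f x \<in> W"
    and v: "v \<in> cspace n" "v \<notin> W" and F: "finite F" "F \<subseteq> S"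
  shows "\<exists>u c. u \<in> cspace n \<and> u \<notin> W \<and> (\<forall>f\<in>F. (\<lambda>i. ap f u i - c f * u i) \<in> W)"
  using F
proof (induction F rule: finite_induct)
  case empty thus ?case using v by auto
next
  case (insert g F)
  then obtain u c where u: "u \<in> cspace n" "u \<notin> W" "\<forall>f\<in>F. (\<lambda>i. ap f u i - c f * u i) \<in> W"
    by auto
  define E where "E = {x \<in> cspace n. \<forall>f\<in>F. (\<lambda>i. ap f x i - c f * x i) \<in> W}"
  have E1: "lin_subspace E"
    unfolding lin_subspace_def
  proof (intro conjI ballI allI)
    have "ap f (\<lambda>_. 0) = (\<lambda>_. 0)" for f by (auto simp: mat_vec_def)
    thus "(\<lambda>_. 0) \<in> E" using W(1) by (simp add: E_def cspace_def lin_subspace_def)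
    fix x y a b assume xy: "x \<in> E" "y \<in> E"
    have "(\<lambda>i. ap f (\<lambda>i. a * x i + b * y i) i - c f * (a * x i + b * y i)) \<in> W" if "f \<in> F" for f
    proof -
      have "(\<lambda>i. a * (ap f x i - c f * x i) + b * (ap f y i - c f * y i)) \<in> W"
        by (rule lin_subspace_combine[OF W(1)]) (use xy that in \<open>auto simp: E_def\<close>)
      thus ?thesis unfolding lin_mapD[OF lin_map_mat_vec] by (simp add: algebra_simps)
    qed
    thus "(\<lambda>i. a * x i + b * y i) \<in> E"
      using xy lin_subspace_combine[OF lin_subspace_cspace] by (simp add: E_def)
  qed
  have E2: "ap g x \<in> E" if x: "x \<in> E" for x
    unfolding E_def
  proof (intro CollectI conjI ballI mat_vec_cspace)
    fix f assume f: "f \<in> F"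
    have "ap g (\<lambda>i. ap f x i - c f * x i) \<in> W"
      using x f insert.prems by (intro W(2)) (auto simp: E_def)
    thus "(\<lambda>i. ap f (ap g x) i - c f * ap g x i) \<in> W"
      using f insert.prems ap_commute[of f g] by (simp add: lin_map_diff_scale[OF lin_map_mat_vec] subset_eq)
  qed
  obtain u' c' where u': "u' \<in> E" "u' \<notin> W" "(\<lambda>i. ap g u' i - c' * u' i) \<in> W"
    by (rule eigenvector_mod_subspace[OF lin_map_mat_vec E1 E2 _ W(1), of n u])
       (use u in \<open>auto simp: E_def\<close>)
  show ?case
    by (rule exI[of _ u'], rule exI[of _ "c(g := c')"])
       (use u' insert.hyps in \<open>auto simp: E_def\<close>)
qed

text \<open>
  Finitely many of the matrices span all of them, and a joint eigenvector of these is one of all.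
\<close>

lemma joint_eigenvector_mod:
  assumes W: "lin_subspace W" "\<And>f x. f \<in> S \<Longrightarrow> x \<in> W \<Longrightarrow> ap f x \<in> W"
    and v: "v \<in> cspace n" "v \<notin> W"
  obtains u where "u \<in> cspace n" "u \<notin> W" "\<And>f. f \<in> S \<Longrightarrow> \<exists>c. (\<lambda>i. ap f u i - c * u i) \<in> W"
proof -
  define m where "m = (\<lambda>f (i, j). if i < n \<and> j < n then A f i j else 0)"
  obtain F where F: "finite F" "F \<subseteq> S" "\<And>f. f \<in> S \<Longrightarrow> \<exists>a. \<forall>x. m f x = (\<Sum>k\<in>F. a k * m k x)"
    by (rule maximal_indep_subfamily[of "{..<n} \<times> {..<n}" S m]) (auto simp: m_def split: if_splits)
  obtain u c where u: "u \<in> cspace n" "u \<notin> W" "\<And>f. f \<in> F \<Longrightarrow> (\<lambda>i. ap f u i - c f * u i) \<in> W"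
    using joint_eigenvector_mod_finite[OF W v F(1,2)] by blast
  have "\<exists>c. (\<lambda>i. ap f u i - c * u i) \<in> W" if f: "f \<in> S" for f
  proof -
    obtain a where a: "\<And>x. m f x = (\<Sum>k\<in>F. a k * m k x)" using F(3)[OF f] by blast
    have a': "A f i j = (\<Sum>k\<in>F. a k * A k i j)" if "i < n" "j < n" for i j
      using a[of "(i,j)"] that by (simp add: m_def)
    have ap: "ap f u i = (\<Sum>k\<in>F. a k * ap k u i)" for i
    proof (cases "i < n")
      case True
      have "ap f u i = (\<Sum>j<n. \<Sum>k\<in>F. a k * A k i j * u j)"
        using True by (simp add: mat_vec_def a' sum_distrib_right)
      also have "\<dots> = (\<Sum>k\<in>F. \<Sum>j<n. a k * A k i j * u j)" by (rule sum.swap)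
      also have "\<dots> = (\<Sum>k\<in>F. a k * ap k u i)"
        using True by (simp add: mat_vec_def sum_distrib_left mult.assoc)
      finally show ?thesis .
    qed (simp add: mat_vec_def)
    have "(\<lambda>i. \<Sum>k\<in>F. a k * (ap k u i - c k * u i)) \<in> W"
      by (rule lin_subspace_sum[OF W(1)]) (rule u(3))
    moreover have "(\<lambda>i. \<Sum>k\<in>F. a k * (ap k u i - c k * u i)) = (\<lambda>i. ap f u i - (\<Sum>k\<in>F. a k * c k) * u i)"
      unfolding ap by (simp add: right_diff_distrib sum_subtractf sum_distrib_right mult.assoc)
    ultimately show ?thesis by auto
  qed
  with u that show thesis by blast
qed

definition combos :: "nat \<Rightarrow> (nat \<Rightarrow> nat \<Rightarrow> complex) \<Rightarrow> (nat \<Rightarrow> complex) set" where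
  "combos m v = {x. \<exists>a. x = (\<lambda>i. \<Sum>k<m. a k * v k i)}"

lemma lin_subspace_combos: "lin_subspace (combos m v)"
  unfolding lin_subspace_def
proof (intro conjI ballI allI)
  show "(\<lambda>_. 0) \<in> combos m v"
    unfolding combos_def by (rule CollectI, rule exI[of _ "\<lambda>_. 0"]) simp
  fix x y a b assume "x \<in> combos m v" "y \<in> combos m v"
  then obtain c d where "x = (\<lambda>i. \<Sum>k<m. c k * v k i)" "y = (\<lambda>i. \<Sum>k<m. d k * v k i)"
    unfolding combos_def by blast
  hence "(\<lambda>i. a * x i + b * y i) = (\<lambda>i. \<Sum>k<m. (a * c k + b * d k) * v k i)"
    by (simp add: sum_distrib_left sum.distrib distrib_right mult.assoc)
  thus "(\<lambda>i. a * x i + b * y i) \<in> combos m v"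
    unfolding combos_def by (intro CollectI exI[of _ "\<lambda>k. a * c k + b * d k"])
qed

lemma combos_member: "k < m \<Longrightarrow> v k \<in> combos m v"
  unfolding combos_def
  by (rule CollectI, rule exI[of _ "\<lambda>j. if j = k then 1 else 0"])
     (simp add: if_distrib[of "\<lambda>c. c * _"] cong: if_cong)

lemma combos_mono:
  assumes "k \<le> m" shows "combos k v \<subseteq> combos m v"
proof
  fix x assume "x \<in> combos k v"
  then obtain a where "x = (\<lambda>i. \<Sum>j<k. a j * v j i)" unfolding combos_def by blast
  hence "x = (\<lambda>i. \<Sum>j\<in>{..<k}. a j * v j i)" by simp
  moreover have "(\<lambda>i. \<Sum>j\<in>{..<k}. a j * v j i) \<in> combos m v"
    by (rule lin_subspace_sum[OF lin_subspace_combos]) (use assms in \<open>auto intro: combos_member\<close>)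
  ultimately show "x \<in> combos m v" by simp
qed

lemma combos_cong: "(\<And>k. k < m \<Longrightarrow> v k = w k) \<Longrightarrow> combos m v = combos m w"
  unfolding combos_def by auto

lemma indep_fam_extend:
  assumes "indep_fam {..<m} v" "u \<notin> combos m v"
  shows "indep_fam {..<Suc m} (v(m := u))"
proof (rule indep_famI)
  fix a i assume z: "\<And>x. (\<Sum>i<Suc m. a i * (v(m := u)) i x) = 0" and i: "i \<in> {..<Suc m}"
  have z': "(\<Sum>i<m. a i * v i x) + a m * u x = 0" for x
    using z[of x] by simp
  have am: "a m = 0"
  proof (rule ccontr)
    assume am: "a m \<noteq> 0"
    have "u x = (\<Sum>i<m. (- a i / a m) * v i x)" for x
    proof -
      have "u x = - (\<Sum>i<m. a i * v i x) / a m"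
        using z'[of x] am by (simp add: field_simps eq_neg_iff_add_eq_0)
      thus ?thesis by (simp add: sum_divide_distrib sum_negf)
    qed
    hence "u \<in> combos m v" unfolding combos_def by (intro CollectI exI[of _ "\<lambda>i. - a i / a m"] ext)
    with assms(2) show False by simp
  qed
  from indep_famD[OF assms(1), of a i] z' am i show "a i = 0"
    by (cases "i = m") auto
qed

lemma exists_outside_combos:
  assumes "m < n"
  shows "\<exists>x\<in>cspace n. x \<notin> combos m v"
proof (rule ccontr)
  assume "\<not> ?thesis"
  hence all: "cspace n \<subseteq> combos m v" by auto
  define \<delta> :: "nat \<Rightarrow> nat \<Rightarrow> complex" where "\<delta> = (\<lambda>j i. if i = j then 1 else 0)"
  have "card {..<n} \<le> card {..<m}"
  proof (rule card_indep_fam_le_combinations[where u = \<delta> and w = v])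
    show "indep_fam {..<n} \<delta>"
    proof (rule indep_famI)
      fix a i assume z: "\<And>x. (\<Sum>i<n. a i * \<delta> i x) = 0" and i: "i \<in> {..<n}"
      from z[of i] i show "a i = 0" by (simp add: \<delta>_def if_distrib[of "\<lambda>c. _ * c"] cong: if_cong)
    qed
    fix i assume "i \<in> {..<n}"
    hence "\<delta> i \<in> cspace n" by (auto simp: \<delta>_def cspace_def)
    with all have "\<delta> i \<in> combos m v" by auto
    thus "\<exists>a. \<forall>x. \<delta> i x = (\<Sum>j<m. a j * v j x)" unfolding combos_def by auto
  qed auto
  with assms show False by simp
qed

lemma triangular_flag:
  "m \<le> n \<Longrightarrow> \<exists>v. (\<forall>k<m. v k \<in> cspace n) \<and> indep_fam {..<m} v
     \<and> (\<forall>k<m. \<forall>f\<in>S. \<exists>c. (\<lambda>i. ap f (v k) i - c * v k i) \<in> combos k v)"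
proof (induction m)
  case 0 thus ?case by (auto simp: indep_fam_def)
next
  case (Suc m)
  obtain v where v': "\<forall>k<m. v k \<in> cspace n" "indep_fam {..<m} v"
     "\<forall>k<m. \<forall>f\<in>S. \<exists>c. (\<lambda>i. ap f (v k) i - c * v k i) \<in> combos k v"
    using Suc.IH[OF Suc_leD[OF Suc.prems]] by blast
  note v = v'(1)[rule_format] v'(2) v'(3)[rule_format]
  have inv: "ap f x \<in> combos m v" if f: "f \<in> S" and x: "x \<in> combos m v" for f x
  proof -
    have 1: "ap f (v k) \<in> combos m v" if k: "k < m" for k
    proof -
      obtain c where "(\<lambda>i. ap f (v k) i - c * v k i) \<in> combos k v" using v(3)[OF k f] by auto
      hence "(\<lambda>i. ap f (v k) i - c * v k i) \<in> combos m v" using combos_mono[of k m v] k by auto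
      from lin_subspace_diff_scale[OF lin_subspace_combos this combos_member[OF k], of "-c"]
      show ?thesis by simp
    qed
    from x obtain a where x: "x = (\<lambda>i. \<Sum>k<m. a k * v k i)" unfolding combos_def by blast
    have "ap f x = (\<lambda>i. \<Sum>k<m. a k * ap f (v k) i)"
    proof
      fix i
      have "(\<Sum>j<n. A f i j * (\<Sum>k<m. a k * v k j)) = (\<Sum>k<m. a k * (\<Sum>j<n. A f i j * v k j))"
        unfolding sum_distrib_left by (subst sum.swap) (simp add: mult_ac)
      thus "ap f x i = (\<Sum>k<m. a k * ap f (v k) i)" by (simp add: x mat_vec_def)
    qed
    also have "\<dots> \<in> combos m v"
      by (rule lin_subspace_sum[OF lin_subspace_combos]) (auto intro: 1)
    finally show ?thesis .
  qed
  obtain x where x: "x \<in> cspace n" "x \<notin> combos m v" using exists_outside_combos[of m v] Suc.prems by auto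
  obtain u where u: "u \<in> cspace n" "u \<notin> combos m v"
      "\<And>f. f \<in> S \<Longrightarrow> \<exists>c. (\<lambda>i. ap f u i - c * u i) \<in> combos m v"
    using joint_eigenvector_mod[OF lin_subspace_combos[of m v] inv x] by blast
  have c: "combos k (v(m := u)) = combos k v" if "k \<le> m" for k
    using that by (intro combos_cong) auto
  show ?case
  proof (rule exI[of _ "v(m := u)"], intro conjI allI impI ballI)
    show "indep_fam {..<Suc m} (v(m := u))" by (rule indep_fam_extend[OF v(2) u(2)])
    show "(v(m := u)) k \<in> cspace n" if "k < Suc m" for k using that u v by auto
    fix k f assume "k < Suc m" "f \<in> S"
    thus "\<exists>c. (\<lambda>i. ap f ((v(m := u)) k) i - c * (v(m := u)) k i) \<in> combos k (v(m := u))"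
      using u(3) v(3) c[of k] by (cases "k = m") auto
  qed
qed

text \<open>
  A basis is built vector by vector, each one a joint eigenvector modulo the span of its predecessors.
  \<open>P\<close> has the basis vectors as columns and \<open>Q\<close> is its inverse.
\<close>

theorem simultaneous_triangularization:
  obtains P Q :: "nat \<Rightarrow> nat \<Rightarrow> complex" where
    "\<And>i j. i < n \<Longrightarrow> j < n \<Longrightarrow> (\<Sum>k<n. P i k * Q k j) = (if i = j then 1 else 0)"
    "\<And>i j. i < n \<Longrightarrow> j < n \<Longrightarrow> (\<Sum>k<n. Q i k * P k j) = (if i = j then 1 else 0)"
    "\<And>f r s. f \<in> S \<Longrightarrow> s < r \<Longrightarrow> r < n \<Longrightarrow> (\<Sum>i<n. \<Sum>j<n. Q r i * A f i j * P j s) = 0"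
proof -
  obtain v where v': "\<forall>k<n. v k \<in> cspace n" "indep_fam {..<n} v"
     "\<forall>k<n. \<forall>f\<in>S. \<exists>c. (\<lambda>i. ap f (v k) i - c * v k i) \<in> combos k v"
    using triangular_flag[OF order.refl] by blast
  note v = v'(1)[rule_format] v'(2) v'(3)[rule_format]
  define P where "P = (\<lambda>i k. v k i)"
  define \<delta> :: "nat \<Rightarrow> nat \<Rightarrow> complex" where "\<delta> = (\<lambda>j i. if i = j then 1 else 0)"
  have "\<delta> j \<in> combos n v" if j: "j < n" for j
  proof (rule ccontr)
    assume "\<delta> j \<notin> combos n v"
    from indep_fam_extend[OF v(2) this] have ind: "indep_fam {..<Suc n} (v(n := \<delta> j))" .
    have supp: "(v(n := \<delta> j)) i x = 0" if "i \<in> {..<Suc n}" "x \<notin> {..<n}" for i x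
      using that v(1)[of i] j by (cases "i = n") (auto simp: cspace_def \<delta>_def)
    have "card {..<Suc n} \<le> card {..<n}"
      by (rule card_indep_fam_le[OF _ _ ind supp]) simp_all
    thus False by simp
  qed
  hence "\<forall>j. \<exists>a. j < n \<longrightarrow> \<delta> j = (\<lambda>i. \<Sum>k<n. a k * v k i)"
    unfolding combos_def by blast
  then obtain q where q: "\<And>j. j < n \<Longrightarrow> \<delta> j = (\<lambda>i. \<Sum>k<n. q j k * v k i)"
    using choice[of "\<lambda>j a. j < n \<longrightarrow> \<delta> j = (\<lambda>i. \<Sum>k<n. a k * v k i)"] by blast
  define Q where "Q = (\<lambda>k j. q j k)"
  have PQ: "(\<Sum>k<n. P i k * Q k j) = (if i = j then 1 else 0)" if "i < n" "j < n" for i j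
    using fun_cong[OF q[OF that(2)], of i] by (simp add: P_def Q_def \<delta>_def mult.commute)
  have QP: "(\<Sum>k<n. Q i k * P k j) = (if i = j then 1 else 0)" if i: "i < n" and j: "j < n" for i j
  proof -
    define e where "e = (\<lambda>i. (\<Sum>k<n. Q i k * P k j) - (if i = j then 1 else 0))"
    have "(\<Sum>i<n. e i * v i x) = 0" for x
    proof (cases "x < n")
      case True
      have "(\<Sum>i<n. e i * v i x)
          = (\<Sum>i<n. (\<Sum>k<n. Q i k * P k j) * v i x) - (\<Sum>i<n. (if i = j then 1 else 0) * v i x)"
        by (simp add: e_def left_diff_distrib sum_subtractf)
      also have "(\<Sum>i<n. (if i = j then 1 else 0) * v i x) = v j x"
        using j by (simp add: if_distrib[of "\<lambda>c. c * _"] cong: if_cong)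
      also have "(\<Sum>i<n. (\<Sum>k<n. Q i k * P k j) * v i x) = (\<Sum>k<n. P k j * (\<Sum>i<n. P x i * Q i k))"
        unfolding sum_distrib_left sum_distrib_right
        by (subst sum.swap) (simp add: mult_ac P_def)
      also have "\<dots> = (\<Sum>k<n. P k j * (if x = k then 1 else 0))"
        by (intro sum.cong refl) (simp add: PQ[OF True])
      also have "\<dots> = v j x" using True by (simp add: P_def if_distrib[of "\<lambda>c. _ * c"] cong: if_cong)
      finally show ?thesis by simp
    qed (use v(1) in \<open>simp add: cspace_def\<close>)
    from indep_famD[OF v(2) this, of i] i show ?thesis by (simp add: e_def)
  qed
  have up: "(\<Sum>i<n. \<Sum>j<n. Q r i * A f i j * P j s) = 0" if f: "f \<in> S" and s: "s < r" and r: "r < n" for f r s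
  proof -
    have sn: "s < n" using s r by simp
    from v(3)[OF sn f] obtain c a where ca: "(\<lambda>i. ap f (v s) i - c * v s i) = (\<lambda>i. \<Sum>k<s. a k * v k i)"
      unfolding combos_def by blast
    have ca': "ap f (v s) i = c * P i s + (\<Sum>k<s. a k * P i k)" for i
      using fun_cong[OF ca, of i] by (simp add: P_def algebra_simps)
    have "(\<Sum>i<n. \<Sum>j<n. Q r i * A f i j * P j s) = (\<Sum>i<n. Q r i * ap f (v s) i)"
      by (intro sum.cong refl) (simp add: mat_vec_def P_def sum_distrib_left mult.assoc)
    also have "\<dots> = c * (\<Sum>i<n. Q r i * P i s) + (\<Sum>i<n. \<Sum>k<s. a k * (Q r i * P i k))"
      unfolding ca' by (simp add: distrib_left sum.distrib sum_distrib_left mult_ac)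
    also have "(\<Sum>i<n. \<Sum>k<s. a k * (Q r i * P i k)) = (\<Sum>k<s. a k * (\<Sum>i<n. Q r i * P i k))"
      by (subst sum.swap) (simp add: sum_distrib_left)
    also have "\<dots> = 0"
    proof (rule sum.neutral, intro ballI)
      fix k assume "k \<in> {..<s}"
      with QP[OF r, of k] sn s show "a k * (\<Sum>i<n. Q r i * P i k) = 0" by simp
    qed
    finally show ?thesis using QP[OF r sn] s by simp
  qed
  show thesis by (rule that[of P Q]) (assumption | rule PQ QP up)+
qed

end

section \<open>Multipliers of a positive definite kernel\<close>

text \<open>
  The inner product of \<open>\<Sum>x\<in>F. a x * K(\<cdot>, x)\<close> and \<open>\<Sum>y\<in>F. b y * K(\<cdot>, y)\<close>.
\<close>

definition kform :: "('x \<Rightarrow> 'x \<Rightarrow> complex) \<Rightarrow> 'x set \<Rightarrow> ('x \<Rightarrow> complex) \<Rightarrow> ('x \<Rightarrow> complex) \<Rightarrow> complex" where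
  "kform K F a b = (\<Sum>x\<in>F. \<Sum>y\<in>F. a x * cnj (b y) * K y x)"

definition kquad :: "('x \<Rightarrow> 'x \<Rightarrow> complex) \<Rightarrow> 'x set \<Rightarrow> ('x \<Rightarrow> complex) \<Rightarrow> real" where
  "kquad K F a = Re (kform K F a a)"

text \<open>
  The adjoint of multiplication by \<open>g\<close> maps \<open>K(\<cdot>, x)\<close> to \<open>cnj (g x) * K(\<cdot>, x)\<close>. So this is the bound \<open>R\<close>
  for the adjoint on the span of the kernel functions.
\<close>

definition mult_bound :: "'x set \<Rightarrow> ('x \<Rightarrow> 'x \<Rightarrow> complex) \<Rightarrow> ('x \<Rightarrow> complex) \<Rightarrow> real \<Rightarrow> bool" where
  "mult_bound X K g R \<longleftrightarrow> (\<forall>F c. finite F \<and> F \<subseteq> X \<longrightarrow>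
     kquad K F (\<lambda>x. c x * cnj (g x)) \<le> R\<^sup>2 * kquad K F c)"

lemma mult_boundD:
  "mult_bound X K g R \<Longrightarrow> finite F \<Longrightarrow> F \<subseteq> X \<Longrightarrow> kquad K F (\<lambda>x. c x * cnj (g x)) \<le> R\<^sup>2 * kquad K F c"
  unfolding mult_bound_def by blast

lemma kform_add_left: "kform K F (\<lambda>x. a x + b x) c = kform K F a c + kform K F b c"
  by (simp add: kform_def distrib_right sum.distrib)

lemma kform_add_right: "kform K F c (\<lambda>x. a x + b x) = kform K F c a + kform K F c b"
  by (simp add: kform_def distrib_right distrib_left sum.distrib)

lemma kform_scale_left: "kform K F (\<lambda>x. t * a x) c = t * kform K F a c"
  by (simp add: kform_def sum_distrib_left mult.assoc)

lemma kform_scale_right: "kform K F c (\<lambda>x. t * a x) = cnj t * kform K F c a"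
  by (simp add: kform_def sum_distrib_left mult_ac)

lemma kform_sum_left: "kform K F (\<lambda>x. \<Sum>i\<in>I. a i x) c = (\<Sum>i\<in>I. kform K F (a i) c)"
  by (induction I rule: infinite_finite_induct) (simp_all add: kform_add_left, simp_all add: kform_def)

lemma kform_sum_right: "kform K F c (\<lambda>x. \<Sum>i\<in>I. a i x) = (\<Sum>i\<in>I. kform K F c (a i))"
  by (induction I rule: infinite_finite_induct) (simp_all add: kform_add_right, simp_all add: kform_def)

lemma kquad_scale: "kquad K F (\<lambda>x. t * a x) = (cmod t)\<^sup>2 * kquad K F a"
proof -
  have "kform K F (\<lambda>x. t * a x) (\<lambda>x. t * a x) = of_real ((cmod t)\<^sup>2) * kform K F a a"
    by (simp only: kform_scale_left kform_scale_right complex_norm_square mult_ac)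
  thus ?thesis unfolding kquad_def by (simp del: of_real_power)
qed

lemma kquad_cong: "(\<And>x. x \<in> F \<Longrightarrow> a x = b x) \<Longrightarrow> kquad K F a = kquad K F b"
  unfolding kquad_def kform_def by (intro arg_cong[of _ _ Re] sum.cong refl) simp

locale pd_kernel =
  fixes X :: "'x set" and K :: "'x \<Rightarrow> 'x \<Rightarrow> complex"
  assumes hermitian: "x \<in> X \<Longrightarrow> y \<in> X \<Longrightarrow> K x y = cnj (K y x)"
    and kquad_nonneg: "finite F \<Longrightarrow> F \<subseteq> X \<Longrightarrow> 0 \<le> kquad K F c"
begin

lemma kform_commute:
  assumes "F \<subseteq> X"
  shows "kform K F b a = cnj (kform K F a b)"
proof -
  have "cnj (kform K F a b) = (\<Sum>x\<in>F. \<Sum>y\<in>F. b y * cnj (a x) * K x y)"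
    unfolding kform_def cnj_sum
  proof (intro sum.cong refl)
    fix x y assume "x \<in> F" "y \<in> F"
    with assms have "x \<in> X" "y \<in> X" by auto
    hence "cnj (K y x) = K x y" by (rule hermitian[symmetric])
    thus "cnj (a x * cnj (b y) * K y x) = b y * cnj (a x) * K x y" by simp
  qed
  also have "\<dots> = kform K F b a" unfolding kform_def by (rule sum.swap)
  finally show ?thesis by simp
qed

lemma kquad_combine:
  assumes "F \<subseteq> X"
  shows "kquad K F (\<lambda>x. s * a x + t * b x)
    = (cmod s)\<^sup>2 * kquad K F a + (cmod t)\<^sup>2 * kquad K F b + 2 * Re (s * cnj t * kform K F a b)"
proof -
  have 1: "kform K F (\<lambda>x. s * a x + t * b x) (\<lambda>x. s * a x + t * b x)
      = kform K F (\<lambda>x. s * a x) (\<lambda>x. s * a x) + kform K F (\<lambda>x. t * b x) (\<lambda>x. t * b x)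
        + (s * cnj t * kform K F a b + cnj (s * cnj t * kform K F a b))"
    by (simp add: kform_add_left kform_add_right kform_scale_left kform_scale_right
        kform_commute[OF assms, of b a] algebra_simps)
  show ?thesis
    unfolding kquad_def 1 using kquad_scale[of K F s a] kquad_scale[of K F t b]
    by (simp add: kquad_def algebra_simps)
qed

lemma kquad_diff:
  assumes "F \<subseteq> X"
  shows "kquad K F (\<lambda>x. a x - b x) = kquad K F a + kquad K F b - 2 * Re (kform K F a b)"
  using kquad_combine[OF assms, of 1 a "-1" b] by simp

text \<open>
  Summing \<open>0 \<le> \<parallel>a i - a j\<parallel>\<^sup>2\<close> over all pairs. This is where the factor \<open>sqrt k\<close> of a column of length
  \<open>k\<close> arises.
\<close>

lemma kquad_sum_le:
  assumes F: "finite F" "F \<subseteq> X"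
  shows "kquad K F (\<lambda>x. \<Sum>i<k. a i x) \<le> real k * (\<Sum>i<k. kquad K F (a i))"
proof -
  have "0 \<le> (\<Sum>i<k. \<Sum>j<k. kquad K F (\<lambda>x. a i x - a j x))"
    by (intro sum_nonneg kquad_nonneg F)
  also have "\<dots> = 2 * (real k * (\<Sum>i<k. kquad K F (a i))) - 2 * (\<Sum>i<k. \<Sum>j<k. Re (kform K F (a i) (a j)))"
    by (simp add: kquad_diff[OF F(2)] sum_subtractf sum.distrib sum_distrib_left)
  also have "(\<Sum>i<k. \<Sum>j<k. Re (kform K F (a i) (a j))) = kquad K F (\<lambda>x. \<Sum>i<k. a i x)"
    by (simp add: kquad_def kform_sum_left kform_sum_right)
  finally show ?thesis by simp
qed

lemma mult_bound_const:
  assumes "cmod t \<le> R" shows "mult_bound X K (\<lambda>_. t) R"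
  unfolding mult_bound_def
proof (intro allI impI)
  fix F c assume F: "finite F \<and> F \<subseteq> X"
  have "kquad K F (\<lambda>x. c x * cnj t) = (cmod t)\<^sup>2 * kquad K F c"
    using kquad_scale[of K F "cnj t" c] by (simp add: mult.commute)
  also have "\<dots> \<le> R\<^sup>2 * kquad K F c"
    using assms F by (intro mult_right_mono power_mono kquad_nonneg) auto
  finally show "kquad K F (\<lambda>x. c x * cnj t) \<le> R\<^sup>2 * kquad K F c" .
qed

lemma mult_bound_scale:
  assumes "mult_bound X K g R" shows "mult_bound X K (\<lambda>x. t * g x) (cmod t * R)"
  unfolding mult_bound_def
proof (intro allI impI)
  fix F c assume F: "finite F \<and> F \<subseteq> X"
  have "kquad K F (\<lambda>x. c x * cnj (t * g x)) = (cmod t)\<^sup>2 * kquad K F (\<lambda>x. c x * cnj (g x))"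
    using kquad_scale[of K F "cnj t" "\<lambda>x. c x * cnj (g x)"] by (simp add: mult_ac)
  also have "\<dots> \<le> (cmod t)\<^sup>2 * (R\<^sup>2 * kquad K F c)"
    using assms F by (intro mult_left_mono mult_boundD) auto
  finally show "kquad K F (\<lambda>x. c x * cnj (t * g x)) \<le> (cmod t * R)\<^sup>2 * kquad K F c"
    by (simp add: power_mult_distrib mult.assoc)
qed

lemma mult_bound_imp_norm_le:
  assumes "mult_bound X K g R" "0 \<le> R" "x \<in> X" "0 < Re (K x x)"
  shows "cmod (g x) \<le> R"
proof -
  have "kquad K {x} (\<lambda>x. 1 * cnj (g x)) \<le> R\<^sup>2 * kquad K {x} (\<lambda>_. 1)"
    using mult_boundD[OF assms(1), of "{x}" "\<lambda>_. 1"] assms(3) by simp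
  moreover have "kquad K {x} (\<lambda>x. 1 * cnj (g x)) = (cmod (g x))\<^sup>2 * Re (K x x)"
  proof -
    have "cnj (g x) * g x = of_real ((cmod (g x))\<^sup>2)"
      using complex_norm_square[of "g x"] by (simp add: mult.commute)
    thus ?thesis unfolding kquad_def kform_def by (simp del: of_real_power)
  qed
  moreover have "kquad K {x} (\<lambda>_. 1) = Re (K x x)" by (simp add: kquad_def kform_def)
  ultimately have "(cmod (g x))\<^sup>2 * Re (K x x) \<le> R\<^sup>2 * Re (K x x)" by (simp only:)
  hence "(cmod (g x))\<^sup>2 \<le> R\<^sup>2" using assms(4) by simp
  thus ?thesis using assms(2) by (rule power2_le_imp_le)
qed

text \<open>
  Von Neumann's inequality for a disc automorphism. With \<open>b = (1 + c * cnj G) * a\<close> the two sides are the squared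
  norms of \<open>a + c * e\<close> and \<open>cnj c * a + e\<close>, where \<open>e = cnj G * a\<close>, and their difference is
  \<open>(1 - \<bar>c\<bar>\<^sup>2) * (\<parallel>a\<parallel>\<^sup>2 - \<parallel>e\<parallel>\<^sup>2)\<close>.
\<close>

lemma mult_bound_moebius:
  assumes G: "mult_bound X K G 1" and c: "cmod c \<le> 1"
    and nz: "\<And>x. x \<in> X \<Longrightarrow> 1 + cnj c * G x \<noteq> 0"
  shows "mult_bound X K (\<lambda>x. (c + G x) / (1 + cnj c * G x)) 1"
  unfolding mult_bound_def
proof (intro allI impI)
  fix F b assume F: "finite F \<and> F \<subseteq> X"
  define a where "a = (\<lambda>x. b x / (1 + c * cnj (G x)))"
  define e where "e = (\<lambda>x. a x * cnj (G x))"
  have nz': "1 + c * cnj (G x) \<noteq> 0" if "x \<in> F" for x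
    using nz[of x] that F by (metis complex_cnj_add complex_cnj_cnj complex_cnj_mult complex_cnj_one
        complex_cnj_zero subsetD)
  have 1: "kquad K F (\<lambda>x. b x * cnj ((c + G x) / (1 + cnj c * G x))) = kquad K F (\<lambda>x. cnj c * a x + 1 * e x)"
    by (rule kquad_cong) (simp add: a_def e_def add_divide_distrib distrib_left mult.commute)
  have 2: "kquad K F b = kquad K F (\<lambda>x. 1 * a x + c * e x)"
  proof (rule kquad_cong)
    fix x assume "x \<in> F"
    hence "b x = a x * (1 + c * cnj (G x))" using nz' by (simp add: a_def)
    thus "b x = 1 * a x + c * e x" by (simp add: e_def algebra_simps)
  qed
  have "0 \<le> (1 - (cmod c)\<^sup>2) * (kquad K F a - kquad K F e)"
    using c mult_boundD[OF G, of F a] F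
    by (intro mult_nonneg_nonneg) (auto simp: e_def power_le_one)
  thus "kquad K F (\<lambda>x. b x * cnj ((c + G x) / (1 + cnj c * G x))) \<le> 1\<^sup>2 * kquad K F b"
    unfolding 1 2 kquad_combine[OF conjunct2[OF F]] by (simp add: algebra_simps)
qed

text \<open>
  A row of norm \<open>M\<close> times a column of \<open>k\<close> multipliers of norm \<open>R\<close>.
\<close>

lemma mult_bound_row:
  assumes row: "\<And>F c. finite F \<Longrightarrow> F \<subseteq> X \<Longrightarrow>
      (\<Sum>i<k. kquad K F (\<lambda>x. c x * cnj (\<psi> i x))) \<le> M\<^sup>2 * kquad K F c"
    and g: "\<And>i. i < k \<Longrightarrow> mult_bound X K (g i) R"
  shows "mult_bound X K (\<lambda>x. \<Sum>i<k. \<psi> i x * g i x) (sqrt (real k) * M * R)"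
  unfolding mult_bound_def
proof (intro allI impI)
  fix F c assume F: "finite F \<and> F \<subseteq> X"
  have "kquad K F (\<lambda>x. c x * cnj (\<Sum>i<k. \<psi> i x * g i x))
      = kquad K F (\<lambda>x. \<Sum>i<k. (c x * cnj (\<psi> i x)) * cnj (g i x))"
    by (simp add: sum_distrib_left mult.assoc)
  also have "\<dots> \<le> real k * (\<Sum>i<k. kquad K F (\<lambda>x. (c x * cnj (\<psi> i x)) * cnj (g i x)))"
    using F by (intro kquad_sum_le) auto
  also have "\<dots> \<le> real k * (\<Sum>i<k. R\<^sup>2 * kquad K F (\<lambda>x. c x * cnj (\<psi> i x)))"
    using F g by (intro mult_left_mono sum_mono mult_boundD) auto
  also have "\<dots> = real k * R\<^sup>2 * (\<Sum>i<k. kquad K F (\<lambda>x. c x * cnj (\<psi> i x)))"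
    by (simp add: sum_distrib_left mult.assoc)
  also have "\<dots> \<le> real k * R\<^sup>2 * (M\<^sup>2 * kquad K F c)"
    using F by (intro mult_left_mono row) auto
  finally show "kquad K F (\<lambda>x. c x * cnj (\<Sum>i<k. \<psi> i x * g i x)) \<le> (sqrt (real k) * M * R)\<^sup>2 * kquad K F c"
    by (simp add: power_mult_distrib mult_ac)
qed

end

section \<open>Multipliers of a reproducing kernel Hilbert space\<close>

context rkhs
begin

definition kfun :: "'x \<Rightarrow> 'x \<Rightarrow> complex" where
  "kfun w = (\<lambda>x. if x \<in> X then K x w else 0)"

lemma kfun_mem: "w \<in> X \<Longrightarrow> kfun w \<in> H"
  unfolding kfun_def by (rule kernel_mem)

lemma ip_kfun: "h \<in> H \<Longrightarrow> w \<in> X \<Longrightarrow> ip h (kfun w) = h w"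
  unfolding kfun_def by (rule reproducing)

lemma combine_mem: "g \<in> H \<Longrightarrow> h \<in> H \<Longrightarrow> (\<lambda>x. s * g x + t * h x) \<in> H"
  using add_mem[OF scale_mem scale_mem, of g h s t] .

lemma diff_mem: "g \<in> H \<Longrightarrow> h \<in> H \<Longrightarrow> (\<lambda>x. g x - h x) \<in> H"
  using combine_mem[of g h 1 "-1"] by simp

lemma ip_combine_left:
  assumes "f \<in> H" "g \<in> H" "h \<in> H"
  shows "ip (\<lambda>x. s * f x + t * g x) h = s * ip f h + t * ip g h"
  using ip_add[OF scale_mem scale_mem, of f g h s t] assms by (simp add: ip_scale)

lemma ip_combine_right:
  assumes "f \<in> H" "g \<in> H" "h \<in> H"
  shows "ip h (\<lambda>x. s * f x + t * g x) = cnj s * ip h f + cnj t * ip h g"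
  using ip_combine_left[OF assms, of s t] ip_commute[OF combine_mem[of f g s t] assms(3)]
    ip_commute[of f h] ip_commute[of g h] assms
  by simp

abbreviation nsq :: "('x \<Rightarrow> complex) \<Rightarrow> real" where "nsq h \<equiv> Re (ip h h)"

lemma nsq_nonneg: "h \<in> H \<Longrightarrow> 0 \<le> nsq h"
proof (cases "h = (\<lambda>_. 0)")
  case True
  have "ip (\<lambda>x. 0 * h x) h = 0 * ip h h" if "h \<in> H" using that by (intro ip_scale)
  thus "h \<in> H \<Longrightarrow> 0 \<le> nsq h" using True by simp
qed (use ip_pos in \<open>auto intro: less_imp_le\<close>)

lemma ip_norm_sq: "h \<in> H \<Longrightarrow> (ip_norm ip h)\<^sup>2 = nsq h"
  unfolding ip_norm_def by (simp add: nsq_nonneg)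

lemma ip_norm_nonneg: "0 \<le> ip_norm ip h" if "h \<in> H"
  unfolding ip_norm_def by (simp add: nsq_nonneg that)

lemma nsq_combine:
  assumes "g \<in> H" "h \<in> H"
  shows "nsq (\<lambda>x. s * g x + t * h x)
    = (cmod s)\<^sup>2 * nsq g + (cmod t)\<^sup>2 * nsq h + 2 * Re (s * cnj t * ip g h)"
proof -
  have 1: "ip (\<lambda>x. s * g x + t * h x) (\<lambda>x. s * g x + t * h x)
     = (s * cnj s) * ip g g + (t * cnj t) * ip h h + (s * cnj t * ip g h + cnj (s * cnj t * ip g h))"
    using assms ip_commute[OF assms] by (simp add: ip_combine_left ip_combine_right combine_mem algebra_simps)
  show ?thesis unfolding 1 complex_norm_square[symmetric] by (simp add: algebra_simps flip: of_real_power)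
qed

lemma cauchy_schwarz:
  assumes g: "g \<in> H" and h: "h \<in> H"
  shows "cmod (ip g h) \<le> ip_norm ip g * ip_norm ip h"
proof (cases "h = (\<lambda>_. 0)")
  case True
  have "ip h g = 0" using ip_scale[OF h g, of 0] True by simp
  hence "ip g h = 0" using ip_commute[OF h g] by simp
  thus ?thesis using g h by (simp add: ip_norm_nonneg)
next
  case False
  hence p: "0 < nsq h" using ip_pos[OF h] by simp
  define t where "t = - ip g h / of_real (nsq h)"
  have "0 \<le> nsq (\<lambda>x. 1 * g x + t * h x)" by (rule nsq_nonneg[OF combine_mem[OF g h]])
  also have "\<dots> = nsq g + (cmod t)\<^sup>2 * nsq h + 2 * Re (cnj t * ip g h)"
    unfolding nsq_combine[OF g h] by simp
  also have "cnj t * ip g h = - of_real ((cmod (ip g h))\<^sup>2 / nsq h)"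
    unfolding t_def of_real_divide complex_norm_square by simp
  also have "(cmod t)\<^sup>2 * nsq h = (cmod (ip g h))\<^sup>2 / nsq h"
    using p by (simp add: t_def norm_divide power_divide power2_eq_square)
  finally have "(cmod (ip g h))\<^sup>2 / nsq h \<le> nsq g" by simp
  hence "(cmod (ip g h))\<^sup>2 \<le> (ip_norm ip g * ip_norm ip h)\<^sup>2"
    using p g h by (simp add: field_simps power_mult_distrib ip_norm_sq)
  thus ?thesis by (rule power2_le_imp_le) (use g h in \<open>simp add: ip_norm_nonneg\<close>)
qed

definition comb :: "'x set \<Rightarrow> ('x \<Rightarrow> complex) \<Rightarrow> 'x \<Rightarrow> complex" where
  "comb F c = (\<lambda>x. \<Sum>w\<in>F. c w * kfun w x)"

lemma comb_insert: "finite F \<Longrightarrow> w \<notin> F \<Longrightarrow> comb (insert w F) c = (\<lambda>x. c w * kfun w x + 1 * comb F c x)"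
  by (simp add: comb_def)

lemma comb_mem: "finite F \<Longrightarrow> F \<subseteq> X \<Longrightarrow> comb F c \<in> H"
proof (induction F rule: finite_induct)
  case empty thus ?case by (simp add: comb_def zero_mem)
next
  case (insert w F)
  show ?case unfolding comb_insert[OF insert.hyps]
    using insert by (intro combine_mem kfun_mem) auto
qed

lemma ip_comb: "finite F \<Longrightarrow> F \<subseteq> X \<Longrightarrow> h \<in> H \<Longrightarrow> ip (comb F c) h = (\<Sum>w\<in>F. c w * cnj (h w))"
proof (induction F rule: finite_induct)
  case empty
  thus ?case using ip_scale[OF zero_mem, of h 0] by (simp add: comb_def)
next
  case (insert w F)
  have "ip (kfun w) h = cnj (h w)"
    using insert.prems ip_commute[OF _ kfun_mem, of h w] ip_kfun[of h w] by simp
  thus ?case unfolding comb_insert[OF insert.hyps(1,2)]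
    using insert by (subst ip_combine_left) (auto intro: kfun_mem comb_mem)
qed

lemma K_hermitian: "x \<in> X \<Longrightarrow> y \<in> X \<Longrightarrow> K x y = cnj (K y x)"
  using ip_commute[OF kfun_mem kfun_mem, of x y] ip_kfun[OF kfun_mem, of x y] ip_kfun[OF kfun_mem, of y x]
  by (simp add: kfun_def)

lemma nsq_comb:
  assumes "finite F" "F \<subseteq> X"
  shows "nsq (comb F c) = kquad K F c"
proof -
  have "ip (comb F c) (comb F c) = (\<Sum>x\<in>F. \<Sum>y\<in>F. c x * cnj (c y) * K y x)"
    unfolding ip_comb[OF assms comb_mem[OF assms]]
  proof (intro sum.cong refl)
    fix x assume x: "x \<in> F"
    have "cnj (comb F c x) = (\<Sum>y\<in>F. cnj (c y) * K y x)"
      unfolding comb_def cnj_sum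
    proof (rule sum.cong[OF refl])
      fix y assume "y \<in> F"
      with x assms show "cnj (c y * kfun y x) = cnj (c y) * K y x"
        using K_hermitian[of x y] by (auto simp: kfun_def)
    qed
    thus "c x * cnj (comb F c x) = (\<Sum>y\<in>F. c x * cnj (c y) * K y x)"
      by (simp add: sum_distrib_left mult.assoc)
  qed
  thus ?thesis by (simp add: kquad_def kform_def)
qed

lemma ip_norm_comb: "finite F \<Longrightarrow> F \<subseteq> X \<Longrightarrow> ip_norm ip (comb F c) = sqrt (kquad K F c)"
  by (simp add: ip_norm_def nsq_comb)

sublocale pd_kernel X K
proof
  show "K x y = cnj (K y x)" if "x \<in> X" "y \<in> X" for x y using K_hermitian that .
  show "0 \<le> kquad K F c" if "finite F" "F \<subseteq> X" for F c
    using nsq_comb[OF that] nsq_nonneg[OF comb_mem[OF that]] by simp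
qed

lemma ip_norm_triangle_diff:
  assumes g: "g \<in> H" and h: "h \<in> H"
  shows "\<bar>ip_norm ip g - ip_norm ip h\<bar> \<le> ip_norm ip (\<lambda>x. g x - h x)"
proof -
  have "(ip_norm ip g - ip_norm ip h)\<^sup>2 = nsq g + nsq h - 2 * (ip_norm ip g * ip_norm ip h)"
    by (simp add: power2_diff ip_norm_sq g h)
  also have "\<dots> \<le> nsq g + nsq h - 2 * Re (ip g h)"
    using cauchy_schwarz[OF g h] complex_Re_le_cmod[of "ip g h"] by linarith
  also have "\<dots> = (ip_norm ip (\<lambda>x. g x - h x))\<^sup>2"
    using nsq_combine[OF g h, of 1 "-1"] by (simp add: ip_norm_sq diff_mem g h)
  finally show ?thesis
    by (metis abs_le_square_iff abs_of_nonneg diff_mem g h ip_norm_nonneg)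
qed

lemma nsq_diff_parallelogram:
  assumes g: "g \<in> H" and h: "h \<in> H"
  shows "nsq (\<lambda>x. g x - h x) = 2 * nsq g + 2 * nsq h - 4 * nsq (\<lambda>x. 1/2 * g x + 1/2 * h x)"
  using nsq_combine[OF g h, of 1 "-1"] nsq_combine[OF g h, of "1/2" "1/2"]
  by (simp add: power2_eq_square norm_divide)

lemma comb_extend:
  assumes "finite F'" "F \<subseteq> F'"
  shows "comb F c = comb F' (\<lambda>x. if x \<in> F then c x else 0)"
    and "(\<Sum>x\<in>F. c x * z x) = (\<Sum>x\<in>F'. (if x \<in> F then c x else 0) * (z x :: complex))"
proof -
  have *: "(\<Sum>x\<in>F. c x * z x) = (\<Sum>x\<in>F'. (if x \<in> F then c x else 0) * (z x :: complex))" for z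
    using assms by (intro sum.mono_neutral_cong_left) auto
  show "comb F c = comb F' (\<lambda>x. if x \<in> F then c x else 0)"
    unfolding comb_def using * by (intro ext) auto
  show "(\<Sum>x\<in>F. c x * z x) = (\<Sum>x\<in>F'. (if x \<in> F then c x else 0) * (z x :: complex))" by (rule *)
qed

text \<open>
  Riesz representation, phrased for functions: if \<open>\<Sum>x\<in>F. c x * cnj (f x)\<close>, which would be the inner product of
  the kernel combination \<open>comb F c\<close> with \<open>f\<close>, is bounded by \<open>\<rho>\<close> times the norm of the combination, then \<open>f\<close> is in the
  space. A minimizing sequence of \<open>\<parallel>s\<parallel>\<^sup>2 - 2 * Re l\<close>, where \<open>l\<close> is the value of the functional at \<open>s\<close>, is Cauchy by
  the parallelogram law, and its limit has the values of \<open>f\<close>.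
\<close>

theorem bounded_functional_represented:
  assumes off: "\<And>x. x \<notin> X \<Longrightarrow> f x = 0" and \<rho>: "0 \<le> \<rho>"
    and bd: "\<And>F c. finite F \<Longrightarrow> F \<subseteq> X \<Longrightarrow> cmod (\<Sum>x\<in>F. c x * cnj (f x)) \<le> \<rho> * sqrt (kquad K F c)"
  shows "f \<in> H" and "ip_norm ip f \<le> \<rho>"
proof -
  define P where "P = {(s, l). \<exists>F c. finite F \<and> F \<subseteq> X \<and> s = comb F c \<and> l = (\<Sum>x\<in>F. c x * cnj (f x))}"
  have PH: "s \<in> H" if "(s, l) \<in> P" for s l using that comb_mem by (auto simp: P_def)
  have Pbd: "cmod l \<le> \<rho> * ip_norm ip s" if "(s, l) \<in> P" for s l
    using that bd by (auto simp: P_def ip_norm_comb)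
  have Pcomb: "((\<lambda>x. a * s x + b * s' x), a * l + b * l') \<in> P"
    if P: "(s, l) \<in> P" "(s', l') \<in> P" for s l s' l' a b
  proof -
    from P(1) obtain F c where F: "finite F" "F \<subseteq> X" "s = comb F c" "l = (\<Sum>x\<in>F. c x * cnj (f x))"
      unfolding P_def by blast
    from P(2) obtain F' c' where F': "finite F'" "F' \<subseteq> X" "s' = comb F' c'" "l' = (\<Sum>x\<in>F'. c' x * cnj (f x))"
      unfolding P_def by blast
    define e where "e = (\<lambda>x. a * (if x \<in> F then c x else 0) + b * (if x \<in> F' then c' x else 0))"
    have fin: "finite (F \<union> F')" using F F' by simp
    note c1 = comb_extend[OF fin Un_upper1] and c2 = comb_extend[OF fin Un_upper2]
    have "(\<lambda>x. a * s x + b * s' x) = comb (F \<union> F') e"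
      unfolding F(3) F'(3) c1(1)[of c] c2(1)[of c']
      by (simp add: comb_def e_def sum_distrib_left sum.distrib distrib_right mult.assoc)
    moreover have "a * l + b * l' = (\<Sum>x\<in>F \<union> F'. e x * cnj (f x))"
      unfolding F(4) F'(4) c1(2)[of c] c2(2)[of c']
      by (simp add: e_def sum_distrib_left sum.distrib distrib_right mult.assoc)
    ultimately show ?thesis
      unfolding P_def using F F' fin
      by (intro CollectI case_prodI exI[of _ "F \<union> F'"] exI[of _ e] conjI) auto
  qed
  have P0: "(comb {} (\<lambda>_. 0), 0) \<in> P" unfolding P_def by force
  define J where "J = (\<lambda>(s, l). nsq s - 2 * Re l)"
  have Jlow: "- \<rho>\<^sup>2 \<le> J p" if "p \<in> P" for p
  proof -
    obtain s l where p: "p = (s, l)" by (cases p)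
    have "Re l \<le> \<rho> * ip_norm ip s" using Pbd[of s l] that p complex_Re_le_cmod[of l] by simp
    moreover have "0 \<le> (ip_norm ip s - \<rho>)\<^sup>2" by simp
    ultimately show ?thesis using PH[of s l] that p by (simp add: J_def power2_diff ip_norm_sq mult_ac)
  qed
  define m where "m = (INF p\<in>P. J p)"
  have bdd: "bdd_below (J ` P)" using Jlow by (intro bdd_belowI2)
  have mle: "m \<le> J p" if "p \<in> P" for p unfolding m_def by (rule cINF_lower[OF bdd that])
  have "\<exists>p\<in>P. J p < m + 1 / real (Suc k)" for k
  proof -
    have "m < m + 1 / real (Suc k)" by simp
    thus ?thesis unfolding m_def using P0 bdd cINF_less_iff[of P J "m + 1 / real (Suc k)"] by (auto simp: m_def)
  qed
  then obtain p where p: "\<And>k. p k \<in> P" "\<And>k. J (p k) < m + 1 / real (Suc k)" by metis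
  define s where "s = (\<lambda>k. fst (p k))"
  define l where "l = (\<lambda>k. snd (p k))"
  have sl: "(s k, l k) \<in> P" for k using p(1) by (simp add: s_def l_def)
  have Jsl: "J (s k, l k) < m + 1 / real (Suc k)" for k using p(2) by (simp add: s_def l_def)
  note sH = PH[OF sl]
  have dist: "nsq (\<lambda>x. s j x - s k x) \<le> 2 / real (Suc j) + 2 / real (Suc k)" for j k
  proof -
    have "m \<le> J (\<lambda>x. 1/2 * s j x + 1/2 * s k x, 1/2 * l j + 1/2 * l k)"
      by (rule mle[OF Pcomb[OF sl sl]])
    moreover have "nsq (\<lambda>x. s j x - s k x)
        = 2 * J (s j, l j) + 2 * J (s k, l k) - 4 * J (\<lambda>x. 1/2 * s j x + 1/2 * s k x, 1/2 * l j + 1/2 * l k)"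
      unfolding nsq_diff_parallelogram[OF sH sH] by (simp add: J_def)
    ultimately show ?thesis using Jsl[of j] Jsl[of k] by simp
  qed
  have cauchy: "\<exists>N. \<forall>m\<ge>N. \<forall>k\<ge>N. ip_norm ip (\<lambda>x. s m x - s k x) < e" if e: "e > 0" for e
  proof -
    obtain N where N: "4 / e\<^sup>2 < real N" using reals_Archimedean2 by blast
    have "ip_norm ip (\<lambda>x. s j x - s k x) < e" if jk: "N \<le> j" "N \<le> k" for j k
    proof -
      have N0: "0 < real N" using N e by (smt (verit) divide_nonneg_nonneg zero_le_power2)
      have "1 / real (Suc i) \<le> 1 / real N" if "N \<le> i" for i
        using that N0 by (intro divide_left_mono) auto
      from this[OF jk(1)] this[OF jk(2)] have "nsq (\<lambda>x. s j x - s k x) \<le> 4 / real N"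
        using dist[of j k] by simp
      also have "\<dots> < e\<^sup>2" using N N0 e by (simp add: field_simps)
      finally have "sqrt (nsq (\<lambda>x. s j x - s k x)) < sqrt (e\<^sup>2)" by (rule real_sqrt_less_mono)
      thus ?thesis using e by (simp add: ip_norm_def)
    qed
    thus ?thesis by blast
  qed
  obtain h where h: "h \<in> H" "(\<lambda>k. ip_norm ip (\<lambda>x. s k x - h x)) \<longlonglongrightarrow> 0"
    using complete[of s, OF sH] cauchy by blast
  have lim_ip: "(\<lambda>k. ip t (s k)) \<longlonglongrightarrow> ip t h" if t: "t \<in> H" for t
  proof (rule LIM_zero_cancel, rule Lim_null_comparison[OF _ tendsto_mult_right_zero[OF h(2)]])
    show "\<forall>\<^sub>F k in sequentially. norm (ip t (s k) - ip t h) \<le> ip_norm ip t * ip_norm ip (\<lambda>x. s k x - h x)"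
    proof (intro always_eventually allI)
      fix k
      have "ip t (s k) - ip t h = ip t (\<lambda>x. s k x - h x)"
        using ip_combine_right[OF sH h(1) t, of 1 k "-1"] by simp
      thus "norm (ip t (s k) - ip t h) \<le> ip_norm ip t * ip_norm ip (\<lambda>x. s k x - h x)"
        using cauchy_schwarz[OF t diff_mem[OF sH h(1)], of k] by simp
    qed
  qed
  have rep: "ip t h = lt" if t: "(t, lt) \<in> P" for t lt
  proof -
    note tH = PH[OF t]
    define D where "D = ip t h - lt"
    have var: "0 \<le> 2 * Re (\<epsilon> * D) + (cmod \<epsilon>)\<^sup>2 * nsq t" for \<epsilon>
    proof -
      have "m \<le> J (s k, l k) + 2 * Re (\<epsilon> * (ip t (s k) - lt)) + (cmod \<epsilon>)\<^sup>2 * nsq t" for k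
      proof -
        have "m \<le> J (\<lambda>x. 1 * s k x + \<epsilon> * t x, 1 * l k + \<epsilon> * lt)" by (rule mle[OF Pcomb[OF sl t]])
        also have "\<dots> = nsq (s k) + (cmod \<epsilon>)\<^sup>2 * nsq t + 2 * Re (cnj \<epsilon> * ip (s k) t) - 2 * Re (l k + \<epsilon> * lt)"
          unfolding J_def prod.case nsq_combine[OF sH tH] by simp
        also have "Re (cnj \<epsilon> * ip (s k) t) = Re (\<epsilon> * ip t (s k))"
          unfolding ip_commute[OF sH tH] by simp
        finally show ?thesis by (simp add: J_def right_diff_distrib)
      qed
      hence "0 \<le> 1 / real (Suc k) + 2 * Re (\<epsilon> * (ip t (s k) - lt)) + (cmod \<epsilon>)\<^sup>2 * nsq t" for k
        using Jsl[of k] by (smt (verit))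
      moreover have "(\<lambda>k. 1 / real (Suc k) + 2 * Re (\<epsilon> * (ip t (s k) - lt)) + (cmod \<epsilon>)\<^sup>2 * nsq t)
          \<longlonglongrightarrow> 0 + 2 * Re (\<epsilon> * (ip t h - lt)) + (cmod \<epsilon>)\<^sup>2 * nsq t"
        by (intro tendsto_intros lim_ip tH LIMSEQ_inverse_real_of_nat[unfolded inverse_eq_divide])
      ultimately have "0 \<le> 0 + 2 * Re (\<epsilon> * (ip t h - lt)) + (cmod \<epsilon>)\<^sup>2 * nsq t"
        using LIMSEQ_le_const by blast
      thus ?thesis by (simp add: D_def)
    qed
    have "D = 0"
    proof (rule ccontr)
      assume "D \<noteq> 0"
      hence D: "0 < (cmod D)\<^sup>2" by simp
      \<comment> \<open>any positive \<open>\<delta>\<close> with \<open>\<delta> * nsq t < 2\<close> makes the variation below negative\<close>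
      define \<delta> where "\<delta> = 1 / (nsq t + 1)"
      have nt: "0 \<le> nsq t" by (rule nsq_nonneg[OF tH])
      have \<delta>: "0 < \<delta>" "\<delta> * nsq t < 1" using nt by (auto simp: \<delta>_def)
      have "- of_real \<delta> * cnj D * D = - of_real (\<delta> * (cmod D)\<^sup>2)"
        using complex_norm_square[of D] by (simp add: mult_ac)
      hence "Re (- of_real \<delta> * cnj D * D) = - (\<delta> * (cmod D)\<^sup>2)" by (simp only: Re_complex_of_real uminus_complex.sel)
      moreover have "(cmod (- of_real \<delta> * cnj D))\<^sup>2 = \<delta> * (\<delta> * (cmod D)\<^sup>2)"
        by (simp add: norm_mult power_mult_distrib power2_eq_square)
      ultimately have "0 \<le> \<delta> * (cmod D)\<^sup>2 * (\<delta> * nsq t - 2)"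
        using var[of "- of_real \<delta> * cnj D"] by (simp add: algebra_simps)
      moreover have "\<delta> * (cmod D)\<^sup>2 * (\<delta> * nsq t - 2) < 0"
        using \<delta> D by (intro mult_pos_neg) auto
      ultimately show False by simp
    qed
    thus ?thesis by (simp add: D_def)
  qed
  have "h = f"
  proof
    fix w
    show "h w = f w"
    proof (cases "w \<in> X")
      case True
      have "(kfun w, cnj (f w)) \<in> P"
        unfolding P_def using True
        by (intro CollectI case_prodI exI[of _ "{w}"] exI[of _ "\<lambda>_. 1"]) (auto simp: comb_def)
      from rep[OF this] have "ip (kfun w) h = cnj (f w)" .
      thus ?thesis using ip_commute[OF kfun_mem[OF True] h(1)] ip_kfun[OF h(1) True] by simp
    qed (use off off_domain[OF h(1)] in auto)
  qed
  thus fH: "f \<in> H" using h(1) by simp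
  have ls: "l k = ip (s k) f" for k using rep[OF sl, of k] \<open>h = f\<close> by simp
  have norm_lim: "(\<lambda>k. ip_norm ip (s k)) \<longlonglongrightarrow> ip_norm ip f"
  proof (rule LIM_zero_cancel, rule Lim_null_comparison)
    show "(\<lambda>k. ip_norm ip (\<lambda>x. s k x - f x)) \<longlonglongrightarrow> 0" using h(2) \<open>h = f\<close> by simp
    show "\<forall>\<^sub>F k in sequentially. norm (ip_norm ip (s k) - ip_norm ip f) \<le> ip_norm ip (\<lambda>x. s k x - f x)"
      using ip_norm_triangle_diff[OF sH fH] by (intro always_eventually allI) simp
  qed
  have "(\<lambda>k. cmod (ip f (s k))) \<longlonglongrightarrow> cmod (ip f f)"
    using tendsto_norm[OF lim_ip[OF fH]] \<open>h = f\<close> by simp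
  moreover have "(\<lambda>k. \<rho> * ip_norm ip (s k)) \<longlonglongrightarrow> \<rho> * ip_norm ip f"
    by (intro tendsto_intros norm_lim)
  moreover have "cmod (ip f (s k)) \<le> \<rho> * ip_norm ip (s k)" for k
    using Pbd[OF sl, of k] ls[of k] ip_commute[OF sH fH, of k] by simp
  ultimately have "cmod (ip f f) \<le> \<rho> * ip_norm ip f"
    by (intro LIMSEQ_le) auto
  hence "(ip_norm ip f)\<^sup>2 \<le> \<rho> * ip_norm ip f"
    using complex_Re_le_cmod[of "ip f f"] by (simp add: ip_norm_sq fH)
  thus "ip_norm ip f \<le> \<rho>"
    using ip_norm_nonneg[OF fH] \<rho> by (cases "ip_norm ip f = 0") (auto simp: power2_eq_square)
qed

text \<open>
  For \<open>h\<close> in the space, the functional that belongs to \<open>g * h\<close> is the inner product with \<open>h\<close> after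
  the adjoint of \<open>g\<close> has been applied to the kernel combination.
\<close>

theorem mult_bound_imp_Mult:
  assumes g: "mult_bound X K g R" and R: "0 \<le> R"
  shows "g \<in> Mult H" and "mult_norm H ip g \<le> R"
proof -
  have main: "(\<lambda>x. g x * h x) \<in> H \<and> ip_norm ip (\<lambda>x. g x * h x) \<le> R * ip_norm ip h" if h: "h \<in> H" for h
  proof -
    have bd: "cmod (\<Sum>x\<in>F. c x * cnj (g x * h x)) \<le> R * ip_norm ip h * sqrt (kquad K F c)"
      if F: "finite F" "F \<subseteq> X" for F c
    proof -
      have "(\<Sum>x\<in>F. c x * cnj (g x * h x)) = ip (comb F (\<lambda>x. c x * cnj (g x))) h"
        unfolding ip_comb[OF F h] by (simp add: mult_ac)
      hence "cmod (\<Sum>x\<in>F. c x * cnj (g x * h x)) \<le> ip_norm ip (comb F (\<lambda>x. c x * cnj (g x))) * ip_norm ip h"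
        using cauchy_schwarz[OF comb_mem[OF F] h] by simp
      moreover have "ip_norm ip (comb F (\<lambda>x. c x * cnj (g x))) \<le> sqrt (R\<^sup>2 * kquad K F c)"
        unfolding ip_norm_comb[OF F] using mult_boundD[OF g F] by simp
      moreover have "sqrt (R\<^sup>2 * kquad K F c) = R * sqrt (kquad K F c)"
        using R by (simp add: real_sqrt_mult)
      ultimately show ?thesis
        using mult_right_mono[OF _ ip_norm_nonneg[OF h], of _ "R * sqrt (kquad K F c)"]
        by (fastforce simp: mult_ac)
    qed
    have off: "g x * h x = 0" if "x \<notin> X" for x using off_domain[OF h that] by simp
    have "0 \<le> R * ip_norm ip h" using R ip_norm_nonneg[OF h] by simp
    from bounded_functional_represented[of "\<lambda>x. g x * h x", OF off this bd] show ?thesis by simp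
  qed
  show "g \<in> Mult H" unfolding Mult_def using main by blast
  show "mult_norm H ip g \<le> R"
    unfolding mult_norm_def
  proof (rule cSUP_least)
    have "ip_norm ip (\<lambda>_. 0) = 0" using ip_scale[OF zero_mem zero_mem, of 0] by (simp add: ip_norm_def)
    hence "(\<lambda>_. 0) \<in> {h \<in> H. ip_norm ip h \<le> 1}" using zero_mem by simp
    thus "{h \<in> H. ip_norm ip h \<le> 1} \<noteq> {}" by blast
    fix h assume h: "h \<in> {h \<in> H. ip_norm ip h \<le> 1}"
    hence "ip_norm ip (\<lambda>x. g x * h x) \<le> R * ip_norm ip h" using main by blast
    also have "\<dots> \<le> R * 1" using h R by (intro mult_left_mono) auto
    finally show "ip_norm ip (\<lambda>x. g x * h x) \<le> R" by simp
  qed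
qed

end

section \<open>Euclidean geometry of the ball\<close>

lemma cnorm_nonneg: "0 \<le> cnorm d x" by (simp add: cnorm_def)

lemma cinner_self: "cinner d x x = of_real ((cnorm d x)\<^sup>2)"
  unfolding cinner_def cnorm_def L2_set_def
  by (simp add: sum_nonneg complex_norm_square del: of_real_power)

lemma cinner_commute: "cinner d y x = cnj (cinner d x y)"
  by (simp add: cinner_def mult.commute)

lemma cinner_combine_left: "cinner d (\<lambda>i. a * x i + b * y i) w = a * cinner d x w + b * cinner d y w"
  by (simp add: cinner_def distrib_right sum.distrib sum_distrib_left mult.assoc)

lemma cinner_combine_right: "cinner d w (\<lambda>i. a * x i + b * y i) = cnj a * cinner d w x + cnj b * cinner d w y"
  by (simp add: cinner_def distrib_left sum.distrib sum_distrib_left mult_ac)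

lemma cinner_scale_left: "cinner d (\<lambda>i. a * x i) w = a * cinner d x w"
  by (simp add: cinner_def sum_distrib_left mult.assoc)

lemma cinner_scale_right: "cinner d w (\<lambda>i. a * x i) = cnj a * cinner d w x"
  by (simp add: cinner_def sum_distrib_left mult_ac)

lemma cinner_sum_left: "cinner d (\<lambda>j. \<Sum>i\<in>I. x i j) w = (\<Sum>i\<in>I. cinner d (x i) w)"
  unfolding cinner_def sum_distrib_right by (rule sum.swap)

lemma cinner_sum_right: "cinner d w (\<lambda>j. \<Sum>i\<in>I. x i j) = (\<Sum>i\<in>I. cinner d w (x i))"
  unfolding cinner_def cnj_sum sum_distrib_left by (rule sum.swap)

lemma cauchy_schwarz_cinner: "cmod (cinner d x y) \<le> cnorm d x * cnorm d y"
proof -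
  have "cmod (cinner d x y) \<le> (\<Sum>i<d. \<bar>cmod (x i)\<bar> * \<bar>cmod (y i)\<bar>)"
    unfolding cinner_def by (rule order.trans[OF norm_sum]) (simp add: norm_mult)
  also have "\<dots> \<le> cnorm d x * cnorm d y" unfolding cnorm_def by (rule L2_set_mult_ineq)
  finally show ?thesis .
qed

lemma cmod_le_cnorm: "i < d \<Longrightarrow> cmod (x i) \<le> cnorm d x"
  unfolding cnorm_def by (rule member_le_L2_set) auto

lemma cnorm_eq_0: "x \<in> cspace d \<Longrightarrow> cnorm d x = 0 \<Longrightarrow> x = (\<lambda>_. 0)"
  unfolding cnorm_def cspace_def by (auto simp: L2_set_eq_0_iff fun_eq_iff) (metis lessThan_iff not_less)

lemma zero_in_ball: "(\<lambda>_. 0) \<in> unit_ball d"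
  by (simp add: unit_ball_def cspace_def cnorm_def L2_set_0')

lemma ball_cinner_less_1:
  assumes "z \<in> unit_ball d" "w \<in> unit_ball d"
  shows "cmod (cinner d z w) < 1"
proof -
  have "cmod (cinner d z w) \<le> cnorm d z * cnorm d w" by (rule cauchy_schwarz_cinner)
  also have "\<dots> < 1"
  proof (cases "cnorm d w = 0")
    case False
    have "cnorm d z * cnorm d w < 1 * 1"
      using assms False cnorm_nonneg[of d w] cnorm_nonneg[of d z]
      by (intro mult_strict_mono) (auto simp: unit_ball_def)
    thus ?thesis by simp
  qed simp
  finally show ?thesis .
qed

lemma ball_one_minus_nonzero:
  assumes "z \<in> unit_ball d" "w \<in> unit_ball d"
  shows "1 - cinner d z w \<noteq> 0"
  using ball_cinner_less_1[OF assms] by auto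

section \<open>Holomorphic functions on the ball\<close>

lemma coordinate_tendsto: "((\<lambda>w. w i) \<longlongrightarrow> (z :: nat \<Rightarrow> complex) i) (at z within S)"
proof (rule tendsto_within_subset)
  show "((\<lambda>w. w i) \<longlongrightarrow> z i) (at z within UNIV)"
    using continuous_on_product_coordinates[of i] unfolding continuous_on_def by blast
qed simp

lemma tendsto_coordinatewise:
  fixes f :: "'a \<Rightarrow> nat \<Rightarrow> complex"
  assumes "\<And>i. ((\<lambda>x. f x i) \<longlongrightarrow> l i) F"
  shows "(f \<longlongrightarrow> l) F"
proof -
  have "limitin (product_topology (\<lambda>i. euclidean) UNIV) f l F"
    unfolding limitin_componentwise using assms by simp
  thus ?thesis unfolding euclidean_product_topology by simp
qed

text \<open>
  Caratheodory's form of differentiability: difference quotients \<open>q i\<close> that are continuous at \<open>z\<close>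
  replace the limit. Products, quotients and compositions of holomorphic functions then
  need only algebra. The quotients are obtained by distributing the remainder over the
  coordinates in proportion to \<open>cnj (w i - z i)\<close>.
\<close>

lemma holo_iff_caratheodory:
  "f \<in> holo d \<longleftrightarrow> (\<forall>z\<in>unit_ball d. \<exists>q.
     (\<forall>w\<in>unit_ball d. f w - f z = (\<Sum>i<d. q i w * (w i - z i))) \<and>
     (\<forall>i<d. (q i \<longlongrightarrow> q i z) (at z within unit_ball d)))"
    (is "_ \<longleftrightarrow> (\<forall>z\<in>_. ?C z)")
proof -
  have "?C z" if z: "z \<in> unit_ball d" and f: "f \<in> holo d" for z
  proof -
    from f z obtain L where L: "((\<lambda>w. (f w - f z - (\<Sum>i<d. L i * (w i - z i))) / of_real (cnorm d (\<lambda>i. w i - z i)))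
        \<longlongrightarrow> 0) (at z within unit_ball d)" unfolding holo_def by blast
    define N where "N = (\<lambda>w. cnorm d (\<lambda>i. w i - z i))"
    define r where "r = (\<lambda>w. f w - f z - (\<Sum>i<d. L i * (w i - z i)))"
    define q where "q = (\<lambda>i w. L i + r w / of_real (N w) * (cnj (w i - z i) / of_real (N w)))"
    have Nz: "N z = 0" by (simp add: N_def cnorm_def L2_set_0')
    have "f w - f z = (\<Sum>i<d. q i w * (w i - z i))" if w: "w \<in> unit_ball d" for w
    proof (cases "w = z")
      case False
      have "N w \<noteq> 0"
      proof
        assume "N w = 0"
        moreover have "(\<lambda>i. w i - z i) \<in> cspace d" using w z by (simp add: unit_ball_def cspace_def)
        ultimately have "(\<lambda>i. w i - z i) = (\<lambda>_. 0)" unfolding N_def by (intro cnorm_eq_0)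
        hence "w i = z i" for i by (metis right_minus_eq)
        with False show False by blast
      qed
      have "(\<Sum>i<d. q i w * (w i - z i)) = (\<Sum>i<d. L i * (w i - z i))
          + r w / of_real (N w) * ((\<Sum>i<d. (w i - z i) * cnj (w i - z i)) / of_real (N w))"
        unfolding sum_divide_distrib sum_distrib_left sum.distrib[symmetric]
        by (intro sum.cong refl) (simp add: q_def distrib_right distrib_left mult_ac)
      also have "(\<Sum>i<d. (w i - z i) * cnj (w i - z i)) = of_real ((N w)\<^sup>2)"
        using cinner_self[of d "\<lambda>i. w i - z i"] by (simp add: cinner_def N_def)
      finally show ?thesis using \<open>N w \<noteq> 0\<close> by (simp add: power2_eq_square r_def)
    qed simp
    moreover have "(q i \<longlongrightarrow> q i z) (at z within unit_ball d)" if i: "i < d" for i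
    proof -
      have "((\<lambda>w. r w / of_real (N w) * (cnj (w i - z i) / of_real (N w))) \<longlongrightarrow> 0) (at z within unit_ball d)"
      proof (rule Lim_null_comparison)
        show "((\<lambda>w. cmod (r w / of_real (N w))) \<longlongrightarrow> 0) (at z within unit_ball d)"
          using tendsto_norm[OF L] by (simp add: r_def N_def)
        show "\<forall>\<^sub>F w in at z within unit_ball d. norm (r w / of_real (N w) * (cnj (w i - z i) / of_real (N w)))
            \<le> cmod (r w / of_real (N w))"
        proof (intro always_eventually allI)
          fix w
          have "cmod (cnj (w i - z i)) \<le> N w"
            using cmod_le_cnorm[OF i, of "\<lambda>i. w i - z i"] by (simp add: N_def norm_minus_commute flip: complex_cnj_diff)
          hence "cmod (cnj (w i - z i) / of_real (N w)) \<le> 1"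
            using cnorm_nonneg[of d "\<lambda>i. w i - z i"] by (auto simp: N_def norm_divide divide_le_eq_1)
          thus "norm (r w / of_real (N w) * (cnj (w i - z i) / of_real (N w))) \<le> cmod (r w / of_real (N w))"
            unfolding norm_mult by (rule mult_left_le) simp
        qed
      qed
      from tendsto_add[OF tendsto_const[of "L i"] this] show ?thesis by (simp add: q_def Nz)
    qed
    ultimately show ?thesis by blast
  qed
  moreover have "f \<in> holo d" if C: "\<forall>z\<in>unit_ball d. ?C z"
    unfolding holo_def
  proof (intro CollectI ballI)
    fix z assume z: "z \<in> unit_ball d"
    with C obtain q where q: "\<And>w. w \<in> unit_ball d \<Longrightarrow> f w - f z = (\<Sum>i<d. q i w * (w i - z i))"
      "\<And>i. i < d \<Longrightarrow> (q i \<longlongrightarrow> q i z) (at z within unit_ball d)" by blast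
    define N where "N = (\<lambda>w. cnorm d (\<lambda>i. w i - z i))"
    show "\<exists>L. ((\<lambda>w. (f w - f z - (\<Sum>i<d. L i * (w i - z i))) / of_real (cnorm d (\<lambda>i. w i - z i)))
        \<longlongrightarrow> 0) (at z within unit_ball d)"
    proof (rule exI[of _ "\<lambda>i. q i z"], rule Lim_null_comparison)
      have "((\<lambda>w. \<Sum>i<d. cmod (q i w - q i z)) \<longlongrightarrow> (\<Sum>i<d. cmod (q i z - q i z))) (at z within unit_ball d)"
        by (intro tendsto_intros q(2)) auto
      thus "((\<lambda>w. \<Sum>i<d. cmod (q i w - q i z)) \<longlongrightarrow> 0) (at z within unit_ball d)" by simp
      show "\<forall>\<^sub>F w in at z within unit_ball d. norm ((f w - f z - (\<Sum>i<d. q i z * (w i - z i))) /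
          of_real (cnorm d (\<lambda>i. w i - z i))) \<le> (\<Sum>i<d. cmod (q i w - q i z))"
        unfolding eventually_at_filter
      proof (intro always_eventually allI impI)
        fix w assume "w \<noteq> z" and w: "w \<in> unit_ball d"
        have N0: "0 \<le> N w" by (simp add: N_def cnorm_nonneg)
        have "norm ((f w - f z - (\<Sum>i<d. q i z * (w i - z i))) / of_real (N w))
          = norm (\<Sum>i<d. (q i w - q i z) * (w i - z i)) / N w"
          using N0 by (simp add: q(1)[OF w] norm_divide left_diff_distrib sum_subtractf)
        also have "\<dots> \<le> (\<Sum>i<d. cmod (q i w - q i z) * N w) / N w"
          using N0 cmod_le_cnorm[of _ d "\<lambda>i. w i - z i"]
          by (intro divide_right_mono order.trans[OF norm_sum] sum_mono)
             (auto simp: norm_mult N_def intro!: mult_left_mono)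
        also have "\<dots> \<le> (\<Sum>i<d. cmod (q i w - q i z))"
          by (cases "N w = 0") (auto simp: sum_distrib_right[symmetric] intro: sum_nonneg)
        finally show "norm ((f w - f z - (\<Sum>i<d. q i z * (w i - z i))) /
          of_real (cnorm d (\<lambda>i. w i - z i))) \<le> (\<Sum>i<d. cmod (q i w - q i z))" by (simp add: N_def)
      qed
    qed
  qed
  ultimately show ?thesis by blast
qed

lemma holoI:
  assumes "\<And>z. z \<in> unit_ball d \<Longrightarrow> \<exists>q.
     (\<forall>w\<in>unit_ball d. f w - f z = (\<Sum>i<d. q i w * (w i - z i))) \<and>
     (\<forall>i<d. (q i \<longlongrightarrow> q i z) (at z within unit_ball d))"
  shows "f \<in> holo d"
  unfolding holo_iff_caratheodory using assms by blast

definition slopes :: "nat \<Rightarrow> ((nat \<Rightarrow> complex) \<Rightarrow> complex) \<Rightarrow> (nat \<Rightarrow> complex)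
    \<Rightarrow> (nat \<Rightarrow> (nat \<Rightarrow> complex) \<Rightarrow> complex) \<Rightarrow> bool" where
  "slopes d f z q \<longleftrightarrow> (\<forall>w\<in>unit_ball d. f w - f z = (\<Sum>i<d. q i w * (w i - z i))) \<and>
     (\<forall>i<d. (q i \<longlongrightarrow> q i z) (at z within unit_ball d))"

lemma holoE:
  assumes "f \<in> holo d" "z \<in> unit_ball d"
  obtains q where "slopes d f z q"
proof -
  from assms have "\<exists>q. slopes d f z q" unfolding holo_iff_caratheodory slopes_def by blast
  thus ?thesis using that by blast
qed

lemma slopesD:
  assumes "slopes d f z q"
  shows "w \<in> unit_ball d \<Longrightarrow> f w - f z = (\<Sum>i<d. q i w * (w i - z i))"
    and "i < d \<Longrightarrow> (q i \<longlongrightarrow> q i z) (at z within unit_ball d)"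
  using assms unfolding slopes_def by blast+

lemma holo_cong:
  assumes "\<And>z. z \<in> unit_ball d \<Longrightarrow> f z = g z" "f \<in> holo d"
  shows "g \<in> holo d"
proof (rule holoI)
  fix z assume z: "z \<in> unit_ball d"
  obtain q where "slopes d f z q" by (rule holoE[OF assms(2) z])
  note q = slopesD[OF this]
  show "\<exists>q. (\<forall>w\<in>unit_ball d. g w - g z = (\<Sum>i<d. q i w * (w i - z i))) \<and>
     (\<forall>i<d. (q i \<longlongrightarrow> q i z) (at z within unit_ball d))"
    using assms(1) z q by (intro exI[of _ q]) auto
qed

lemma holo_tendsto:
  assumes "f \<in> holo d" "z \<in> unit_ball d"
  shows "(f \<longlongrightarrow> f z) (at z within unit_ball d)"
proof -
  obtain q where "slopes d f z q" by (rule holoE[OF assms])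
  note q = slopesD[OF this]
  have "((\<lambda>w. f z + (\<Sum>i<d. q i w * (w i - z i))) \<longlongrightarrow> f z + (\<Sum>i<d. q i z * (z i - z i)))
      (at z within unit_ball d)"
    by (intro tendsto_intros q(2) coordinate_tendsto) auto
  hence "((\<lambda>w. f z + (\<Sum>i<d. q i w * (w i - z i))) \<longlongrightarrow> f z) (at z within unit_ball d)" by simp
  thus ?thesis
    by (rule Lim_transform_eventually) (auto simp: eventually_at_filter q(1)[symmetric])
qed

lemma holo_const: "(\<lambda>_. c) \<in> holo d"
  by (rule holoI, rule exI[of _ "\<lambda>_ _. 0"]) simp

lemma holo_coord: "(\<lambda>z. z j) \<in> holo d"
proof (rule holoI)
  fix z assume z: "z \<in> unit_ball d"
  have "w j - z j = (\<Sum>i<d. (if i = j then 1 else 0) * (w i - z i))" if "w \<in> unit_ball d" for w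
    using that z
    by (cases "j < d") (auto simp: if_distrib[of "\<lambda>c. c * _"] unit_ball_def cspace_def cong: if_cong)
  thus "\<exists>q. (\<forall>w\<in>unit_ball d. w j - z j = (\<Sum>i<d. q i w * (w i - z i))) \<and>
     (\<forall>i<d. (q i \<longlongrightarrow> q i z) (at z within unit_ball d))"
    by (intro exI[of _ "\<lambda>i _. if i = j then 1 else 0"]) simp
qed

lemma holo_add:
  assumes "f \<in> holo d" "g \<in> holo d" shows "(\<lambda>z. f z + g z) \<in> holo d"
proof (rule holoI)
  fix z assume z: "z \<in> unit_ball d"
  obtain q where "slopes d f z q" by (rule holoE[OF assms(1) z])
  note q = slopesD[OF this]
  obtain p where "slopes d g z p" by (rule holoE[OF assms(2) z])
  note p = slopesD[OF this]
  have "f w + g w - (f z + g z) = (\<Sum>i<d. (q i w + p i w) * (w i - z i))" if "w \<in> unit_ball d" for w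
  proof -
    have "f w + g w - (f z + g z) = (f w - f z) + (g w - g z)" by simp
    thus ?thesis unfolding q(1)[OF that] p(1)[OF that] by (simp add: distrib_right sum.distrib)
  qed
  thus "\<exists>q. (\<forall>w\<in>unit_ball d. f w + g w - (f z + g z) = (\<Sum>i<d. q i w * (w i - z i))) \<and>
     (\<forall>i<d. (q i \<longlongrightarrow> q i z) (at z within unit_ball d))"
    by (intro exI[of _ "\<lambda>i w. q i w + p i w"]) (auto intro!: tendsto_add q(2) p(2))
qed

lemma holo_mult:
  assumes "f \<in> holo d" "g \<in> holo d" shows "(\<lambda>z. f z * g z) \<in> holo d"
proof (rule holoI)
  fix z assume z: "z \<in> unit_ball d"
  obtain q where "slopes d f z q" by (rule holoE[OF assms(1) z])
  note q = slopesD[OF this]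
  obtain p where "slopes d g z p" by (rule holoE[OF assms(2) z])
  note p = slopesD[OF this]
  have "f w * g w - f z * g z = (\<Sum>i<d. (q i w * g w + f z * p i w) * (w i - z i))" if "w \<in> unit_ball d" for w
  proof -
    have "f w * g w - f z * g z = (f w - f z) * g w + f z * (g w - g z)" by (simp add: algebra_simps)
    thus ?thesis unfolding q(1)[OF that] p(1)[OF that]
      unfolding sum_distrib_left sum_distrib_right sum.distrib[symmetric] by (simp add: algebra_simps)
  qed
  thus "\<exists>q. (\<forall>w\<in>unit_ball d. f w * g w - f z * g z = (\<Sum>i<d. q i w * (w i - z i))) \<and>
     (\<forall>i<d. (q i \<longlongrightarrow> q i z) (at z within unit_ball d))"
    by (intro exI[of _ "\<lambda>i w. q i w * g w + f z * p i w"])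
       (auto intro!: tendsto_intros q(2) p(2) holo_tendsto[OF assms(2) z])
qed

lemma holo_inverse:
  assumes "f \<in> holo d" "\<And>z. z \<in> unit_ball d \<Longrightarrow> f z \<noteq> 0" shows "(\<lambda>z. inverse (f z)) \<in> holo d"
proof (rule holoI)
  fix z assume z: "z \<in> unit_ball d"
  obtain q where "slopes d f z q" by (rule holoE[OF assms(1) z])
  note q = slopesD[OF this]
  have "inverse (f w) - inverse (f z) = (\<Sum>i<d. (- q i w / (f w * f z)) * (w i - z i))" if w: "w \<in> unit_ball d" for w
  proof -
    have "inverse (f w) - inverse (f z) = - (f w - f z) / (f w * f z)"
      using assms(2)[OF w] assms(2)[OF z] by (simp add: field_simps)
    thus ?thesis unfolding q(1)[OF w]
      by (simp add: sum_divide_distrib sum_negf)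
  qed
  thus "\<exists>q. (\<forall>w\<in>unit_ball d. inverse (f w) - inverse (f z) = (\<Sum>i<d. q i w * (w i - z i))) \<and>
     (\<forall>i<d. (q i \<longlongrightarrow> q i z) (at z within unit_ball d))"
    using assms(2)[OF z]
    by (intro exI[of _ "\<lambda>i w. - q i w / (f w * f z)"])
       (auto intro!: tendsto_intros q(2) holo_tendsto[OF assms(1) z])
qed

lemma holo_scale: "f \<in> holo d \<Longrightarrow> (\<lambda>z. c * f z) \<in> holo d"
  by (rule holo_mult[OF holo_const])

lemma holo_diff: "f \<in> holo d \<Longrightarrow> g \<in> holo d \<Longrightarrow> (\<lambda>z. f z - g z) \<in> holo d"
  using holo_add[OF _ holo_scale[of g d "-1"], of f] by simp

lemma holo_divide:
  assumes "f \<in> holo d" "g \<in> holo d" "\<And>z. z \<in> unit_ball d \<Longrightarrow> g z \<noteq> 0"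
  shows "(\<lambda>z. f z / g z) \<in> holo d"
  unfolding divide_inverse by (rule holo_mult[OF assms(1) holo_inverse[OF assms(2,3)]])

lemma holo_sum: "(\<And>i. i \<in> I \<Longrightarrow> f i \<in> holo d) \<Longrightarrow> (\<lambda>z. \<Sum>i\<in>I. f i z) \<in> holo d"
  by (induction I rule: infinite_finite_induct) (auto intro: holo_const holo_add)

lemma holo_cinner: "(\<And>i. (\<lambda>z. \<phi> z i) \<in> holo d) \<Longrightarrow> (\<lambda>z. cinner k (\<phi> z) w) \<in> holo d"
  unfolding cinner_def by (intro holo_sum holo_mult holo_const)

lemma holo_compose:
  assumes f: "f \<in> holo k" and \<phi>: "\<And>z. z \<in> unit_ball d \<Longrightarrow> \<phi> z \<in> unit_ball k"
    and h: "\<And>i. (\<lambda>z. \<phi> z i) \<in> holo d"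
  shows "(\<lambda>z. f (\<phi> z)) \<in> holo d"
proof (rule holoI)
  fix z assume z: "z \<in> unit_ball d"
  obtain q where "slopes k f (\<phi> z) q" by (rule holoE[OF f \<phi>[OF z]])
  note q = slopesD[OF this]
  have "\<forall>i. \<exists>p. (\<forall>w\<in>unit_ball d. \<phi> w i - \<phi> z i = (\<Sum>j<d. p j w * (w j - z j))) \<and>
     (\<forall>j<d. (p j \<longlongrightarrow> p j z) (at z within unit_ball d))"
    using h z unfolding holo_iff_caratheodory by blast
  from choice[OF this] obtain p where
    p': "\<forall>i. (\<forall>w\<in>unit_ball d. \<phi> w i - \<phi> z i = (\<Sum>j<d. p i j w * (w j - z j))) \<and>
     (\<forall>j<d. (p i j \<longlongrightarrow> p i j z) (at z within unit_ball d))" ..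
  hence p: "\<And>i w. w \<in> unit_ball d \<Longrightarrow> \<phi> w i - \<phi> z i = (\<Sum>j<d. p i j w * (w j - z j))"
     "\<And>i j. j < d \<Longrightarrow> (p i j \<longlongrightarrow> p i j z) (at z within unit_ball d)" by blast+
  have cont: "(\<phi> \<longlongrightarrow> \<phi> z) (at z within unit_ball d)"
    by (rule tendsto_coordinatewise) (rule holo_tendsto[OF h z])
  have comp: "((\<lambda>w. q i (\<phi> w)) \<longlongrightarrow> q i (\<phi> z)) (at z within unit_ball d)" if i: "i < k" for i
  proof -
    have "continuous (at (\<phi> z) within \<phi> ` unit_ball d) (q i)"
      using tendsto_within_subset[OF q(2)[OF i]] \<phi> by (auto simp: continuous_within image_subset_iff)
    moreover have "continuous (at z within unit_ball d) \<phi>" using cont by (simp add: continuous_within)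
    ultimately show ?thesis
      using continuous_within_compose[of z "unit_ball d" \<phi> "q i"] by (simp add: continuous_within o_def)
  qed
  have "f (\<phi> w) - f (\<phi> z) = (\<Sum>j<d. (\<Sum>i<k. q i (\<phi> w) * p i j w) * (w j - z j))"
    if w: "w \<in> unit_ball d" for w
  proof -
    have "f (\<phi> w) - f (\<phi> z) = (\<Sum>i<k. q i (\<phi> w) * (\<Sum>j<d. p i j w * (w j - z j)))"
      using q(1)[OF \<phi>[OF w]] p(1)[OF w] by simp
    also have "\<dots> = (\<Sum>j<d. (\<Sum>i<k. q i (\<phi> w) * p i j w) * (w j - z j))"
      unfolding sum_distrib_left sum_distrib_right by (subst sum.swap) (simp add: mult.assoc)
    finally show ?thesis .
  qed
  thus "\<exists>q. (\<forall>w\<in>unit_ball d. f (\<phi> w) - f (\<phi> z) = (\<Sum>i<d. q i w * (w i - z i))) \<and>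
     (\<forall>i<d. (q i \<longlongrightarrow> q i z) (at z within unit_ball d))"
    by (intro exI[of _ "\<lambda>j w. \<Sum>i<k. q i (\<phi> w) * p i j w"]) (auto intro!: tendsto_intros comp p(2))
qed

lemma HinfI:
  assumes "f \<in> holo d" "\<And>z. z \<in> unit_ball d \<Longrightarrow> cmod (f z) \<le> s"
  shows "f \<in> Hinf d" "supnorm d f \<le> s"
proof -
  show "f \<in> Hinf d" using assms unfolding Hinf_def bounded_iff by blast
  show "supnorm d f \<le> s" unfolding supnorm_def
    by (rule cSUP_least) (use assms(2) zero_in_ball in auto)
qed

lemma Hinf_norm_le_supnorm:
  assumes "f \<in> Hinf d" "z \<in> unit_ball d"
  shows "cmod (f z) \<le> supnorm d f"
  unfolding supnorm_def
proof (rule cSUP_upper[OF assms(2)])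
  from assms(1) obtain b where "\<forall>z\<in>unit_ball d. cmod (f z) \<le> b" by (auto simp: Hinf_def bounded_iff)
  thus "bdd_above ((\<lambda>z. cmod (f z)) ` unit_ball d)" by (intro bdd_aboveI2) auto
qed

lemma Hinf_holo: "f \<in> Hinf d \<Longrightarrow> f \<in> holo d" by (simp add: Hinf_def)

lemma supnorm_nonneg: "f \<in> Hinf d \<Longrightarrow> 0 \<le> supnorm d f"
  using Hinf_norm_le_supnorm[OF _ zero_in_ball, of f d] norm_ge_zero[of "f (\<lambda>_. 0)"] by linarith

section \<open>Involutive automorphisms of the ball\<close>

text \<open>
  The involutive automorphism \<open>(l - P z - s * (z - P z)) / (1 - \<langle>z, l\<rangle>)\<close> of the ball, with \<open>P\<close> the orthogonal
  projection to the line through \<open>l\<close> and \<open>s = sqrt (1 - \<bar>l\<bar>\<^sup>2)\<close>. As \<open>(1 - s) / \<bar>l\<bar>\<^sup>2 = 1 / (1 + s)\<close>,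
  the numerator has a form that is also meaningful for \<open>l = 0\<close>.
\<close>

definition ball_aut :: "nat \<Rightarrow> (nat \<Rightarrow> complex) \<Rightarrow> (nat \<Rightarrow> complex) \<Rightarrow> nat \<Rightarrow> complex" where
  "ball_aut d l z = (\<lambda>j. ((1 - cinner d z l / of_real (1 + sqrt (1 - (cnorm d l)\<^sup>2))) * l j
      + (- of_real (sqrt (1 - (cnorm d l)\<^sup>2))) * z j) / (1 - cinner d z l))"

locale ball_point =
  fixes d :: nat and l :: "nat \<Rightarrow> complex"
  assumes l: "l \<in> unit_ball d"
begin

definition s :: complex where "s = of_real (sqrt (1 - (cnorm d l)\<^sup>2))"

lemma s_pos: "0 < sqrt (1 - (cnorm d l)\<^sup>2)"
  using l by (simp add: unit_ball_def cnorm_nonneg power_less_one_iff abs_square_less_1)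

lemma s_sq: "s\<^sup>2 = 1 - cinner d l l"
  using s_pos by (simp add: s_def cinner_self flip: of_real_power)

lemma s_facts: "s \<noteq> 0" "1 + s \<noteq> 0" "cnj s = s"
proof -
  show "s \<noteq> 0" using s_pos by (simp add: s_def)
  have "1 + s = of_real (1 + sqrt (1 - (cnorm d l)\<^sup>2))" by (simp add: s_def)
  also have "\<dots> \<noteq> 0" using s_pos unfolding of_real_eq_0_iff by linarith
  finally show "1 + s \<noteq> 0" .
  show "cnj s = s" by (simp add: s_def)
qed

lemma ball_aut_alt: "ball_aut d l z j = ((1 - cinner d z l / (1 + s)) * l j + (- s) * z j) / (1 - cinner d z l)"
  by (simp add: ball_aut_def s_def)

lemma ball_aut_eq_scale:
  "ball_aut d l z = (\<lambda>j. (1 / (1 - cinner d z l)) * ((1 - cinner d z l / (1 + s)) * l j + (- s) * z j))"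
  by (simp add: ball_aut_alt fun_eq_iff)

lemma den_nonzero: "z \<in> unit_ball d \<Longrightarrow> 1 - cinner d z l \<noteq> 0"
  using ball_one_minus_nonzero l by blast

text \<open>
  The identity behind both the invariance of the ball and the transformation of the kernel.
\<close>

lemma cinner_ball_aut:
  assumes z: "z \<in> unit_ball d" and w: "w \<in> unit_ball d"
  shows "1 - cinner d (ball_aut d l z) (ball_aut d l w)
    = s\<^sup>2 * (1 - cinner d z w) / ((1 - cinner d z l) * (1 - cinner d l w))"
proof -
  define q where "q = cinner d z l"
  define p where "p = cinner d l w"
  define x where "x = cinner d z w"
  define k where "k = 1 / (1 + s)"
  have k: "k * (1 + s) = 1" using s_facts by (simp add: k_def)
  have ll: "cinner d l l = (1 - s) * (1 + s)" using s_sq by (simp add: power2_eq_square algebra_simps)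
  have nz: "1 - q \<noteq> 0" "1 - p \<noteq> 0" using ball_one_minus_nonzero l z w by (auto simp: q_def p_def)
  have kr: "cnj k = k" using s_facts by (simp add: k_def)
  have p': "cnj (cinner d w l) = p" by (simp add: p_def cinner_commute[of d l w])
  define A where "A = 1 / (1 - q)"
  define B where "B = 1 / (1 - p)"
  have ez: "ball_aut d l z = (\<lambda>j. A * ((1 - q * k) * l j + (- s) * z j))"
    by (simp add: ball_aut_eq_scale A_def q_def k_def)
  have ew: "ball_aut d l w = (\<lambda>j. cnj B * ((1 - cnj p * k) * l j + (- s) * w j))"
    by (simp add: ball_aut_eq_scale B_def k_def flip: p')
  have "cinner d (ball_aut d l z) (ball_aut d l w) = A * (B *
     ((1 - q * k) * (1 - p * k) * cinner d l l - (1 - q * k) * s * p - s * (1 - p * k) * q + s * s * x))"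
    unfolding ez ew cinner_scale_left cinner_scale_right cinner_combine_left cinner_combine_right
      complex_cnj_mult complex_cnj_diff complex_cnj_minus complex_cnj_one complex_cnj_cnj kr s_facts(3)
      q_def[symmetric] x_def[symmetric] p_def[symmetric]
    by (simp add: algebra_simps power2_eq_square)
  also have "(1 - q * k) * (1 - p * k) * cinner d l l - (1 - q * k) * s * p - s * (1 - p * k) * q + s * s * x
      = (1 - q) * (1 - p) - s\<^sup>2 * (1 - x)"
  proof -
    \<comment> \<open>\<open>k\<close> is the inverse of \<open>1 + s\<close>; the second factor is the quotient of the left side by \<open>k * (1 + s) - 1\<close>\<close>
    have "(1 - q * k) * (1 - p * k) * ((1 - s) * (1 + s)) - (1 - q * k) * s * p - s * (1 - p * k) * q + s * s * x
      - ((1 - q) * (1 - p) - s\<^sup>2 * (1 - x))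
      = (k * (1 + s) - 1) * (q * p + q * p * k * (1 - s) - (p + q) * (1 - s))"
      by (simp add: algebra_simps power2_eq_square)
    thus ?thesis unfolding ll k by simp
  qed
  finally have "cinner d (ball_aut d l z) (ball_aut d l w) = ((1 - q) * (1 - p) - s\<^sup>2 * (1 - x)) / ((1 - q) * (1 - p))"
    by (simp add: A_def B_def)
  also have "\<dots> = 1 - s\<^sup>2 * (1 - x) / ((1 - q) * (1 - p))"
    unfolding diff_divide_distrib using nz by simp
  finally show ?thesis by (simp add: q_def p_def x_def)
qed

lemma ball_aut_in_ball:
  assumes z: "z \<in> unit_ball d"
  shows "ball_aut d l z \<in> unit_ball d"
proof -
  have 1: "ball_aut d l z \<in> cspace d"
    using z l by (auto simp: unit_ball_def cspace_def ball_aut_alt)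
  have den: "(1 - cinner d z l) * (1 - cinner d l z) = of_real ((cmod (1 - cinner d z l))\<^sup>2)"
    unfolding complex_norm_square using cinner_commute[of d l z] by simp
  have "of_real (1 - (cnorm d (ball_aut d l z))\<^sup>2) = 1 - cinner d (ball_aut d l z) (ball_aut d l z)"
    by (simp add: cinner_self)
  also have "\<dots> = of_real ((1 - (cnorm d l)\<^sup>2) * (1 - (cnorm d z)\<^sup>2) / (cmod (1 - cinner d z l))\<^sup>2)"
    unfolding cinner_ball_aut[OF z z] den s_sq by (simp add: cinner_self)
  finally have "1 - (cnorm d (ball_aut d l z))\<^sup>2 = (1 - (cnorm d l)\<^sup>2) * (1 - (cnorm d z)\<^sup>2) / (cmod (1 - cinner d z l))\<^sup>2"
    by (simp only: of_real_eq_iff)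
  also have "\<dots> > 0"
    using z l den_nonzero[OF z]
    by (intro divide_pos_pos mult_pos_pos) (auto simp: unit_ball_def cnorm_nonneg power_less_one_iff abs_square_less_1)
  finally have "(cnorm d (ball_aut d l z))\<^sup>2 < 1" by simp
  hence "cnorm d (ball_aut d l z) < 1" using cnorm_nonneg by (simp add: abs_square_less_1)
  with 1 show ?thesis by (simp add: unit_ball_def)
qed

lemma ball_aut_involution:
  assumes z: "z \<in> unit_ball d"
  shows "ball_aut d l (ball_aut d l z) = z"
proof
  fix j
  define q where "q = cinner d z l"
  define k where "k = 1 / (1 + s)"
  have k: "k * (1 + s) = 1" using s_facts by (simp add: k_def)
  have ll: "cinner d l l = (1 - s) * (1 + s)" using s_sq by (simp add: power2_eq_square algebra_simps)
  have nz: "1 - q \<noteq> 0" using den_nonzero[OF z] by (simp add: q_def)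
  have "cinner d (ball_aut d l z) l = (1 / (1 - q)) * ((1 - q * k) * cinner d l l - s * q)"
    unfolding ball_aut_eq_scale cinner_scale_left cinner_combine_left by (simp add: q_def k_def)
  also have "(1 - q * k) * cinner d l l - s * q = (1 - q) - s\<^sup>2"
  proof -
    have "(1 - q * k) * ((1 - s) * (1 + s)) - s * q - ((1 - q) - s\<^sup>2) = (k * (1 + s) - 1) * (- q * (1 - s))"
      by (simp add: algebra_simps power2_eq_square)
    thus ?thesis unfolding ll k by simp
  qed
  finally have q': "cinner d (ball_aut d l z) l = 1 - s\<^sup>2 / (1 - q)" using nz by (simp add: field_simps)
  have fraction: "((1 - (1 - S / m) * k) * L - s * (Y / m)) / (S / m) = ((m - (m - S) * k) * L - s * Y) / S"
    if "m \<noteq> 0" "S \<noteq> 0" for m S L Y :: complex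
    using that by (simp add: field_simps)
  have "ball_aut d l (ball_aut d l z) j = ((1 - (1 - s\<^sup>2 / (1 - q)) * k) * l j
      - s * (((1 - q * k) * l j - s * z j) / (1 - q))) / (s\<^sup>2 / (1 - q))"
    unfolding ball_aut_alt[of "ball_aut d l z"] q' unfolding ball_aut_alt[of z]
    by (simp add: q_def[symmetric] k_def)
  also have "\<dots> = ((1 - q - ((1 - q) - s\<^sup>2) * k) * l j - s * ((1 - q * k) * l j - s * z j)) / s\<^sup>2"
    by (rule fraction) (use nz s_facts in auto)
  also have "(1 - q - ((1 - q) - s\<^sup>2) * k) * l j - s * ((1 - q * k) * l j - s * z j) = s\<^sup>2 * z j"
  proof -
    have "(1 - q - ((1 - q) - s\<^sup>2) * k) * l j - s * ((1 - q * k) * l j - s * z j) - s\<^sup>2 * z j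
      = (k * (1 + s) - 1) * ((q - (1 - s)) * l j)" by (simp add: algebra_simps power2_eq_square)
    thus ?thesis unfolding k by simp
  qed
  finally show "ball_aut d l (ball_aut d l z) j = z j" using s_facts by simp
qed

lemma ball_aut_self: "ball_aut d l l = (\<lambda>_. 0)"
proof -
  have "((1 - cinner d l l / (1 + s)) * l j + (- s) * l j) = 0" for j
  proof -
    have "cinner d l l = (1 - s) * (1 + s)" using s_sq by (simp add: power2_eq_square algebra_simps)
    thus ?thesis using s_facts by simp
  qed
  thus ?thesis by (simp add: ball_aut_alt fun_eq_iff)
qed

lemma ball_aut_zero: "ball_aut d l (\<lambda>_. 0) = l"
  by (simp add: ball_aut_alt fun_eq_iff cinner_def)

lemma holo_ball_aut_compose:
  assumes "\<And>z. z \<in> unit_ball m \<Longrightarrow> u z \<in> unit_ball d" "\<And>i. (\<lambda>z. u z i) \<in> holo m"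
  shows "(\<lambda>z. ball_aut d l (u z) j) \<in> holo m"
  unfolding ball_aut_alt divide_inverse
  by (intro holo_mult holo_add holo_const holo_diff holo_inverse holo_cinner assms)
     (use den_nonzero assms in auto)

lemma holo_ball_aut: "(\<lambda>z. ball_aut d l z j) \<in> holo d"
  by (rule holo_ball_aut_compose) (auto intro: holo_coord)

end

section \<open>Positivity of the kernel composed with an automorphism\<close>

text \<open>
  The kernel \<open>\<langle>z, w\<rangle> ^ n\<close> is a sum of \<open>d\<close> kernels that arise from \<open>\<langle>z, w\<rangle> ^ (n - 1)\<close> by rescaling
  with a coordinate.
\<close>

lemma kquad_cinner_power_nonneg:
  "0 \<le> kquad (\<lambda>y x. cinner d (p y) (p x) ^ n) F a"
proof (induction n arbitrary: a)
  case 0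
  have "kform (\<lambda>y x. cinner d (p y) (p x) ^ 0) F a a = (\<Sum>x\<in>F. a x) * cnj (\<Sum>x\<in>F. a x)"
    by (simp add: kform_def sum_product)
  also have "\<dots> = of_real ((cmod (\<Sum>x\<in>F. a x))\<^sup>2)" by (simp only: complex_norm_square)
  finally have "kquad (\<lambda>y x. cinner d (p y) (p x) ^ 0) F a = (cmod (\<Sum>x\<in>F. a x))\<^sup>2"
    unfolding kquad_def by (simp only: Re_complex_of_real)
  thus ?case by simp
next
  case (Suc n)
  have "kform (\<lambda>y x. cinner d (p y) (p x) ^ Suc n) F a a
      = (\<Sum>x\<in>F. \<Sum>y\<in>F. \<Sum>i<d. (a x * cnj (p x i)) * cnj (a y * cnj (p y i)) * cinner d (p y) (p x) ^ n)"
    unfolding kform_def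
    by (intro sum.cong refl) (simp add: cinner_def[of d "p _"] sum_distrib_left sum_distrib_right mult_ac)
  also have "\<dots> = (\<Sum>i<d. kform (\<lambda>y x. cinner d (p y) (p x) ^ n) F (\<lambda>x. a x * cnj (p x i)) (\<lambda>x. a x * cnj (p x i)))"
    unfolding kform_def by (subst (2) sum.swap, subst sum.swap) (rule refl)
  finally show ?case
    unfolding kquad_def Re_sum using Suc.IH by (auto simp: kquad_def intro!: sum_nonneg)
qed

lemma kquad_power_series_nonneg:
  assumes "finite F" "\<And>n. 0 \<le> \<beta> n"
    and s: "\<And>x y. x \<in> F \<Longrightarrow> y \<in> F \<Longrightarrow> (\<lambda>n. of_real (\<beta> n) * cinner d (p y) (p x) ^ n) sums k y x"
  shows "0 \<le> kquad k F a"
proof -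
  have "(\<lambda>n. \<Sum>x\<in>F. \<Sum>y\<in>F. a x * cnj (a y) * (of_real (\<beta> n) * cinner d (p y) (p x) ^ n)) sums kform k F a a"
    unfolding kform_def by (intro sums_sum sums_mult s)
  moreover have "(\<Sum>x\<in>F. \<Sum>y\<in>F. a x * cnj (a y) * (of_real (\<beta> n) * cinner d (p y) (p x) ^ n))
      = of_real (\<beta> n) * kform (\<lambda>y x. cinner d (p y) (p x) ^ n) F a a" for n
    by (simp add: kform_def sum_distrib_left mult_ac)
  ultimately have "(\<lambda>n. of_real (\<beta> n) * kform (\<lambda>y x. cinner d (p y) (p x) ^ n) F a a) sums kform k F a a"
    by simp
  from sums_Re[OF this]
  have sum: "(\<lambda>n. \<beta> n * kquad (\<lambda>y x. cinner d (p y) (p x) ^ n) F a) sums kquad k F a"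
    by (simp add: kquad_def)
  show ?thesis
    by (rule sums_le[OF _ sums_zero sum]) (simp add: assms(2) kquad_cinner_power_nonneg)
qed

lemma Da_series:
  assumes "cmod t < 1"
  shows "(\<lambda>n. of_real (pochhammer a n / fact n) * t ^ n) sums (1 / (1 - t) powr of_real a)"
proof -
  have "(\<lambda>n. ((- of_real a) gchoose n) * (- t) ^ n) sums (1 + (- t)) powr (- of_real a)"
    by (rule gen_binomial_complex) (use assms in simp)
  moreover have "((- of_real a) gchoose n) * (- t) ^ n = of_real (pochhammer a n / fact n) * t ^ n" for n
  proof -
    have "((- of_real a :: complex) gchoose n) = (-1) ^ n * of_real (pochhammer a n / fact n)"
      by (simp add: gbinomial_pochhammer pochhammer_of_real)
    moreover have "(- t) ^ n = (-1) ^ n * t ^ n" by (rule power_minus)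
    ultimately have "((- of_real a) gchoose n) * (- t) ^ n
        = ((-1) ^ n * (-1) ^ n) * (of_real (pochhammer a n / fact n) * t ^ n)"
      by (simp only: mult_ac)
    thus ?thesis by (simp flip: power_mult_distrib)
  qed
  ultimately show ?thesis by (simp add: powr_minus_divide)
qed

text \<open>
  All Taylor coefficients of \<open>(m - t) / (1 - t) powr a\<close> are nonnegative once \<open>m \<ge> max 1 (1/a)\<close>, since
  the coefficients \<open>c\<close> of \<open>1 / (1 - t) powr a\<close> satisfy \<open>c (Suc j) / c j = (a + j) / (1 + j)\<close>. For \<open>m = M\<^sup>2\<close> this bound
  is the source of \<open>max 1 (a powr (-1/2))\<close>.
\<close>

lemma Da_shifted_series:
  assumes a: "0 < a" and M: "1 \<le> m" "1 / a \<le> m"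
  shows "\<exists>\<beta>. (\<forall>n. 0 \<le> \<beta> n) \<and> (\<forall>t. cmod t < 1 \<longrightarrow>
     (\<lambda>n. of_real (\<beta> n) * t ^ n) sums ((of_real m - t) * (1 / (1 - t) powr of_real a)))"
proof -
  define c where "c = (\<lambda>n. pochhammer a n / fact n)"
  define \<beta> where "\<beta> = (\<lambda>n. m * c n - (case n of 0 \<Rightarrow> 0 | Suc j \<Rightarrow> c j))"
  have c0: "0 \<le> c n" for n using a by (simp add: c_def pochhammer_nonneg)
  have "0 \<le> \<beta> n" for n
  proof (cases n)
    case 0 thus ?thesis using M c0[of 0] by (simp add: \<beta>_def)
  next
    case (Suc j)
    have "c (Suc j) = c j * ((a + real j) / real (Suc j))"
      by (simp add: c_def pochhammer_Suc fact_reduce divide_simps)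
    hence "\<beta> n = c j * (m * ((a + real j) / real (Suc j)) - 1)"
      by (simp add: \<beta>_def Suc algebra_simps)
    moreover have "1 \<le> m * ((a + real j) / real (Suc j))"
    proof -
      have "1 \<le> m * a" using M(2) a by (simp add: field_simps)
      moreover have "1 * real j \<le> m * real j" using M(1) by (intro mult_right_mono) auto
      ultimately have "real (Suc j) \<le> m * (a + real j)" by (simp add: distrib_left)
      thus ?thesis by (simp add: divide_simps)
    qed
    ultimately show ?thesis using c0[of j] by simp
  qed
  moreover have "(\<lambda>n. of_real (\<beta> n) * t ^ n) sums ((of_real m - t) * (1 / (1 - t) powr of_real a))"
    if t: "cmod t < 1" for t
  proof -
    define S where "S = 1 / (1 - t) powr of_real a"
    have s: "(\<lambda>n. of_real (c n) * t ^ n) sums S" using Da_series[OF t, of a] by (simp add: c_def S_def)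
    have "(\<lambda>n. t * (of_real (c n) * t ^ n)) sums (t * S)" by (rule sums_mult[OF s])
    hence "(\<lambda>n. of_real (case n of 0 \<Rightarrow> 0 | Suc j \<Rightarrow> c j) * t ^ n) sums (t * S + of_real (case 0 of 0 \<Rightarrow> 0 | Suc j \<Rightarrow> c j) * t ^ 0)"
      by (intro sums_Suc) (simp add: mult_ac)
    hence "(\<lambda>n. of_real (case n of 0 \<Rightarrow> 0 | Suc j \<Rightarrow> c j) * t ^ n) sums (t * S)" by simp
    from sums_diff[OF sums_mult[OF s, of "of_real m"] this]
    have "(\<lambda>n. of_real (\<beta> n) * t ^ n) sums (of_real m * S - t * S)"
      by (simp add: \<beta>_def left_diff_distrib mult.assoc)
    thus ?thesis by (simp only: S_def left_diff_distrib)
  qed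
  ultimately show ?thesis by blast
qed

lemma kquad_shifted_Da_nonneg:
  assumes "finite F" "\<And>x. x \<in> F \<Longrightarrow> p x \<in> unit_ball d" "0 < a" "1 \<le> m" "1 / a \<le> m"
  shows "0 \<le> kquad (\<lambda>y x. (of_real m - cinner d (p y) (p x)) * Da_kernel a d (p y) (p x)) F c"
proof -
  obtain \<beta> where \<beta>: "\<And>n. 0 \<le> \<beta> n" "\<And>t. cmod t < 1 \<Longrightarrow>
     (\<lambda>n. of_real (\<beta> n) * t ^ n) sums ((of_real m - t) * (1 / (1 - t) powr of_real a))"
    using Da_shifted_series[of a m] assms by auto
  show ?thesis
  proof (rule kquad_power_series_nonneg[where p = p and d = d, OF assms(1) \<beta>(1)])
    fix x y assume "x \<in> F" "y \<in> F"
    hence "cmod (cinner d (p y) (p x)) < 1" using assms(2) by (intro ball_cinner_less_1)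
    thus "(\<lambda>n. of_real (\<beta> n) * cinner d (p y) (p x) ^ n)
        sums ((of_real m - cinner d (p y) (p x)) * Da_kernel a d (p y) (p x))"
      unfolding Da_kernel_def by (rule \<beta>(2))
  qed
qed

lemma Re_one_minus_pos: "cmod t < 1 \<Longrightarrow> 0 < Re (1 - t)"
  using complex_Re_le_cmod[of t] by simp

lemma Im_Ln_one_minus: "cmod t < 1 \<Longrightarrow> \<bar>Im (Ln (1 - t))\<bar> < pi / 2"
  using Re_one_minus_pos[of t] Re_Ln_pos_lt[of "1 - t"] by fastforce

context ball_point
begin

text \<open>
  The logarithms of the factors in \<open>cinner_ball_aut\<close> add up for principal branches. A priori the sum is
  off by a multiple of \<open>2 * pi * \<i>\<close>. Besides the real number \<open>Ln s\<close> there are four logarithms of numbers in the right half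
  plane, and their imaginary parts are below \<open>pi / 2\<close> in absolute value.
\<close>

lemma Ln_cinner_ball_aut:
  assumes z: "z \<in> unit_ball d" and w: "w \<in> unit_ball d"
  shows "Ln (1 - cinner d z w) = Ln (1 - cinner d (ball_aut d l z) (ball_aut d l w))
     + Ln (1 - cinner d z l) + cnj (Ln (1 - cinner d w l)) - 2 * Ln s"
proof -
  let ?A = "1 - cinner d (ball_aut d l z) (ball_aut d l w)" and ?B = "1 - cinner d z l"
    and ?C = "1 - cinner d l w" and ?D = "1 - cinner d z w"
  have lt: "cmod (cinner d (ball_aut d l z) (ball_aut d l w)) < 1" "cmod (cinner d z l) < 1"
     "cmod (cinner d l w) < 1" "cmod (cinner d z w) < 1"
    using ball_cinner_less_1 z w l ball_aut_in_ball by blast+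
  have nz: "?A \<noteq> 0" "?B \<noteq> 0" "?C \<noteq> 0" "?D \<noteq> 0"
    using ball_one_minus_nonzero z w l ball_aut_in_ball by blast+
  have s: "s \<noteq> 0" by (rule s_facts)
  define h where "h = Ln ?A + Ln ?B + Ln ?C - 2 * Ln s - Ln ?D"
  have "exp h = ?A * ?B * ?C / (s\<^sup>2) / ?D"
    unfolding h_def exp_diff exp_add using nz s exp_double[of "Ln s"] by simp
  also have "\<dots> = 1"
  proof -
    have "X * B * D / S / E = 1" if "X = S * E / (B * D)" "B \<noteq> 0" "D \<noteq> 0" "S \<noteq> 0" "E \<noteq> 0"
      for X B D S E :: complex using that by simp
    from this[OF cinner_ball_aut[OF z w] nz(2,3) _ nz(4)] s show ?thesis by simp
  qed
  finally obtain n :: int where n: "Re h = 0" "Im h = of_int (2 * n) * pi" by (auto simp: exp_eq_1)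
  have "Im (Ln s) = 0" using s_pos by (simp add: s_def Ln_of_real)
  hence "\<bar>Im h\<bar> < 2 * pi"
    using Im_Ln_one_minus[OF lt(1)] Im_Ln_one_minus[OF lt(2)] Im_Ln_one_minus[OF lt(3)] Im_Ln_one_minus[OF lt(4)]
    by (simp add: h_def)
  hence "\<bar>real_of_int (2 * n)\<bar> * pi < 2 * pi" using n(2) by (simp add: abs_mult)
  hence "n = 0" by (simp add: abs_mult)
  hence h0: "h = 0" using n by (simp add: complex_eq_iff)
  have "cnj (1 - cinner d w l) = ?C" using cinner_commute[of d l w] by simp
  moreover have "cnj (Ln (1 - cinner d w l)) = Ln (cnj (1 - cinner d w l))"
  proof (rule cnj_Ln)
    have "0 < Re (1 - cinner d w l)" by (rule Re_one_minus_pos[OF ball_cinner_less_1[OF w l]])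
    thus "1 - cinner d w l \<notin> \<real>\<^sub>\<le>\<^sub>0" by (auto simp: complex_nonpos_Reals_iff)
  qed
  ultimately show ?thesis using h0 by (simp add: h_def)
qed

text \<open>
  Composition with the automorphism changes the kernel only by a rank one factor.
\<close>

lemma Da_kernel_ball_aut:
  obtains \<gamma> where "\<And>z w. z \<in> unit_ball d \<Longrightarrow> w \<in> unit_ball d \<Longrightarrow>
     Da_kernel a d z w = \<gamma> z * cnj (\<gamma> w) * Da_kernel a d (ball_aut d l z) (ball_aut d l w)"
proof
  define \<gamma> where "\<gamma> = (\<lambda>z. exp (of_real a * (Ln s - Ln (1 - cinner d z l))))"
  fix z w assume z: "z \<in> unit_ball d" and w: "w \<in> unit_ball d"
  have D: "Da_kernel a d x y = exp (- of_real a * Ln (1 - cinner d x y))"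
    if "x \<in> unit_ball d" "y \<in> unit_ball d" for x y
    using ball_one_minus_nonzero[OF that] by (simp add: Da_kernel_def powr_def exp_minus divide_inverse)
  have "cnj (Ln s) = Ln s" using s_pos by (simp add: s_def Ln_of_real)
  hence g: "cnj (\<gamma> w) = exp (of_real a * (Ln s - cnj (Ln (1 - cinner d w l))))"
    by (simp add: \<gamma>_def exp_cnj)
  show "Da_kernel a d z w = \<gamma> z * cnj (\<gamma> w) * Da_kernel a d (ball_aut d l z) (ball_aut d l w)"
    unfolding g D[OF z w] D[OF ball_aut_in_ball[OF z] ball_aut_in_ball[OF w]] Ln_cinner_ball_aut[OF z w]
    unfolding \<gamma>_def exp_add[symmetric] by (simp add: algebra_simps)
qed

lemma kquad_shifted_ball_aut_nonneg:
  assumes F: "finite F" "F \<subseteq> unit_ball d" and a: "0 < a" "1 \<le> m" "1 / a \<le> m"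
  shows "0 \<le> kquad (\<lambda>y x. (of_real m - cinner d (ball_aut d l y) (ball_aut d l x)) * Da_kernel a d y x) F c"
proof -
  obtain \<gamma> where \<gamma>: "\<And>z w. z \<in> unit_ball d \<Longrightarrow> w \<in> unit_ball d \<Longrightarrow>
     Da_kernel a d z w = \<gamma> z * cnj (\<gamma> w) * Da_kernel a d (ball_aut d l z) (ball_aut d l w)"
    using Da_kernel_ball_aut[of a] by blast
  have "0 \<le> kquad (\<lambda>y x. (of_real m - cinner d (ball_aut d l y) (ball_aut d l x)) * Da_kernel a d (ball_aut d l y) (ball_aut d l x)) F
      (\<lambda>x. c x * cnj (\<gamma> x))"
    by (rule kquad_shifted_Da_nonneg[OF F(1) _ a]) (use F ball_aut_in_ball in auto)
  also have "\<dots> = kquad (\<lambda>y x. (of_real m - cinner d (ball_aut d l y) (ball_aut d l x)) * Da_kernel a d y x) F c"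
    unfolding kquad_def kform_def
  proof (intro arg_cong[of _ _ Re] sum.cong refl)
    fix x y assume "x \<in> F" "y \<in> F"
    hence "Da_kernel a d y x = \<gamma> y * cnj (\<gamma> x) * Da_kernel a d (ball_aut d l y) (ball_aut d l x)"
      using F by (intro \<gamma>) auto
    thus "c x * cnj (\<gamma> x) * cnj (c y * cnj (\<gamma> y)) *
         ((of_real m - cinner d (ball_aut d l y) (ball_aut d l x)) * Da_kernel a d (ball_aut d l y) (ball_aut d l x)) =
         c x * cnj (c y) * ((of_real m - cinner d (ball_aut d l y) (ball_aut d l x)) * Da_kernel a d y x)"
      by simp
  qed
  finally show ?thesis .
qed

end

section \<open>Orthonormal systems\<close>

definition orthonormal :: "nat \<Rightarrow> nat \<Rightarrow> (nat \<Rightarrow> nat \<Rightarrow> complex) \<Rightarrow> bool" where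
  "orthonormal d r e \<longleftrightarrow> (\<forall>i<r. e i \<in> cspace d) \<and>
     (\<forall>i<r. \<forall>j<r. cinner d (e i) (e j) = (if i = j then 1 else 0))"

definition synth :: "nat \<Rightarrow> (nat \<Rightarrow> nat \<Rightarrow> complex) \<Rightarrow> (nat \<Rightarrow> complex) \<Rightarrow> nat \<Rightarrow> complex" where
  "synth r e w = (\<lambda>j. \<Sum>i<r. w i * e i j)"

text \<open>
  Coordinates of the projection of \<open>u\<close> to the span of \<open>e 0, \<dots>, e (r - 1)\<close>, padded with zeros. So the result
  lies in \<open>cspace k\<close> for every \<open>k \<ge> r\<close>.
\<close>

definition coords :: "nat \<Rightarrow> nat \<Rightarrow> (nat \<Rightarrow> nat \<Rightarrow> complex) \<Rightarrow> (nat \<Rightarrow> complex) \<Rightarrow> nat \<Rightarrow> complex" where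
  "coords d r e u = (\<lambda>i. if i < r then cinner d u (e i) else 0)"

abbreviation proj :: "nat \<Rightarrow> nat \<Rightarrow> (nat \<Rightarrow> nat \<Rightarrow> complex) \<Rightarrow> (nat \<Rightarrow> complex) \<Rightarrow> nat \<Rightarrow> complex" where
  "proj d r e u \<equiv> synth r e (coords d r e u)"

lemma cinner_diff_left: "cinner d (\<lambda>j. x j - y j) w = cinner d x w - cinner d y w"
  by (simp add: cinner_def left_diff_distrib sum_subtractf)

lemma cinner_diff_right: "cinner d w (\<lambda>j. x j - y j) = cinner d w x - cinner d w y"
  by (simp add: cinner_def right_diff_distrib sum_subtractf)

lemma cinner_synth_left: "cinner d (synth r e w) y = (\<Sum>i<r. w i * cinner d (e i) y)"
  unfolding synth_def cinner_sum_left by (simp add: cinner_scale_left)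

lemma cinner_synth_right: "cinner d y (synth r e w) = (\<Sum>i<r. cnj (w i) * cinner d y (e i))"
  unfolding synth_def cinner_sum_right by (simp add: cinner_scale_right)

lemma synth_cong: "(\<And>i. i < r \<Longrightarrow> w i = v i) \<Longrightarrow> synth r e w = synth r e v"
  unfolding synth_def by (intro ext sum.cong) auto

lemma coords_synth:
  assumes "orthonormal d r e" "i < r"
  shows "coords d r e (synth r e w) i = w i"
proof -
  have "coords d r e (synth r e w) i = (\<Sum>k<r. w k * cinner d (e k) (e i))"
    using assms(2) by (simp add: coords_def cinner_synth_left)
  also have "\<dots> = (\<Sum>k<r. if k = i then w k else 0)"
    using assms by (intro sum.cong refl) (simp add: orthonormal_def)
  finally show ?thesis using assms(2) by simp
qed

lemma proj_proj:
  assumes "orthonormal d r e"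
  shows "proj d r e (proj d r e u) = proj d r e u"
  by (rule synth_cong) (rule coords_synth[OF assms])

lemma cinner_proj_left:
  "cinner d (proj d r e u) w = (\<Sum>i<r. coords d r e u i * cnj (coords d r e w i))"
  unfolding cinner_synth_left by (intro sum.cong refl) (simp add: coords_def cinner_commute[of d w])

lemma cinner_proj_right:
  "cinner d u (proj d r e w) = (\<Sum>i<r. coords d r e u i * cnj (coords d r e w i))"
  unfolding cinner_synth_right by (intro sum.cong refl) (simp add: coords_def)

lemma cinner_proj_residual:
  assumes "orthonormal d r e"
  shows "cinner d (\<lambda>j. u j - proj d r e u j) (\<lambda>j. w j - proj d r e w j)
    = cinner d u w - (\<Sum>i<r. coords d r e u i * cnj (coords d r e w i))"
proof -
  have "cinner d (proj d r e u) (proj d r e w) = (\<Sum>i<r. coords d r e u i * cnj (coords d r e w i))"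
    unfolding cinner_proj_right by (intro sum.cong refl) (simp add: coords_synth[OF assms])
  thus ?thesis by (simp add: cinner_diff_left cinner_diff_right cinner_proj_left cinner_proj_right)
qed

lemma proj_residual_orthogonal:
  assumes "orthonormal d r e" "i < r"
  shows "cinner d (\<lambda>j. u j - proj d r e u j) (e i) = 0"
  using coords_synth[OF assms, of "coords d r e u"] assms(2) by (simp add: cinner_diff_left coords_def)

lemma bessel:
  assumes "orthonormal d r e"
  shows "(\<Sum>i<r. (cmod (coords d r e u i))\<^sup>2) \<le> (cnorm d u)\<^sup>2"
proof -
  have "of_real ((cnorm d (\<lambda>j. u j - proj d r e u j))\<^sup>2)
      = (of_real ((cnorm d u)\<^sup>2 - (\<Sum>i<r. (cmod (coords d r e u i))\<^sup>2)) :: complex)"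
    using cinner_proj_residual[OF assms, of u u]
    by (simp only: cinner_self of_real_diff of_real_sum complex_norm_square)
  hence "(cnorm d (\<lambda>j. u j - proj d r e u j))\<^sup>2 = (cnorm d u)\<^sup>2 - (\<Sum>i<r. (cmod (coords d r e u i))\<^sup>2)"
    by (simp only: of_real_eq_iff)
  thus ?thesis using zero_le_power2[of "cnorm d (\<lambda>j. u j - proj d r e u j)"] by linarith
qed

lemma cnorm_sq: "(cnorm d u)\<^sup>2 = (\<Sum>i<d. (cmod (u i))\<^sup>2)"
  by (simp add: cnorm_def L2_set_def sum_nonneg)

lemma unit_ball_iff: "u \<in> unit_ball d \<longleftrightarrow> u \<in> cspace d \<and> (\<Sum>i<d. (cmod (u i))\<^sup>2) < 1"
  unfolding unit_ball_def cnorm_sq[symmetric]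
  using cnorm_nonneg[of d u] by (auto simp: abs_square_less_1)

lemma coords_in_ball:
  assumes "orthonormal d r e" "r \<le> k" "u \<in> unit_ball d"
  shows "coords d r e u \<in> unit_ball k"
proof -
  have "(\<Sum>i<k. (cmod (coords d r e u i))\<^sup>2) = (\<Sum>i<r. (cmod (coords d r e u i))\<^sup>2)"
    using assms(2) by (intro sum.mono_neutral_right) (auto simp: coords_def)
  also have "\<dots> \<le> (cnorm d u)\<^sup>2" by (rule bessel[OF assms(1)])
  also have "\<dots> < 1" using assms(3) by (simp add: unit_ball_iff cnorm_sq)
  finally show ?thesis using assms(2) by (simp add: unit_ball_iff cspace_def coords_def)
qed

lemma synth_in_ball:
  assumes "orthonormal d r e" "r \<le> k" "w \<in> unit_ball k"
  shows "synth r e w \<in> unit_ball d"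
proof -
  have "of_real ((cnorm d (synth r e w))\<^sup>2) = cinner d (synth r e w) (synth r e w)"
    by (simp only: cinner_self)
  also have "\<dots> = (\<Sum>i<r. cnj (w i) * coords d r e (synth r e w) i)"
    unfolding cinner_synth_right[of _ "synth r e w"] by (intro sum.cong refl) (simp add: coords_def)
  also have "\<dots> = of_real (\<Sum>i<r. (cmod (w i))\<^sup>2)"
    unfolding of_real_sum complex_norm_square
    by (intro sum.cong refl) (simp add: coords_synth[OF assms(1)])
  finally have "(cnorm d (synth r e w))\<^sup>2 = (\<Sum>i<r. (cmod (w i))\<^sup>2)" by (simp only: of_real_eq_iff)
  also have "\<dots> \<le> (\<Sum>i<k. (cmod (w i))\<^sup>2)" using assms(2) by (intro sum_mono2) auto
  also have "\<dots> < 1" using assms(3) by (simp add: unit_ball_iff)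
  finally have "(\<Sum>i<d. (cmod (synth r e w i))\<^sup>2) < 1" by (simp only: cnorm_sq)
  moreover have "synth r e w \<in> cspace d"
    using assms(1) by (simp add: orthonormal_def cspace_def synth_def)
  ultimately show ?thesis by (simp add: unit_ball_iff)
qed

lemma holo_coords: "(\<And>i. (\<lambda>z. u z i) \<in> holo m) \<Longrightarrow> (\<lambda>z. coords d r e (u z) i) \<in> holo m"
  unfolding coords_def by (cases "i < r") (simp_all add: holo_cinner holo_const)

lemma holo_synth: "(\<And>i. (\<lambda>z. w z i) \<in> holo m) \<Longrightarrow> (\<lambda>z. synth r e (w z) j) \<in> holo m"
  unfolding synth_def by (intro holo_sum holo_mult holo_const)

lemma kquad_gram:
  "kquad (\<lambda>y x. (\<Sum>i\<in>I. \<psi> i y * cnj (\<psi> i x)) * K y x) F c = (\<Sum>i\<in>I. kquad K F (\<lambda>x. c x * cnj (\<psi> i x)))"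
proof -
  have "kform (\<lambda>y x. (\<Sum>i\<in>I. \<psi> i y * cnj (\<psi> i x)) * K y x) F c c
      = (\<Sum>x\<in>F. \<Sum>y\<in>F. \<Sum>i\<in>I. (c x * cnj (\<psi> i x)) * cnj (c y * cnj (\<psi> i y)) * K y x)"
    unfolding kform_def by (intro sum.cong refl) (simp add: sum_distrib_left sum_distrib_right mult_ac)
  also have "\<dots> = (\<Sum>i\<in>I. kform K F (\<lambda>x. c x * cnj (\<psi> i x)) (\<lambda>x. c x * cnj (\<psi> i x)))"
    unfolding kform_def by (subst (2) sum.swap, subst sum.swap) (rule refl)
  finally show ?thesis by (simp add: kquad_def)
qed

lemma kquad_kernel_combine:
  "kquad (\<lambda>y x. (of_real s * A y x + of_real t * B y x) * K y x) F c
    = s * kquad (\<lambda>y x. A y x * K y x) F c + t * kquad (\<lambda>y x. B y x * K y x) F c"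
proof -
  have "kform (\<lambda>y x. (of_real s * A y x + of_real t * B y x) * K y x) F c c
    = of_real s * kform (\<lambda>y x. A y x * K y x) F c c + of_real t * kform (\<lambda>y x. B y x * K y x) F c c"
    unfolding kform_def sum_distrib_left sum.distrib[symmetric]
    by (intro sum.cong refl) (simp add: algebra_simps)
  thus ?thesis by (simp add: kquad_def)
qed

context ball_point
begin

text \<open>
  The coordinates of the automorphism with respect to an orthonormal system form a row multiplier of
  norm at most \<open>sqrt m\<close>. For the standard basis this is the positivity of
  \<open>(m - \<langle>\<phi> z, \<phi> w\<rangle>) * K z w\<close>. The residual \<open>u\<close> of the projection to a smaller
  system contributes nonnegative terms.
\<close>

lemma kquad_row_le:
  assumes pd: "pd_kernel (unit_ball d) (Da_kernel a d)" and a: "0 < a" "1 \<le> m" "1 / a \<le> m"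
    and e: "orthonormal d r e" "r \<le> k" and F: "finite F" "F \<subseteq> unit_ball d"
  shows "(\<Sum>i<k. kquad (Da_kernel a d) F (\<lambda>x. c x * cnj (coords d r e (ball_aut d l x) i)))
    \<le> m * kquad (Da_kernel a d) F c"
proof -
  interpret pd_kernel "unit_ball d" "Da_kernel a d" by (rule pd)
  let ?K = "Da_kernel a d"
  define u where "u = (\<lambda>x j. ball_aut d l x j - proj d r e (ball_aut d l x) j)"
  have 1: "cinner d (ball_aut d l y) (ball_aut d l x)
      = (\<Sum>i<r. coords d r e (ball_aut d l y) i * cnj (coords d r e (ball_aut d l x) i)) + (\<Sum>j<d. u y j * cnj (u x j))"
    for x y
    using cinner_proj_residual[OF e(1), of "ball_aut d l y" "ball_aut d l x"] by (simp add: u_def cinner_def)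
  have "0 \<le> kquad (\<lambda>y x. (of_real m - cinner d (ball_aut d l y) (ball_aut d l x)) * ?K y x) F c"
    by (rule kquad_shifted_ball_aut_nonneg[OF F a])
  also have "\<dots> = kquad (\<lambda>y x. (of_real m * 1 + of_real (-1) * cinner d (ball_aut d l y) (ball_aut d l x)) * ?K y x) F c"
    by simp
  also have "\<dots> = m * kquad ?K F c - kquad (\<lambda>y x. cinner d (ball_aut d l y) (ball_aut d l x) * ?K y x) F c"
    by (subst kquad_kernel_combine) simp
  also have "kquad (\<lambda>y x. cinner d (ball_aut d l y) (ball_aut d l x) * ?K y x) F c
     = (\<Sum>i<r. kquad ?K F (\<lambda>x. c x * cnj (coords d r e (ball_aut d l x) i)))
       + (\<Sum>j<d. kquad ?K F (\<lambda>x. c x * cnj (u x j)))"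
    unfolding 1 kquad_gram[symmetric]
    using kquad_kernel_combine[of 1 _ 1] by simp
  finally have "(\<Sum>i<r. kquad ?K F (\<lambda>x. c x * cnj (coords d r e (ball_aut d l x) i)))
       + (\<Sum>j<d. kquad ?K F (\<lambda>x. c x * cnj (u x j))) \<le> m * kquad ?K F c" by simp
  moreover have "0 \<le> (\<Sum>j<d. kquad ?K F (\<lambda>x. c x * cnj (u x j)))"
    by (intro sum_nonneg kquad_nonneg F)
  moreover have "(\<Sum>i<k. kquad ?K F (\<lambda>x. c x * cnj (coords d r e (ball_aut d l x) i)))
      = (\<Sum>i<r. kquad ?K F (\<lambda>x. c x * cnj (coords d r e (ball_aut d l x) i)))"
    using e(2) by (intro sum.mono_neutral_right) (auto simp: coords_def kquad_def kform_def)
  ultimately show ?thesis by simp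
qed

end

section \<open>Maximal orthonormal sets\<close>

definition orthonormal_set :: "nat \<Rightarrow> (nat \<Rightarrow> complex) set \<Rightarrow> bool" where
  "orthonormal_set d E \<longleftrightarrow> finite E \<and> E \<subseteq> cspace d \<and> (\<forall>x\<in>E. \<forall>y\<in>E. cinner d x y = (if x = y then 1 else 0))"

lemma cinner_sum_orthonormal_set:
  assumes "orthonormal_set d E" "y \<in> E"
  shows "cinner d (\<lambda>j. \<Sum>x\<in>E. a x * x j) y = a y"
proof -
  have "cinner d (\<lambda>j. \<Sum>x\<in>E. a x * x j) y = (\<Sum>x\<in>E. a x * cinner d x y)"
    unfolding cinner_sum_left by (simp add: cinner_scale_left)
  also have "\<dots> = (\<Sum>x\<in>E. if x = y then a x else 0)"
    using assms by (intro sum.cong refl) (simp add: orthonormal_set_def)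
  finally show ?thesis using assms by (simp add: orthonormal_set_def)
qed

lemma orthonormal_set_indep: "orthonormal_set d E \<Longrightarrow> indep_fam E (\<lambda>x. x)"
proof (rule indep_famI)
  fix a y assume E: "orthonormal_set d E" and z: "\<And>j. (\<Sum>x\<in>E. a x * x j) = 0" and y: "y \<in> E"
  have "a y = cinner d (\<lambda>j. \<Sum>x\<in>E. a x * x j) y" using cinner_sum_orthonormal_set[OF E y] by simp
  also have "\<dots> = 0" by (simp add: z cinner_def)
  finally show "a y = 0" .
qed

lemma card_orthonormal_set_le: "orthonormal_set d E \<Longrightarrow> card E \<le> d"
  using card_indep_fam_le[OF _ _ orthonormal_set_indep, of "{..<d}" E d]
  by (auto simp: orthonormal_set_def cspace_def subset_eq)

text \<open>
  Orthonormal sets in \<open>cspace d\<close> have at most \<open>d\<close> elements, so one of largest size exists. A vector orthogonal to it could be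
  normalized and added.
\<close>

lemma maximal_orthonormal_set:
  assumes "orthonormal_set d E0" "E0 \<subseteq> S" "S \<subseteq> cspace d" "\<And>x t. x \<in> S \<Longrightarrow> (\<lambda>j. t * x j) \<in> S"
  obtains E where "orthonormal_set d E" "E0 \<subseteq> E" "E \<subseteq> S"
    "\<forall>x\<in>S. (\<forall>y\<in>E. cinner d x y = 0) \<longrightarrow> x = (\<lambda>_. 0)"
proof -
  define P where "P = (\<lambda>m. \<exists>E. orthonormal_set d E \<and> E0 \<subseteq> E \<and> E \<subseteq> S \<and> card E = m)"
  have P0: "P (card E0)" using assms unfolding P_def by blast
  have bd: "\<forall>m. P m \<longrightarrow> m \<le> d" unfolding P_def using card_orthonormal_set_le by blast
  define m where "m = Greatest P"
  have m: "P m" "\<And>j. P j \<Longrightarrow> j \<le> m"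
    unfolding m_def using GreatestI_nat[of P "card E0" d] P0 Greatest_le_nat[of P _ d] bd by auto
  then obtain E where E: "orthonormal_set d E" "E0 \<subseteq> E" "E \<subseteq> S" "card E = m" unfolding P_def by blast
  have "x = (\<lambda>_. 0)" if x: "x \<in> S" and o: "\<And>y. y \<in> E \<Longrightarrow> cinner d x y = 0" for x
  proof (rule ccontr)
    assume x0: "x \<noteq> (\<lambda>_. 0)"
    hence N: "cnorm d x \<noteq> 0" using cnorm_eq_0[of x d] x assms(3) by blast
    define u where "u = (\<lambda>j. of_real (1 / cnorm d x) * x j)"
    have uS: "u \<in> S" unfolding u_def by (rule assms(4)[OF x])
    have uu: "cinner d u u = 1"
      unfolding u_def cinner_scale_left cinner_scale_right cinner_self
      using N by (simp add: power2_eq_square)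
    have uy: "cinner d u y = 0" "cinner d y u = 0" if "y \<in> E" for y
    proof -
      show 1: "cinner d u y = 0" unfolding u_def cinner_scale_left o[OF that] by simp
      show "cinner d y u = 0" unfolding cinner_commute[of d y u] 1 by simp
    qed
    have uE: "u \<notin> E" using uu uy by auto
    have "orthonormal_set d (insert u E)"
      using E(1) uu uy uS assms(3) uE by (auto simp: orthonormal_set_def)
    hence "P (card (insert u E))" unfolding P_def using E uS by blast
    from m(2)[OF this] show False using uE E by (simp add: orthonormal_set_def)
  qed
  with E that show thesis by blast
qed

section \<open>Upper triangular functional calculi\<close>

text \<open>
  A representation of the holomorphic functions by upper triangular matrices \<open>\<rho> f\<close>, together with the
  constants for the division problem. The values of \<open>\<rho> f\<close> outside of the first \<open>n\<close> rows
  and columns are arbitrary.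
\<close>

locale triangular_calculus =
  fixes d n :: nat and \<rho> :: "((nat \<Rightarrow> complex) \<Rightarrow> complex) \<Rightarrow> nat \<Rightarrow> nat \<Rightarrow> complex"
    and C :: "nat \<Rightarrow> real"
  assumes d_pos: "1 \<le> d"
    and gleason: "1 \<le> k \<Longrightarrow> gleason_constant k (C k)"
    and rep_add: "f \<in> holo d \<Longrightarrow> g \<in> holo d \<Longrightarrow> r < n \<Longrightarrow> s < n \<Longrightarrow>
        \<rho> (\<lambda>z. f z + g z) r s = \<rho> f r s + \<rho> g r s"
    and rep_scale: "f \<in> holo d \<Longrightarrow> r < n \<Longrightarrow> s < n \<Longrightarrow> \<rho> (\<lambda>z. c * f z) r s = c * \<rho> f r s"
    and rep_mult: "f \<in> holo d \<Longrightarrow> g \<in> holo d \<Longrightarrow> r < n \<Longrightarrow> s < n \<Longrightarrow>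
        \<rho> (\<lambda>z. f z * g z) r s = (\<Sum>t<n. \<rho> f r t * \<rho> g t s)"
    and rep_one: "r < n \<Longrightarrow> s < n \<Longrightarrow> \<rho> (\<lambda>_. 1) r s = (if r = s then 1 else 0)"
    and rep_upper: "f \<in> holo d \<Longrightarrow> s < r \<Longrightarrow> r < n \<Longrightarrow> \<rho> f r s = 0"
    and rep_local: "f \<in> holo d \<Longrightarrow> g \<in> holo d \<Longrightarrow> (\<And>z. z \<in> unit_ball d \<Longrightarrow> f z = g z) \<Longrightarrow>
        r < n \<Longrightarrow> s < n \<Longrightarrow> \<rho> f r s = \<rho> g r s"
begin

text \<open>
  The functions whose matrix kills the first \<open>m\<close> basis vectors.
\<close>

definition ann :: "nat \<Rightarrow> ((nat \<Rightarrow> complex) \<Rightarrow> complex) set" where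
  "ann m = {f \<in> holo d. \<forall>r<n. \<forall>s<m. \<rho> f r s = 0}"

lemma ann_holo: "f \<in> ann m \<Longrightarrow> f \<in> holo d" by (simp add: ann_def)

lemma ann_cong:
  assumes "f \<in> ann m" "m \<le> n" "\<And>z. z \<in> unit_ball d \<Longrightarrow> f z = g z"
  shows "g \<in> ann m"
proof -
  have f: "f \<in> holo d" using assms by (simp add: ann_def)
  have g: "g \<in> holo d" by (rule holo_cong[OF assms(3) f])
  have "\<rho> g r s = \<rho> f r s" if "r < n" "s < m" for r s
    using rep_local[OF g f _ that(1)] assms that by simp
  thus ?thesis using assms(1) g by (simp add: ann_def)
qed

lemma ann_add: "f \<in> ann m \<Longrightarrow> g \<in> ann m \<Longrightarrow> m \<le> n \<Longrightarrow> (\<lambda>z. f z + g z) \<in> ann m"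
  by (auto simp: ann_def holo_add rep_add)

lemma ann_scale: "f \<in> ann m \<Longrightarrow> m \<le> n \<Longrightarrow> (\<lambda>z. c * f z) \<in> ann m"
  by (auto simp: ann_def holo_scale rep_scale)

lemma ann_zero: "m \<le> n \<Longrightarrow> (\<lambda>_. 0) \<in> ann m"
  using rep_scale[OF holo_const[of 0], of _ _ 0] by (auto simp: ann_def holo_const)

lemma ann_sum: "(\<And>i. i \<in> I \<Longrightarrow> f i \<in> ann m) \<Longrightarrow> m \<le> n \<Longrightarrow> (\<lambda>z. \<Sum>i\<in>I. f i z) \<in> ann m"
  by (induction I rule: infinite_finite_induct) (auto intro: ann_zero ann_add)

lemma ann_mult_left:
  assumes "f \<in> ann m" "h \<in> holo d" "m \<le> n"
  shows "(\<lambda>z. h z * f z) \<in> ann m"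
  using assms by (auto simp: ann_def holo_mult rep_mult)

lemma ann_mult_right:
  assumes "f \<in> ann m" "h \<in> holo d" "m \<le> n"
  shows "(\<lambda>z. f z * h z) \<in> ann m"
  using ann_mult_left[OF assms] by (simp add: mult.commute)

text \<open>
  Each factor \<open>h\<close> with a zero at the \<open>m\<close>-th diagonal place improves the order of annihilation by one.
\<close>

lemma ann_step:
  assumes f: "f \<in> ann m" and h: "h \<in> holo d" "\<rho> h m m = 0" and m: "m < n"
  shows "(\<lambda>z. f z * h z) \<in> ann (Suc m)"
proof -
  have "\<rho> (\<lambda>z. f z * h z) r s = 0" if r: "r < n" and s: "s < Suc m" for r s
  proof -
    have "\<rho> f r t * \<rho> h t s = 0" if t: "t < n" for t
    proof (cases "t < m")
      case True thus ?thesis using f r by (simp add: ann_def)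
    next
      case False
      hence "s < t \<or> t = m \<and> s = m" using s by auto
      thus ?thesis using rep_upper[OF h(1) _ t] h(2) by auto
    qed
    hence "(\<Sum>t<n. \<rho> f r t * \<rho> h t s) = 0" by (intro sum.neutral) auto
    thus ?thesis using rep_mult[OF ann_holo[OF f] h(1) r] s m by simp
  qed
  thus ?thesis using f h by (simp add: ann_def holo_mult)
qed

lemma ann_mono: "m \<le> m' \<Longrightarrow> ann m' \<subseteq> ann m"
  by (auto simp: ann_def)

section \<open>Spectral points\<close>

abbreviation chi :: "nat \<Rightarrow> ((nat \<Rightarrow> complex) \<Rightarrow> complex) \<Rightarrow> complex" where "chi m f \<equiv> \<rho> f m m"

lemma chi_mult:
  assumes "f \<in> holo d" "g \<in> holo d" "m < n"
  shows "chi m (\<lambda>z. f z * g z) = chi m f * chi m g"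
proof -
  have "chi m (\<lambda>z. f z * g z) = (\<Sum>t<n. \<rho> f m t * \<rho> g t m)" using assms by (simp add: rep_mult)
  also have "\<dots> = (\<Sum>t\<in>{m}. \<rho> f m t * \<rho> g t m)"
  proof (rule sum.mono_neutral_right)
    show "\<forall>t\<in>{..<n} - {m}. \<rho> f m t * \<rho> g t m = 0"
    proof
      fix t assume "t \<in> {..<n} - {m}"
      thus "\<rho> f m t * \<rho> g t m = 0"
        using rep_upper[OF assms(1), of t m] rep_upper[OF assms(2), of m t] assms(3)
        by (cases "t < m") auto
    qed
  qed (use assms in auto)
  finally show ?thesis by simp
qed

lemma chi_add: "f \<in> holo d \<Longrightarrow> g \<in> holo d \<Longrightarrow> m < n \<Longrightarrow> chi m (\<lambda>z. f z + g z) = chi m f + chi m g"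
  by (simp add: rep_add)

lemma chi_scale: "f \<in> holo d \<Longrightarrow> m < n \<Longrightarrow> chi m (\<lambda>z. c * f z) = c * chi m f"
  by (simp add: rep_scale)

lemma chi_const: "m < n \<Longrightarrow> chi m (\<lambda>_. c) = c"
  using chi_scale[OF holo_const[of 1], of m c] by (simp add: rep_one)

lemma chi_diff: "f \<in> holo d \<Longrightarrow> g \<in> holo d \<Longrightarrow> m < n \<Longrightarrow> chi m (\<lambda>z. f z - g z) = chi m f - chi m g"
  using chi_add[OF _ holo_scale[of g d "-1"], of f m] chi_scale[of g m "-1"] by simp

lemma chi_sum: "(\<And>i. i \<in> I \<Longrightarrow> f i \<in> holo d) \<Longrightarrow> m < n \<Longrightarrow> chi m (\<lambda>z. \<Sum>i\<in>I. f i z) = (\<Sum>i\<in>I. chi m (f i))"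
  by (induction I rule: infinite_finite_induct) (auto simp: chi_const chi_add holo_sum)

lemma chi_local:
  assumes f: "f \<in> holo d" and eq: "\<And>z. z \<in> unit_ball d \<Longrightarrow> f z = g z" and m: "m < n"
  shows "chi m f = chi m g"
  by (rule rep_local[OF f holo_cong[OF eq f] eq m m])

lemma chi_ann: "f \<in> ann n \<Longrightarrow> m < n \<Longrightarrow> chi m f = 0"
  by (simp add: ann_def)

text \<open>
  The point of the joint spectrum that belongs to the \<open>m\<close>-th diagonal entry.
\<close>

definition spectral_point :: "nat \<Rightarrow> nat \<Rightarrow> complex" where
  "spectral_point m = (\<lambda>i. if i < d then chi m (\<lambda>z. z i) else 0)"

lemma spectral_point_coord:
  assumes "m < n" shows "chi m (\<lambda>z. z i) = spectral_point m i"
proof (cases "i < d")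
  case False
  have "chi m (\<lambda>z. z i) = chi m (\<lambda>_. 0)"
    by (rule chi_local[OF holo_coord _ assms]) (use False in \<open>auto simp: unit_ball_def cspace_def\<close>)
  thus ?thesis using False assms by (simp add: spectral_point_def chi_const)
qed (simp add: spectral_point_def)

lemma chi_cinner:
  assumes "m < n" shows "chi m (\<lambda>z. cinner d z w) = cinner d (spectral_point m) w"
proof -
  have "chi m (\<lambda>z. \<Sum>i<d. z i * cnj (w i)) = (\<Sum>i<d. chi m (\<lambda>z. z i * cnj (w i)))"
    by (rule chi_sum) (use assms in \<open>auto intro: holo_mult holo_coord holo_const\<close>)
  also have "\<dots> = (\<Sum>i<d. spectral_point m i * cnj (w i))"
    by (intro sum.cong refl) (simp add: chi_mult holo_coord holo_const assms chi_const spectral_point_coord)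
  finally show ?thesis by (simp add: cinner_def)
qed

text \<open>
  For a point \<open>p\<close> with \<open>\<bar>p\<bar> \<ge> 1\<close> the function \<open>1 - \<langle>z, p\<rangle> / \<bar>p\<bar>\<^sup>2\<close> is invertible on the ball, but
  the character gives it the value 0.
\<close>

lemma spectral_point_in_ball:
  assumes m: "m < n" shows "spectral_point m \<in> unit_ball d"
proof (rule ccontr)
  assume "spectral_point m \<notin> unit_ball d"
  moreover have "spectral_point m \<in> cspace d" by (simp add: spectral_point_def cspace_def)
  ultimately have N: "1 \<le> cnorm d (spectral_point m)" by (simp add: unit_ball_def)
  \<comment> \<open>with this factor the character of \<open>f\<close> is \<open>1 - t * \<bar>spectral_point m\<bar>\<^sup>2 = 0\<close>\<close>
  define t where "t = 1 / (cnorm d (spectral_point m))\<^sup>2"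
  define f where "f = (\<lambda>z. 1 - of_real t * cinner d z (spectral_point m))"
  have f: "f \<in> holo d" unfolding f_def by (intro holo_diff holo_const holo_scale holo_cinner holo_coord)
  have nz: "f z \<noteq> 0" if z: "z \<in> unit_ball d" for z
  proof -
    have "cmod (of_real t * cinner d z (spectral_point m)) \<le> t * (cnorm d z * cnorm d (spectral_point m))"
    proof -
      have t0: "0 \<le> t" by (simp add: t_def)
      hence "cmod (of_real t) = t" by simp
      thus ?thesis unfolding norm_mult
        using mult_left_mono[OF cauchy_schwarz_cinner[of d z "spectral_point m"] t0] by simp
    qed
    also have "\<dots> = cnorm d z / cnorm d (spectral_point m)" using N by (simp add: t_def power2_eq_square)
    also have "\<dots> \<le> cnorm d z" using N cnorm_nonneg[of d z] by (simp add: divide_le_eq mult_le_cancel_left1)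
    also have "\<dots> < 1" using z by (simp add: unit_ball_def)
    finally show ?thesis by (auto simp: f_def)
  qed
  have "1 = chi m (\<lambda>z. f z * inverse (f z))"
    using chi_local[OF holo_const[of 1], of "\<lambda>z. f z * inverse (f z)" m] nz m by (simp add: chi_const)
  also have "\<dots> = chi m f * chi m (\<lambda>z. inverse (f z))"
    by (rule chi_mult[OF f holo_inverse[OF f nz] m])
  also have "chi m f = 1 - of_real t * cinner d (spectral_point m) (spectral_point m)"
    unfolding f_def
    by (simp add: chi_diff chi_const chi_scale holo_const holo_scale holo_cinner holo_coord m chi_cinner)
  also have "\<dots> = 0" using N by (simp add: t_def cinner_self)
  finally show False by simp
qed

lemma ball_point_spectral_point: "m < n \<Longrightarrow> ball_point d (spectral_point m)"
  by (rule ball_point.intro[OF spectral_point_in_ball])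

text \<open>
  The automorphism that belongs to the spectral point is a quotient of affine functions, so its value under the character
  can be computed before \<open>chi_eval\<close> is available.
\<close>

lemma chi_ball_aut:
  assumes m: "m < n" shows "chi m (\<lambda>z. ball_aut d (spectral_point m) z j) = 0"
proof -
  interpret ball_point d "spectral_point m" by (rule ball_point_spectral_point[OF m])
  define D where "D = (\<lambda>z. 1 - cinner d z (spectral_point m))"
  have D: "D \<in> holo d" unfolding D_def by (intro holo_diff holo_const holo_cinner holo_coord)
  define N where "N = (\<lambda>z. (1 - (1 / (1 + s)) * cinner d z (spectral_point m)) * spectral_point m j + (- s) * z j)"
  have hc: "(\<lambda>z. 1 - (1 / (1 + s)) * cinner d z (spectral_point m)) \<in> holo d"
    by (intro holo_diff holo_const holo_scale holo_cinner holo_coord)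
  have "chi m (\<lambda>z. ball_aut d (spectral_point m) z j * D z) = chi m N"
    by (rule chi_local[OF holo_mult[OF holo_ball_aut D] _ m]) (use den_nonzero in \<open>simp add: ball_aut_alt D_def N_def\<close>)
  also have "chi m N = (1 - (1 / (1 + s)) * cinner d (spectral_point m) (spectral_point m)) * spectral_point m j + (- s) * spectral_point m j"
  proof -
    have hcin: "(\<lambda>z. cinner d z (spectral_point m)) \<in> holo d" by (intro holo_cinner holo_coord)
    show ?thesis
      unfolding N_def chi_add[OF holo_mult[OF hc holo_const] holo_scale[OF holo_coord] m]
        chi_mult[OF hc holo_const m] chi_diff[OF holo_const holo_scale[OF hcin] m] chi_const[OF m]
        chi_scale[OF hcin m] chi_cinner[OF m] chi_scale[OF holo_coord m] spectral_point_coord[OF m] ..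
  qed
  also have "\<dots> = ball_aut d (spectral_point m) (spectral_point m) j * (1 - cinner d (spectral_point m) (spectral_point m))"
    using den_nonzero[OF spectral_point_in_ball[OF m]] by (simp add: ball_aut_alt)
  also have "\<dots> = 0" by (simp add: ball_aut_self)
  finally have "chi m (\<lambda>z. ball_aut d (spectral_point m) z j) * chi m D = 0" using chi_mult[OF holo_ball_aut D m] by simp
  moreover have "chi m D = 1 - cinner d (spectral_point m) (spectral_point m)"
    unfolding D_def by (simp add: chi_diff chi_const chi_cinner holo_const holo_cinner holo_coord m)
  ultimately show ?thesis using den_nonzero[OF spectral_point_in_ball[OF m]] by simp
qed

section \<open>Division at a spectral point\<close>

text \<open>
  The division at 0 in \<open>k\<close> variables, pulled to the ball of \<open>d\<close> variables by \<open>\<sigma>\<close> and \<open>\<eta>\<close>.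
\<close>

lemma gleason_transport:
  assumes k: "1 \<le> k" and f: "f \<in> holo d" "\<And>z. z \<in> unit_ball d \<Longrightarrow> cmod (f z) \<le> b"
    and \<sigma>: "\<And>w. w \<in> unit_ball k \<Longrightarrow> \<sigma> w \<in> unit_ball d" "\<And>i. (\<lambda>w. \<sigma> w i) \<in> holo k"
    and \<eta>: "\<And>z. z \<in> unit_ball d \<Longrightarrow> \<eta> z \<in> unit_ball k" "\<And>i. (\<lambda>z. \<eta> z i) \<in> holo d"
    and f0: "f (\<sigma> (\<lambda>_. 0)) = 0"
  shows "\<exists>F. (\<forall>i<k. F i \<in> holo d \<and> (\<forall>z\<in>unit_ball d. cmod (F i z) \<le> C k * b)) \<and>
    (\<forall>z\<in>unit_ball d. f (\<sigma> (\<eta> z)) = (\<Sum>i<k. \<eta> z i * F i z))"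
proof -
  define h where "h = (\<lambda>w. f (\<sigma> w))"
  have h: "h \<in> holo k" unfolding h_def by (rule holo_compose[OF f(1) \<sigma>])
  have hb: "cmod (h w) \<le> b" if "w \<in> unit_ball k" for w using f(2)[OF \<sigma>(1)[OF that]] by (simp add: h_def)
  have hI: "h \<in> Hinf k" "supnorm k h \<le> b" using HinfI[OF h, of b] hb by auto
  have C0: "0 < C k" using gleason[OF k] by (simp add: gleason_constant_def)
  have h0: "h (\<lambda>_. 0) = 0" using f0 by (simp add: h_def)
  have all: "\<forall>f\<in>Hinf k. f (\<lambda>_. 0) = 0 \<longrightarrow> (\<exists>F. (\<forall>i<k. F i \<in> Hinf k \<and>
      supnorm k (F i) \<le> C k * supnorm k f) \<and> (\<forall>z\<in>unit_ball k. f z = (\<Sum>i<k. z i * F i z)))"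
    using gleason[OF k] unfolding gleason_constant_def by (rule conjunct2)
  have "\<exists>F. (\<forall>i<k. F i \<in> Hinf k \<and> supnorm k (F i) \<le> C k * supnorm k h) \<and>
      (\<forall>z\<in>unit_ball k. h z = (\<Sum>i<k. z i * F i z))" by (rule mp[OF bspec[OF all hI(1)] h0])
  then
  obtain G where G: "\<forall>i<k. G i \<in> Hinf k \<and> supnorm k (G i) \<le> C k * supnorm k h"
      "\<forall>z\<in>unit_ball k. h z = (\<Sum>i<k. z i * G i z)"
    by blast
  show ?thesis
  proof (rule exI[of _ "\<lambda>i z. G i (\<eta> z)"], intro conjI allI impI ballI)
    fix i assume i: "i < k"
    show "(\<lambda>z. G i (\<eta> z)) \<in> holo d"
      by (rule holo_compose[OF _ \<eta>]) (use G i in \<open>auto intro: Hinf_holo\<close>)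
    fix z assume z: "z \<in> unit_ball d"
    have "cmod (G i (\<eta> z)) \<le> supnorm k (G i)"
      using G(1) i by (intro Hinf_norm_le_supnorm \<eta>(1)[OF z]) auto
    also have "\<dots> \<le> C k * supnorm k h" using G(1) i by auto
    also have "\<dots> \<le> C k * b" using C0 hI(2) by simp
    finally show "cmod (G i (\<eta> z)) \<le> C k * b" .
  next
    fix z assume "z \<in> unit_ball d"
    thus "f (\<sigma> (\<eta> z)) = (\<Sum>i<k. \<eta> z i * G i (\<eta> z))" using G(2) \<eta>(1) by (simp add: h_def)
  qed
qed

lemma gleason_at_point:
  assumes l: "l \<in> unit_ball d" and f: "f \<in> holo d" "\<And>z. z \<in> unit_ball d \<Longrightarrow> cmod (f z) \<le> b"
    and f0: "f l = 0"
  shows "\<exists>F. (\<forall>i<d. F i \<in> holo d \<and> (\<forall>z\<in>unit_ball d. cmod (F i z) \<le> C d * b)) \<and>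
    (\<forall>z\<in>unit_ball d. f z = (\<Sum>i<d. ball_aut d l z i * F i z))"
proof -
  interpret ball_point d l by (rule ball_point.intro[OF l])
  have "f (ball_aut d l (\<lambda>_. 0)) = 0" by (simp add: ball_aut_zero f0)
  from gleason_transport[where \<sigma> = "ball_aut d l" and \<eta> = "ball_aut d l",
      OF d_pos f ball_aut_in_ball holo_ball_aut ball_aut_in_ball holo_ball_aut this]
  show ?thesis by (simp add: ball_aut_involution)
qed

text \<open>
  Division at the spectral point writes \<open>f\<close> minus its value there as a combination of functions with character value 0.
\<close>

lemma chi_eval:
  assumes m: "m < n" and f: "f \<in> holo d" "\<And>z. z \<in> unit_ball d \<Longrightarrow> cmod (f z) \<le> b"
  shows "chi m f = f (spectral_point m)"
proof -
  interpret ball_point d "spectral_point m" by (rule ball_point_spectral_point[OF m])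
  define g where "g = (\<lambda>z. f z - f (spectral_point m))"
  have g: "g \<in> holo d" unfolding g_def by (intro holo_diff f holo_const)
  have gb: "cmod (g z) \<le> 2 * b" if "z \<in> unit_ball d" for z
    using norm_triangle_ineq4[of "f z" "f (spectral_point m)"] f(2)[OF that] f(2)[OF spectral_point_in_ball[OF m]] by (simp add: g_def)
  have "g (spectral_point m) = 0" by (simp add: g_def)
  from gleason_at_point[OF spectral_point_in_ball[OF m] g gb this] obtain F where
    F': "\<forall>i<d. F i \<in> holo d \<and> (\<forall>z\<in>unit_ball d. cmod (F i z) \<le> C d * (2 * b))"
      "\<forall>z\<in>unit_ball d. g z = (\<Sum>i<d. ball_aut d (spectral_point m) z i * F i z)" by blast
  have F: "\<And>i. i < d \<Longrightarrow> F i \<in> holo d"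
    "\<And>z. z \<in> unit_ball d \<Longrightarrow> g z = (\<Sum>i<d. ball_aut d (spectral_point m) z i * F i z)" using F' by auto
  have "chi m g = chi m (\<lambda>z. \<Sum>i<d. ball_aut d (spectral_point m) z i * F i z)"
    by (rule chi_local[OF g F(2) m])
  also have "\<dots> = (\<Sum>i<d. chi m (\<lambda>z. ball_aut d (spectral_point m) z i) * chi m (F i))"
    by (subst chi_sum) (auto intro!: holo_mult holo_ball_aut F(1) m sum.cong chi_mult)
  also have "\<dots> = 0" by (simp add: chi_ball_aut[OF m])
  finally show ?thesis
    unfolding g_def using chi_diff[OF f(1) holo_const m] chi_const[OF m] by simp
qed

text \<open>
  If the calculus cannot tell \<open>u\<close> from \<open>v\<close>, then it cannot tell their images under an automorphism apart
  either. For a quotient of affine functions this is algebra; from there \<open>retraction_kernel\<close> gets to bounded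
  functions by division.
\<close>

lemma ball_aut_difference_in_kernel:
  assumes l: "l \<in> unit_ball d"
    and u: "\<And>z. z \<in> unit_ball d \<Longrightarrow> u z \<in> unit_ball d" "\<And>i. (\<lambda>z. u z i) \<in> holo d"
    and v: "\<And>z. z \<in> unit_ball d \<Longrightarrow> v z \<in> unit_ball d" "\<And>i. (\<lambda>z. v z i) \<in> holo d"
    and uv: "\<And>i. (\<lambda>z. u z i - v z i) \<in> ann n"
  shows "(\<lambda>z. ball_aut d l (u z) j - ball_aut d l (v z) j) \<in> ann n"
proof -
  interpret ball_point d l by (rule ball_point.intro[OF l])
  define Du where "Du = (\<lambda>z. 1 - cinner d (u z) l)"
  define Dv where "Dv = (\<lambda>z. 1 - cinner d (v z) l)"
  define Nv where "Nv = (\<lambda>z. (1 - cinner d (v z) l / (1 + s)) * l j + (- s) * v z j)"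
  have Nv_alt: "Nv = (\<lambda>z. (1 - (1 / (1 + s)) * cinner d (v z) l) * l j + (- s) * v z j)"
    by (simp add: Nv_def)
  have hol: "Du \<in> holo d" "Dv \<in> holo d" "Nv \<in> holo d"
    unfolding Du_def Dv_def Nv_alt by (intro holo_add holo_mult holo_diff holo_const holo_cinner u v)+
  have nz: "Du z \<noteq> 0" "Dv z \<noteq> 0" if "z \<in> unit_ball d" for z
    using den_nonzero u(1)[OF that] v(1)[OF that] by (auto simp: Du_def Dv_def)
  define e where "e = (\<lambda>z. \<Sum>i<d. (u z i - v z i) * cnj (l i))"
  have eJ: "e \<in> ann n" unfolding e_def by (intro ann_sum ann_mult_right uv holo_const) auto
  have e: "cinner d (u z) l = cinner d (v z) l + e z" for z
    by (simp add: e_def cinner_def left_diff_distrib sum_subtractf)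
  define p where "p = (\<lambda>z. (- l j / (1 + s)) * e z + (- s) * (u z j - v z j))"
  have pJ: "p \<in> ann n" unfolding p_def by (intro ann_add ann_scale eJ uv) auto
  have "(\<lambda>z. (p z * Dv z + Nv z * e z) * inverse (Du z * Dv z)) \<in> ann n"
    by (intro ann_mult_right ann_add ann_mult_left pJ eJ hol holo_inverse holo_mult) (use nz in auto)
  thus ?thesis
  proof (rule ann_cong[OF _ order.refl])
    fix z assume z: "z \<in> unit_ball d"
    have "ball_aut d l (u z) j = (Nv z + p z) / Du z"
      unfolding ball_aut_alt e Nv_def p_def Du_def by (simp add: field_simps add_divide_distrib)
    moreover have "ball_aut d l (v z) j = Nv z / Dv z" by (simp add: ball_aut_alt Nv_def Dv_def)
    moreover have "(N + q) / A - N / B = (q * B + N * t) * inverse (A * B)"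
      if "A \<noteq> 0" "B \<noteq> 0" "B - A = t" for N q A B t :: complex
      unfolding that(3)[symmetric] using that(1,2) by (simp add: field_simps)
    moreover have "Dv z - Du z = e z" by (simp add: Du_def Dv_def e)
    ultimately show "(p z * Dv z + Nv z * e z) * inverse (Du z * Dv z) = ball_aut d l (u z) j - ball_aut d l (v z) j"
      using nz[OF z] by metis
  qed
qed

text \<open>
  If the calculus cannot tell the retraction \<open>\<theta>\<close> from the identity, then it annihilates
  every bounded function \<open>E\<close> that vanishes on the range of \<open>\<theta>\<close>. The spectral points are fixed by \<open>\<theta>\<close>. So \<open>E\<close>
  can be divided at the \<open>m\<close>-th of them, and modulo the kernel each quotient \<open>F i\<close> may be
  replaced by \<open>F i - F i \<circ> \<theta>\<close>, which vanishes on the range of \<open>\<theta>\<close> again. The induction hypothesis for these differences gives one order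
  more for \<open>E\<close>.
\<close>

lemma retraction_kernel:
  assumes \<theta>: "\<And>z. z \<in> unit_ball d \<Longrightarrow> \<theta> z \<in> unit_ball d" "\<And>i. (\<lambda>z. \<theta> z i) \<in> holo d"
      "\<And>z. z \<in> unit_ball d \<Longrightarrow> \<theta> (\<theta> z) = \<theta> z" "\<And>i. (\<lambda>z. z i - \<theta> z i) \<in> ann n"
    and m: "m \<le> n"
    and E: "E \<in> holo d" "\<And>z. z \<in> unit_ball d \<Longrightarrow> cmod (E z) \<le> b"
      "\<And>z. z \<in> unit_ball d \<Longrightarrow> E (\<theta> z) = 0"
  shows "E \<in> ann m"
  using m E
proof (induction m arbitrary: E b)
  case 0 thus ?case by (simp add: ann_def)
next
  case (Suc m)
  have m: "m < n" "m \<le> n" "Suc m \<le> n" using Suc.prems(1) by auto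
  define \<mu> where "\<mu> = spectral_point m"
  have \<mu>: "\<mu> \<in> unit_ball d" using spectral_point_in_ball[OF m(1)] by (simp add: \<mu>_def)
  interpret ball_point d \<mu> by (rule ball_point.intro[OF \<mu>])
  have "\<theta> \<mu> i = \<mu> i" for i
  proof -
    have b: "cmod (\<theta> z i) \<le> 1" if "z \<in> unit_ball d" for z
    proof (cases "i < d")
      case True
      thus ?thesis using cmod_le_cnorm[OF True, of "\<theta> z"] \<theta>(1)[OF that] by (simp add: unit_ball_def)
    next
      case False
      thus ?thesis using \<theta>(1)[OF that] by (simp add: unit_ball_def cspace_def)
    qed
    have "0 = chi m (\<lambda>z. z i - \<theta> z i)" using chi_ann[OF \<theta>(4) m(1)] by simp
    also have "\<dots> = spectral_point m i - \<theta> (spectral_point m) i"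
      by (simp add: chi_diff holo_coord \<theta>(2) m spectral_point_coord chi_eval[OF m(1) \<theta>(2) b])
    finally show ?thesis by (simp add: \<mu>_def)
  qed
  hence "\<theta> \<mu> = \<mu>" by blast
  hence "E \<mu> = 0" using Suc.prems(4)[OF \<mu>] by simp
  from gleason_at_point[OF \<mu> Suc.prems(2,3) this] obtain F where
    F': "\<forall>i<d. F i \<in> holo d \<and> (\<forall>z\<in>unit_ball d. cmod (F i z) \<le> C d * b)"
      "\<forall>z\<in>unit_ball d. E z = (\<Sum>i<d. ball_aut d \<mu> z i * F i z)" by blast
  have F: "\<And>i. i < d \<Longrightarrow> F i \<in> holo d"
    "\<And>i z. i < d \<Longrightarrow> z \<in> unit_ball d \<Longrightarrow> cmod (F i z) \<le> C d * b"
    "\<And>z. z \<in> unit_ball d \<Longrightarrow> E z = (\<Sum>i<d. ball_aut d \<mu> z i * F i z)" using F' by auto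
  have F\<theta>: "(\<lambda>z. F i (\<theta> z)) \<in> holo d" if "i < d" for i by (rule holo_compose[OF F(1)[OF that] \<theta>(1,2)])
  have D: "(\<lambda>z. F i z - F i (\<theta> z)) \<in> ann m" if i: "i < d" for i
  proof (rule Suc.IH[OF m(2) holo_diff[OF F(1)[OF i] F\<theta>[OF i]]])
    fix z assume z: "z \<in> unit_ball d"
    show "cmod (F i z - F i (\<theta> z)) \<le> 2 * (C d * b)"
      using norm_triangle_ineq4[of "F i z" "F i (\<theta> z)"] F(2)[OF i z] F(2)[OF i \<theta>(1)[OF z]] by simp
    show "F i (\<theta> z) - F i (\<theta> (\<theta> z)) = 0" using \<theta>(3)[OF z] by simp
  qed
  have mJ: "(\<lambda>z. ball_aut d \<mu> z i - ball_aut d \<mu> (\<theta> z) i) \<in> ann (Suc m)" for i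
    using ball_aut_difference_in_kernel[OF \<mu> _ holo_coord \<theta>(1,2,4)] ann_mono[OF m(3)] by blast
  have "(\<lambda>z. (\<Sum>i<d. (F i z - F i (\<theta> z)) * ball_aut d \<mu> z i)
      + (\<Sum>i<d. (ball_aut d \<mu> z i - ball_aut d \<mu> (\<theta> z) i) * F i (\<theta> z))) \<in> ann (Suc m)"
    using chi_ball_aut[OF m(1)]
    by (intro ann_add ann_sum ann_step ann_mult_right D mJ F\<theta> holo_ball_aut m) (auto simp: \<mu>_def)
  thus "E \<in> ann (Suc m)"
  proof (rule ann_cong[OF _ m(3)])
    fix z assume z: "z \<in> unit_ball d"
    have "E z = E z - E (\<theta> z)" using Suc.prems(4)[OF z] by simp
    also have "\<dots> = (\<Sum>i<d. ball_aut d \<mu> z i * F i z) - (\<Sum>i<d. ball_aut d \<mu> (\<theta> z) i * F i (\<theta> z))"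
      using F(3)[OF z] F(3)[OF \<theta>(1)[OF z]] by simp
    also have "\<dots> = (\<Sum>i<d. (F i z - F i (\<theta> z)) * ball_aut d \<mu> z i)
      + (\<Sum>i<d. (ball_aut d \<mu> z i - ball_aut d \<mu> (\<theta> z) i) * F i (\<theta> z))"
      unfolding sum.distrib[symmetric] sum_subtractf[symmetric]
      by (intro sum.cong refl) (simp add: algebra_simps)
    finally show "(\<Sum>i<d. (F i z - F i (\<theta> z)) * ball_aut d \<mu> z i)
      + (\<Sum>i<d. (ball_aut d \<mu> z i - ball_aut d \<mu> (\<theta> z) i) * F i (\<theta> z)) = E z" by simp
  qed
qed

end

section \<open>Division in few variables\<close>

text \<open>
  The coordinate function \<open>z 0\<close> forces the quotient \<open>F 0\<close> to be 1 at points of the first axis.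
\<close>

lemma gleason_constant_ge_1:
  assumes k: "1 \<le> k" and c: "gleason_constant k c"
  shows "1 \<le> c"
proof -
  define f :: "(nat \<Rightarrow> complex) \<Rightarrow> complex" where "f = (\<lambda>z. z 0)"
  have f1: "cmod (f z) \<le> 1" if "z \<in> unit_ball k" for z
    using cmod_le_cnorm[of 0 k z] that k by (simp add: f_def unit_ball_def)
  note fI = HinfI[OF holo_coord[of 0 k, folded f_def] f1]
  obtain F where F: "\<forall>i<k. F i \<in> Hinf k \<and> supnorm k (F i) \<le> c * supnorm k f"
      "\<forall>z\<in>unit_ball k. f z = (\<Sum>i<k. z i * F i z)"
    using c fI(1) unfolding gleason_constant_def by (auto simp: f_def)
  define w :: "nat \<Rightarrow> complex" where "w = (\<lambda>i. if i = 0 then 1/2 else 0)"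
  have "(\<Sum>i<k. (cmod (w i))\<^sup>2) = (\<Sum>i\<in>{0}. (cmod (w i))\<^sup>2)"
    using k by (intro sum.mono_neutral_right) (auto simp: w_def)
  hence w: "w \<in> unit_ball k" using k by (simp add: unit_ball_iff cspace_def w_def power2_eq_square norm_divide)
  have "(\<Sum>i<k. w i * F i w) = (\<Sum>i\<in>{0}. w i * F i w)"
    using k by (intro sum.mono_neutral_right) (auto simp: w_def)
  hence "F 0 w = 1" using F(2) w by (simp add: f_def w_def)
  hence "1 \<le> supnorm k (F 0)" using Hinf_norm_le_supnorm[of "F 0" k w] F(1) w k by simp
  also have "\<dots> \<le> c * supnorm k f" using F(1) k by simp
  also have "\<dots> \<le> c * 1" using c fI(2) by (intro mult_left_mono) (auto simp: gleason_constant_def)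
  finally show ?thesis by simp
qed

text \<open>
  The bound \<open>2 / Q\<close> for the Moebius transform in the induction step, with \<open>t = 1 / Q\<^sup>2\<close>.
\<close>

lemma shifted_distance_le:
  fixes u v :: complex
  assumes "cmod u \<le> 1" "cmod v \<le> 1" "0 \<le> t" "t \<le> 1 / 4"
  shows "cmod (u - v) \<le> 2 * cmod (1 - of_real t * (cnj v * u))"
proof -
  define x where "x = Re (cnj v * u)"
  have x: "\<bar>x\<bar> \<le> 1"
  proof -
    have "\<bar>x\<bar> \<le> cmod v * cmod u" unfolding x_def using abs_Re_le_cmod[of "cnj v * u"] by (simp add: norm_mult)
    also have "\<dots> \<le> 1 * 1" using assms by (intro mult_mono) auto
    finally show ?thesis by simp
  qed
  have "(cmod (u - v))\<^sup>2 = (cmod u)\<^sup>2 + (cmod v)\<^sup>2 - 2 * x"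
    unfolding cmod_power2 x_def by (simp add: power2_eq_square algebra_simps)
  also have "\<dots> \<le> 1 + 1 - 2 * x"
    using assms by (intro diff_right_mono add_mono) (auto simp: power_le_one)
  also have "\<dots> \<le> (2 * (1 - t * x))\<^sup>2"
  proof (cases "x \<le> 0")
    case True
    hence "1 \<le> 1 - t * x" using assms(3) by (simp add: mult_nonneg_nonpos)
    hence "1\<^sup>2 \<le> (1 - t * x)\<^sup>2" by (intro power_mono) auto
    thus ?thesis using x True unfolding power_mult_distrib by (auto simp: abs_le_iff)
  next
    case False
    hence "t * x \<le> 1 / 4 * x" using assms(4) by (intro mult_right_mono) auto
    hence "(1 - x / 4)\<^sup>2 \<le> (1 - t * x)\<^sup>2" using x by (intro power_mono) auto
    moreover have "1 + 1 - 2 * x \<le> 4 * (1 - x / 4)\<^sup>2" by (simp add: power2_eq_square algebra_simps)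
    ultimately show ?thesis unfolding power_mult_distrib by simp
  qed
  finally have "(cmod (u - v))\<^sup>2 \<le> (2 * (1 - t * x))\<^sup>2" .
  moreover have "0 \<le> 1 - t * x"
  proof -
    have "t * x \<le> 1 / 4 * 1" using assms x by (intro order.trans[OF mult_left_mono[of x 1 t]]) auto
    thus ?thesis by simp
  qed
  ultimately have "cmod (u - v) \<le> 2 * (1 - t * x)" by (intro power2_le_imp_le[of "cmod (u - v)"]) auto
  also have "1 - t * x = Re (1 - of_real t * (cnj v * u))" by (simp add: x_def)
  also have "2 * Re (1 - of_real t * (cnj v * u)) \<le> 2 * cmod (1 - of_real t * (cnj v * u))"
    by (intro mult_left_mono complex_Re_le_cmod) simp
  finally show ?thesis by simp
qed

context triangular_calculus
begin

text \<open>
  Modulo the kernel of the calculus, the automorphism of the \<open>m\<close>-th spectral point takes its values in the span of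
  \<open>e 0, \<dots>, e (r - 1)\<close>.
\<close>

definition good_frame :: "nat \<Rightarrow> nat \<Rightarrow> nat \<Rightarrow> (nat \<Rightarrow> nat \<Rightarrow> complex) \<Rightarrow> bool" where
  "good_frame m k r e \<longleftrightarrow> orthonormal d r e \<and> r \<le> k \<and>
     (\<forall>x\<in>cspace d. (\<forall>i<r. cinner d x (e i) = 0) \<longrightarrow> (\<lambda>z. cinner d (ball_aut d (spectral_point m) z) x) \<in> ann n)"

text \<open>
  Projecting to the frame inside of the automorphism gives the retraction \<open>\<theta>\<close>, so the calculus maps \<open>f\<close> and \<open>f \<circ> \<theta>\<close> to the
  same matrix, and \<open>f \<circ> \<theta>\<close> factors through a ball of dimension \<open>k\<close>, where it can be divided with constant \<open>C k\<close>.
\<close>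

lemma decomposition:
  assumes m: "m < n" and k: "1 \<le> k" and fr: "good_frame m k r e"
    and f: "f \<in> holo d" "\<And>z. z \<in> unit_ball d \<Longrightarrow> cmod (f z) \<le> b" "f (spectral_point m) = 0"
  shows "\<exists>F. (\<forall>i<k. F i \<in> holo d \<and> (\<forall>z\<in>unit_ball d. cmod (F i z) \<le> C k * b)) \<and>
    (\<lambda>z. f z - (\<Sum>i<k. coords d r e (ball_aut d (spectral_point m) z) i * F i z)) \<in> ann n"
proof -
  have on: "orthonormal d r e" and rk: "r \<le> k" using fr by (auto simp: good_frame_def)
  interpret ball_point d "spectral_point m" by (rule ball_point_spectral_point[OF m])
  let ?\<phi> = "ball_aut d (spectral_point m)"
  define \<sigma> where "\<sigma> = (\<lambda>w. ?\<phi> (synth r e w))"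
  define \<eta> where "\<eta> = (\<lambda>z. coords d r e (?\<phi> z))"
  define \<theta> where "\<theta> = (\<lambda>z. \<sigma> (\<eta> z))"
  have \<sigma>: "\<sigma> w \<in> unit_ball d" if "w \<in> unit_ball k" for w
    unfolding \<sigma>_def by (rule ball_aut_in_ball[OF synth_in_ball[OF on rk that]])
  have \<sigma>h: "(\<lambda>w. \<sigma> w i) \<in> holo k" for i
    unfolding \<sigma>_def by (rule holo_ball_aut_compose[OF synth_in_ball[OF on rk] holo_synth[OF holo_coord]])
  have \<eta>: "\<eta> z \<in> unit_ball k" if "z \<in> unit_ball d" for z
    unfolding \<eta>_def by (rule coords_in_ball[OF on rk ball_aut_in_ball[OF that]])
  have \<eta>h: "(\<lambda>z. \<eta> z i) \<in> holo d" for i unfolding \<eta>_def by (rule holo_coords[OF holo_ball_aut])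
  have pb: "proj d r e (?\<phi> z) \<in> unit_ball d" if "z \<in> unit_ball d" for z
    using synth_in_ball[OF on rk \<eta>[OF that]] by (simp add: \<eta>_def)
  have ph: "(\<lambda>z. proj d r e (?\<phi> z) i) \<in> holo d" for i by (rule holo_synth[OF holo_coords[OF holo_ball_aut]])
  have \<theta>b: "\<theta> z \<in> unit_ball d" if "z \<in> unit_ball d" for z unfolding \<theta>_def by (rule \<sigma>[OF \<eta>[OF that]])
  have \<theta>h: "(\<lambda>z. \<theta> z i) \<in> holo d" for i
    unfolding \<theta>_def \<sigma>_def \<eta>_def by (rule holo_ball_aut_compose[OF pb ph])
  have \<theta>\<theta>: "\<theta> (\<theta> z) = \<theta> z" if z: "z \<in> unit_ball d" for z
    unfolding \<theta>_def \<sigma>_def \<eta>_def ball_aut_involution[OF pb[OF z]] proj_proj[OF on] ..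
  have diff: "(\<lambda>z. ?\<phi> z i - proj d r e (?\<phi> z) i) \<in> ann n" for i
  proof (cases "i < d")
    case True
    define \<delta> :: "nat \<Rightarrow> complex" where "\<delta> = (\<lambda>j. if j = i then 1 else 0)"
    define x where "x = (\<lambda>j. \<delta> j - proj d r e \<delta> j)"
    have \<delta>: "cinner d u \<delta> = u i" for u
      using True by (simp add: cinner_def \<delta>_def if_distrib[of "\<lambda>c. _ * c"] if_distrib[of cnj] cong: if_cong)
    have "x \<in> cspace d"
      using True on by (simp add: x_def \<delta>_def cspace_def orthonormal_def synth_def)
    moreover have "cinner d x (e j) = 0" if "j < r" for j
      unfolding x_def by (rule proj_residual_orthogonal[OF on that])
    ultimately have "(\<lambda>z. cinner d (?\<phi> z) x) \<in> ann n" using fr by (simp add: good_frame_def)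
    moreover have "cinner d u x = u i - proj d r e u i" for u
      unfolding x_def cinner_diff_right cinner_proj_right cinner_proj_left[symmetric] \<delta> ..
    ultimately show ?thesis by simp
  next
    case False
    show ?thesis
      by (rule ann_cong[OF ann_zero]) (use False ball_aut_in_ball pb in \<open>auto simp: unit_ball_def cspace_def\<close>)
  qed
  have z\<theta>: "(\<lambda>z. z i - \<theta> z i) \<in> ann n" for i
  proof (rule ann_cong[OF ball_aut_difference_in_kernel[OF spectral_point_in_ball[OF m] ball_aut_in_ball holo_ball_aut pb ph diff] order.refl])
    show "?\<phi> (?\<phi> z) i - ?\<phi> (proj d r e (?\<phi> z)) i = z i - \<theta> z i" if "z \<in> unit_ball d" for z
      using ball_aut_involution[OF that] by (simp add: \<theta>_def \<sigma>_def \<eta>_def)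
  qed
  have f\<theta>: "(\<lambda>z. f (\<theta> z)) \<in> holo d" by (rule holo_compose[OF f(1) \<theta>b \<theta>h])
  have E: "(\<lambda>z. f z - f (\<theta> z)) \<in> ann n"
  proof (rule retraction_kernel[OF \<theta>b \<theta>h \<theta>\<theta> z\<theta> order.refl holo_diff[OF f(1) f\<theta>]])
    fix z assume z: "z \<in> unit_ball d"
    show "cmod (f z - f (\<theta> z)) \<le> 2 * b"
      using norm_triangle_ineq4[of "f z" "f (\<theta> z)"] f(2)[OF z] f(2)[OF \<theta>b[OF z]] by simp
    show "f (\<theta> z) - f (\<theta> (\<theta> z)) = 0" using \<theta>\<theta>[OF z] by simp
  qed
  have "f (\<sigma> (\<lambda>_. 0)) = 0" using f(3) by (simp add: \<sigma>_def synth_def ball_aut_zero)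
  from gleason_transport[OF k f(1,2) \<sigma> \<sigma>h \<eta> \<eta>h this] obtain F where
    F: "\<forall>i<k. F i \<in> holo d \<and> (\<forall>z\<in>unit_ball d. cmod (F i z) \<le> C k * b)"
       "\<forall>z\<in>unit_ball d. f (\<sigma> (\<eta> z)) = (\<Sum>i<k. \<eta> z i * F i z)" by blast
  have "(\<lambda>z. f z - (\<Sum>i<k. \<eta> z i * F i z)) \<in> ann n"
    by (rule ann_cong[OF E order.refl]) (use F(2) in \<open>simp add: \<theta>_def\<close>)
  with F(1) show ?thesis unfolding \<eta>_def by blast
qed

lemma standard_frame: "\<exists>r e. good_frame m d r e"
proof -
  define e :: "nat \<Rightarrow> nat \<Rightarrow> complex" where "e = (\<lambda>i j. if j = i then 1 else 0)"
  have e: "cinner d u (e i) = u i" if "i < d" for u i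
    using that by (simp add: cinner_def e_def if_distrib[of "\<lambda>c. _ * c"] if_distrib[of cnj] cong: if_cong)
  have "orthonormal d d e" unfolding orthonormal_def using e by (auto simp: cspace_def e_def)
  moreover have "(\<lambda>z. cinner d (ball_aut d (spectral_point m) z) x) \<in> ann n" if "x \<in> cspace d" "\<forall>i<d. cinner d x (e i) = 0" for x
  proof -
    have "x i = 0" if "i < d" for i using \<open>\<forall>i<d. _\<close> that e by auto
    hence "(\<lambda>z. cinner d (ball_aut d (spectral_point m) z) x) = (\<lambda>_. 0)" by (simp add: cinner_def)
    thus ?thesis by (simp add: ann_zero)
  qed
  ultimately have "good_frame m d d e" by (simp add: good_frame_def)
  thus ?thesis by blast
qed

lemma cinner_combination_in_ann:
  assumes "\<And>x. x \<in> E \<Longrightarrow> (\<lambda>z. cinner d (u z) x) \<in> ann n"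
  shows "(\<lambda>z. cinner d (u z) (\<lambda>j. \<Sum>x\<in>E. a x * x j)) \<in> ann n"
proof -
  have "(\<lambda>z. \<Sum>x\<in>E. cnj (a x) * cinner d (u z) x) \<in> ann n"
    by (intro ann_sum ann_scale assms) auto
  thus ?thesis unfolding cinner_sum_right by (simp add: cinner_scale_right)
qed

text \<open>
  Let \<open>N\<close> be the space of directions in which the automorphism is invisible to the calculus. The vectors \<open>E1\<close> that extend an
  orthonormal basis \<open>E0\<close> of \<open>N\<close> to one of \<open>cspace d\<close> give linearly independent commuting matrices, and Schur's bound applies.
\<close>

lemma schur_frame:
  assumes m: "m < n" shows "\<exists>r e. good_frame m (n\<^sup>2 div 4 + 1) r e"
proof -
  interpret ball_point d "spectral_point m" by (rule ball_point_spectral_point[OF m])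
  let ?\<phi> = "ball_aut d (spectral_point m)"
  define N where "N = {x \<in> cspace d. (\<lambda>z. cinner d (?\<phi> z) x) \<in> ann n}"
  have hol: "(\<lambda>z. cinner d (?\<phi> z) x) \<in> holo d" for x by (rule holo_cinner[OF holo_ball_aut])
  have N_scale: "(\<lambda>j. t * x j) \<in> N" if "x \<in> N" for x t
    using that ann_scale[of "\<lambda>z. cinner d (?\<phi> z) x" n "cnj t"]
    by (simp add: N_def cinner_scale_right cspace_def)
  have N_comb: "(\<lambda>j. \<Sum>x\<in>E. a x * x j) \<in> N" if "E \<subseteq> N" for E a
  proof -
    have "x i = 0" if "x \<in> E" "d \<le> i" for x i using that \<open>E \<subseteq> N\<close> by (auto simp: N_def cspace_def)
    hence "(\<lambda>j. \<Sum>x\<in>E. a x * x j) \<in> cspace d" unfolding cspace_def by (auto intro!: sum.neutral)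
    thus ?thesis using that cinner_combination_in_ann[of E ?\<phi> a] by (auto simp: N_def)
  qed
  have e0: "orthonormal_set d {}" by (simp add: orthonormal_set_def)
  obtain E0 where E0': "orthonormal_set d E0" "{} \<subseteq> E0" "E0 \<subseteq> N"
      "\<forall>x\<in>N. (\<forall>y\<in>E0. cinner d x y = 0) \<longrightarrow> x = (\<lambda>_. 0)"
    by (rule maximal_orthonormal_set[OF e0 empty_subsetI _ N_scale]) (auto simp: N_def)
  have E0: "orthonormal_set d E0" "E0 \<subseteq> N"
      "\<And>x. x \<in> N \<Longrightarrow> (\<And>y. y \<in> E0 \<Longrightarrow> cinner d x y = 0) \<Longrightarrow> x = (\<lambda>_. 0)" using E0' by auto
  have E0c: "E0 \<subseteq> cspace d" using E0(1) by (simp add: orthonormal_set_def)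
  have scale: "(\<lambda>j. t * x j) \<in> cspace d" if "x \<in> cspace d" for t x using that by (simp add: cspace_def)
  obtain E where E': "orthonormal_set d E" "E0 \<subseteq> E" "E \<subseteq> cspace d"
      "\<forall>x\<in>cspace d. (\<forall>y\<in>E. cinner d x y = 0) \<longrightarrow> x = (\<lambda>_. 0)"
    by (rule maximal_orthonormal_set[OF E0(1) E0c order.refl scale])
  have E: "orthonormal_set d E" "E0 \<subseteq> E"
      "\<And>x. x \<in> cspace d \<Longrightarrow> (\<And>y. y \<in> E \<Longrightarrow> cinner d x y = 0) \<Longrightarrow> x = (\<lambda>_. 0)" using E' by auto
  define E1 where "E1 = E - E0"
  have fin: "finite E" "finite E0" "finite E1" using E(1) E0(1) by (auto simp: orthonormal_set_def E1_def)
  have on1: "orthonormal_set d E1" using E(1) by (auto simp: orthonormal_set_def E1_def)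
  have orth: "cinner d x y = 0" if "x \<in> E1" "y \<in> E0" for x y
    using that E(1,2) by (auto simp: orthonormal_set_def E1_def)
  have ker: "(\<lambda>z. cinner d (?\<phi> z) x) \<in> ann n" if x: "x \<in> cspace d" "\<And>y. y \<in> E1 \<Longrightarrow> cinner d x y = 0" for x
  proof -
    define p where "p = (\<lambda>j. \<Sum>y\<in>E0. cinner d x y * y j)"
    have pN: "p \<in> N" unfolding p_def by (rule N_comb[OF E0(2)])
    have "(\<lambda>j. x j - p j) = (\<lambda>_. 0)"
    proof (rule E(3))
      show "(\<lambda>j. x j - p j) \<in> cspace d" using x(1) pN by (simp add: N_def cspace_def)
      fix y assume y: "y \<in> E"
      show "cinner d (\<lambda>j. x j - p j) y = 0"
      proof (cases "y \<in> E0")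
        case True
        thus ?thesis using cinner_sum_orthonormal_set[OF E0(1) True] by (simp add: cinner_diff_left p_def)
      next
        case False
        hence y1: "y \<in> E1" using y by (simp add: E1_def)
        have "cinner d p y = (\<Sum>w\<in>E0. cinner d x w * cinner d w y)"
          unfolding p_def cinner_sum_left by (simp add: cinner_scale_left)
        also have "\<dots> = 0"
        proof (rule sum.neutral, intro ballI)
          fix w assume "w \<in> E0"
          thus "cinner d x w * cinner d w y = 0" using orth[OF y1] cinner_commute[of d w y] by simp
        qed
        finally show ?thesis using x(2)[OF y1] by (simp add: cinner_diff_left)
      qed
    qed
    hence "x j = p j" for j by (metis right_minus_eq)
    hence "x = p" by blast
    thus ?thesis using pN by (simp add: N_def)
  qed
  have "card E1 \<le> n\<^sup>2 div 4 + 1"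
  proof (rule card_commuting_upper_indep_le[where p = 0])
    define A where "A = (\<lambda>x (r, t). if r \<le> t \<and> t < n then \<rho> (\<lambda>z. cinner d (?\<phi> z) x) r t else 0)"
    show "finite E1" by (rule fin)
    show "upper (A x)" for x by (auto simp: upper_def A_def)
    have A: "A x (r, t) = \<rho> (\<lambda>z. cinner d (?\<phi> z) x) r t" if "r < n" "t < n" for x r t
      using that rep_upper[OF hol, of t r x] by (auto simp: A_def not_le)
    show "comm_block 0 (0 + n) A E1"
      unfolding comm_block_def
    proof (intro ballI)
      fix x y r t assume rt: "r \<in> {0..<0 + n}" "t \<in> {0..<0 + n}"
      have *: "(\<Sum>q\<in>{0..<0 + n}. A x (r, q) * A y (q, t))
          = \<rho> (\<lambda>z. cinner d (?\<phi> z) x * cinner d (?\<phi> z) y) r t" for x y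
        using rt by (simp add: rep_mult hol A atLeast0LessThan)
      show "(\<Sum>q\<in>{0..<0 + n}. A x (r, q) * A y (q, t)) = (\<Sum>q\<in>{0..<0 + n}. A y (r, q) * A x (q, t))"
        unfolding * by (simp add: mult.commute)
    qed
    show "indep_fam E1 (\<lambda>x. block 0 (0 + n) (A x))"
    proof (rule indep_famI)
      fix a x assume z: "\<And>q. (\<Sum>x\<in>E1. a x * block 0 (0 + n) (A x) q) = 0" and x: "x \<in> E1"
      define v where "v = (\<lambda>j. \<Sum>y\<in>E1. cnj (a y) * y j)"
      have vs: "cinner d u v = (\<Sum>y\<in>E1. a y * cinner d u y)" for u
        unfolding v_def cinner_sum_right by (simp add: cinner_scale_right)
      have rep: "\<rho> (\<lambda>z. \<Sum>y\<in>F. a y * cinner d (?\<phi> z) y) r t = (\<Sum>y\<in>F. a y * \<rho> (\<lambda>z. cinner d (?\<phi> z) y) r t)"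
        if "r < n" "t < n" for r t F
      proof (induction F rule: infinite_finite_induct)
        case (insert y F)
        thus ?case using that
          by (simp add: rep_add rep_scale hol holo_scale holo_sum)
      qed (use that ann_zero[of n] in \<open>auto simp: ann_def\<close>)
      have "(\<lambda>z. cinner d (?\<phi> z) v) \<in> ann n"
        unfolding ann_def
      proof (intro CollectI conjI allI impI hol)
        fix r t assume rt: "r < n" "t < n"
        show "\<rho> (\<lambda>z. cinner d (?\<phi> z) v) r t = 0"
          using z[of "(r, t)"] rt unfolding vs rep[OF rt] by (simp add: block_def A)
      qed
      moreover have "v \<in> cspace d"
        using on1 by (auto simp: v_def cspace_def orthonormal_set_def subset_eq intro!: sum.neutral)
      ultimately have vN: "v \<in> N" by (simp add: N_def)
      have "v = (\<lambda>_. 0)"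
      proof (rule E0(3)[OF vN])
        fix y assume y: "y \<in> E0"
        have "cinner d v y = (\<Sum>x\<in>E1. cnj (a x) * cinner d x y)"
          unfolding v_def cinner_sum_left by (simp add: cinner_scale_left)
        also have "\<dots> = 0" using orth[OF _ y] by (intro sum.neutral) auto
        finally show "cinner d v y = 0" .
      qed
      moreover have "cinner d v x = cnj (a x)" unfolding v_def by (rule cinner_sum_orthonormal_set[OF on1 x])
      ultimately show "a x = 0" by (simp add: cinner_def)
    qed
  qed
  moreover obtain e where e: "bij_betw e {..<card E1} E1"
    using ex_bij_betw_nat_finite[OF fin(3)] by (auto simp: atLeast0LessThan)
  have eE: "e i \<in> E1" if "i < card E1" for i using e that by (auto simp: bij_betw_def)
  have "orthonormal d (card E1) e"
    unfolding orthonormal_def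
  proof (intro conjI allI impI)
    fix i j assume ij: "i < card E1" "j < card E1"
    have "e i = e j \<longleftrightarrow> i = j" using e ij by (auto simp: bij_betw_def inj_on_def)
    thus "cinner d (e i) (e j) = (if i = j then 1 else 0)" using on1 eE ij by (simp add: orthonormal_set_def)
  qed (use on1 eE in \<open>auto simp: orthonormal_set_def\<close>)
  moreover have "(\<lambda>z. cinner d (?\<phi> z) x) \<in> ann n"
    if x: "x \<in> cspace d" "\<forall>i<card E1. cinner d x (e i) = 0" for x
  proof (rule ker[OF x(1)])
    fix y assume "y \<in> E1"
    then obtain i where "i < card E1" "y = e i" using e by (auto simp: bij_betw_def)
    thus "cinner d x y = 0" using x(2) by simp
  qed
  ultimately have "good_frame m (n\<^sup>2 div 4 + 1) (card E1) e" by (simp add: good_frame_def)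
  thus ?thesis by blast
qed

end

section \<open>Interpolation by multipliers\<close>

context triangular_calculus
begin

lemma chi_coords: "m < n \<Longrightarrow> chi m (\<lambda>z. coords d r e (ball_aut d (spectral_point m) z) i) = 0"
proof -
  assume m: "m < n"
  interpret ball_point d "spectral_point m" by (rule ball_point_spectral_point[OF m])
  have "chi m (\<lambda>z. \<Sum>j<d. ball_aut d (spectral_point m) z j * cnj (e i j)) = (\<Sum>j<d. chi m (\<lambda>z. ball_aut d (spectral_point m) z j * cnj (e i j)))"
    by (rule chi_sum[OF holo_mult[OF holo_ball_aut holo_const] m])
  also have "\<dots> = 0" by (simp add: chi_mult[OF holo_ball_aut holo_const m] chi_ball_aut[OF m])
  finally show ?thesis by (cases "i < r") (simp_all add: coords_def cinner_def chi_const[OF m])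
qed

text \<open>
  The induction step. \<open>u\<close> is \<open>f / Q\<close> and \<open>c\<close> its value at the spectral point, \<open>h\<close> the Moebius transform of \<open>u\<close> that vanishes there, \<open>g\<close> a
  contractive multiplier that replaces \<open>h\<close>, and \<open>w\<close> the inverse transform of \<open>g\<close> times \<open>Q\<close>.
\<close>

lemma approximation_step:
  assumes m: "1 \<le> m" "m < n" and k: "1 \<le> k" and fr: "good_frame m k r e"
    and pd: "pd_kernel (unit_ball d) (Da_kernel a d)" and a: "0 < a" "1 \<le> M" "1 / a \<le> M\<^sup>2"
    and Kpos: "\<And>x. x \<in> unit_ball d \<Longrightarrow> 0 < Re (Da_kernel a d x x)"
    and Q1: "Q1 = 2 * (C k * sqrt (real k)) * M"
    and IH: "\<And>f. f \<in> holo d \<Longrightarrow> (\<And>z. z \<in> unit_ball d \<Longrightarrow> cmod (f z) \<le> 1) \<Longrightarrow>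
      \<exists>g\<in>holo d. mult_bound (unit_ball d) (Da_kernel a d) g (Q1 ^ (m - 1)) \<and> (\<lambda>z. f z - g z) \<in> ann m"
    and f: "f \<in> holo d" "\<And>z. z \<in> unit_ball d \<Longrightarrow> cmod (f z) \<le> 1"
  shows "\<exists>g\<in>holo d. mult_bound (unit_ball d) (Da_kernel a d) g (Q1 ^ m) \<and> (\<lambda>z. f z - g z) \<in> ann (Suc m)"
proof -
  interpret pd_kernel "unit_ball d" "Da_kernel a d" by (rule pd)
  interpret ball_point d "spectral_point m" by (rule ball_point_spectral_point[OF m(2)])
  let ?B = "unit_ball d" and ?K = "Da_kernel a d"
  have mn: "m \<le> n" "Suc m \<le> n" using m by auto
  have C1: "1 \<le> C k" by (rule gleason_constant_ge_1[OF k gleason[OF k]])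
  have k1: "1 \<le> sqrt (real k)" using k by simp
  have Q12: "2 \<le> Q1"
  proof -
    have "1 * 1 \<le> C k * sqrt (real k)" using C1 k1 by (intro mult_mono) auto
    hence "1 * 1 \<le> (C k * sqrt (real k)) * M" using a(2) by (intro mult_mono) auto
    thus ?thesis by (simp add: Q1)
  qed
  define Q where "Q = Q1 ^ m"
  have Q2: "2 \<le> Q"
  proof -
    have "Q1 ^ 1 \<le> Q1 ^ m" using Q12 m(1) by (intro power_increasing) auto
    thus ?thesis using Q12 by (simp add: Q_def)
  qed
  define u where "u = (\<lambda>z. f z / of_real Q)"
  define c where "c = f (spectral_point m) / of_real Q"
  have u_le: "cmod (u z) \<le> 1 / 2" if "z \<in> ?B" for z
    using f(2)[OF that] Q2 by (simp add: u_def norm_divide divide_le_eq)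
  have c_le: "cmod c \<le> 1 / 2"
    using u_le[OF spectral_point_in_ball[OF m(2)]] by (simp add: u_def c_def)
  have cu: "cmod (cnj c * u z) \<le> 1 / 4" if "z \<in> ?B" for z
  proof -
    have "cmod (cnj c * u z) \<le> (1 / 2) * (1 / 2)"
      unfolding norm_mult complex_mod_cnj by (intro mult_mono c_le u_le[OF that]) auto
    thus ?thesis by simp
  qed
  have nz1: "1 - cnj c * u z \<noteq> 0" if "z \<in> ?B" for z
  proof
    assume "1 - cnj c * u z = 0"
    hence "cmod (cnj c * u z) = 1" by simp
    thus False using cu[OF that] by simp
  qed
  have uh: "u \<in> holo d" unfolding u_def divide_inverse by (intro holo_mult f holo_const)
  define h where "h = (\<lambda>z. (u z - c) / (1 - cnj c * u z))"
  have hh: "h \<in> holo d" unfolding h_def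
    by (intro holo_divide holo_diff holo_scale uh holo_const nz1)
  have h0: "h (spectral_point m) = 0" by (simp add: h_def u_def c_def)
  have hb: "cmod (h z) \<le> 2 / Q" if z: "z \<in> ?B" for z
  proof -
    have t: "(0::real) \<le> 1 / Q\<^sup>2" "1 / Q\<^sup>2 \<le> 1 / 4"
    proof -
      have "2\<^sup>2 \<le> Q\<^sup>2" using Q2 by (intro power_mono) auto
      thus "1 / Q\<^sup>2 \<le> 1 / 4" using Q2 by (simp add: field_simps)
    qed simp
    have "cmod (f z - f (spectral_point m)) \<le> 2 * cmod (1 - of_real (1 / Q\<^sup>2) * (cnj (f (spectral_point m)) * f z))"
      by (rule shifted_distance_le[OF f(2)[OF z] f(2)[OF spectral_point_in_ball[OF m(2)]] t])
    also have "of_real (1 / Q\<^sup>2) * (cnj (f (spectral_point m)) * f z) = cnj c * u z"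
      by (simp add: c_def u_def power2_eq_square)
    finally have "cmod (f z - f (spectral_point m)) \<le> 2 * cmod (1 - cnj c * u z)" .
    moreover have "u z - c = (f z - f (spectral_point m)) / of_real Q" by (simp add: u_def c_def diff_divide_distrib)
    hence "cmod (u z - c) = cmod (f z - f (spectral_point m)) / Q" using Q2 by (simp add: norm_divide)
    ultimately have "cmod (u z - c) \<le> 2 * cmod (1 - cnj c * u z) / Q"
      using Q2 by (simp add: divide_right_mono)
    hence "cmod (u z - c) \<le> 2 / Q * cmod (1 - cnj c * u z)" by simp
    thus ?thesis unfolding h_def norm_divide
      using nz1[OF z] by (subst pos_divide_le_eq) auto
  qed
  define \<psi> where "\<psi> = (\<lambda>i z. coords d r e (ball_aut d (spectral_point m) z) i)"
  have \<psi>h: "\<psi> i \<in> holo d" for i unfolding \<psi>_def by (rule holo_coords[OF holo_ball_aut])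
  from decomposition[OF m(2) k fr hh hb h0] obtain F where
    F: "\<forall>i<k. F i \<in> holo d \<and> (\<forall>z\<in>?B. cmod (F i z) \<le> C k * (2 / Q))"
       "(\<lambda>z. h z - (\<Sum>i<k. \<psi> i z * F i z)) \<in> ann n"
    unfolding \<psi>_def by blast
  define \<beta> where "\<beta> = C k * (2 / Q)"
  have \<beta>: "0 < \<beta>" using C1 Q2 by (simp add: \<beta>_def)
  have "\<exists>g. i < k \<longrightarrow> g \<in> holo d \<and> mult_bound ?B ?K g (\<beta> * Q1 ^ (m - 1)) \<and> (\<lambda>z. F i z - g z) \<in> ann m" for i
  proof (cases "i < k")
    case True
    have Fi: "F i \<in> holo d" "\<And>z. z \<in> ?B \<Longrightarrow> cmod (F i z) \<le> \<beta>" using F(1) True by (auto simp: \<beta>_def)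
    have "\<exists>g\<in>holo d. mult_bound ?B ?K g (Q1 ^ (m - 1)) \<and> (\<lambda>z. of_real (1 / \<beta>) * F i z - g z) \<in> ann m"
    proof (rule IH)
      show "(\<lambda>z. of_real (1 / \<beta>) * F i z) \<in> holo d" by (rule holo_scale[OF Fi(1)])
      show "cmod (of_real (1 / \<beta>) * F i z) \<le> 1" if "z \<in> ?B" for z
        using Fi(2)[OF that] \<beta> by (simp add: norm_mult norm_divide divide_le_eq)
    qed
    then obtain g where g: "g \<in> holo d" "mult_bound ?B ?K g (Q1 ^ (m - 1))"
        "(\<lambda>z. of_real (1 / \<beta>) * F i z - g z) \<in> ann m" by blast
    have "mult_bound ?B ?K (\<lambda>z. of_real \<beta> * g z) (\<beta> * Q1 ^ (m - 1))"
      using mult_bound_scale[OF g(2), of "of_real \<beta>"] \<beta> by simp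
    moreover have "(\<lambda>z. F i z - of_real \<beta> * g z) \<in> ann m"
    proof (rule ann_cong[OF ann_scale[OF g(3) mn(1)] mn(1)])
      show "of_real \<beta> * (of_real (1 / \<beta>) * F i z - g z) = F i z - of_real \<beta> * g z" for z
        using \<beta> by (simp add: right_diff_distrib)
    qed
    ultimately show ?thesis using holo_scale[OF g(1)] by blast
  qed simp
  hence "\<forall>i. \<exists>g. i < k \<longrightarrow> g \<in> holo d \<and> mult_bound ?B ?K g (\<beta> * Q1 ^ (m - 1)) \<and> (\<lambda>z. F i z - g z) \<in> ann m" ..
  from choice[OF this] obtain G where G': "\<forall>i. i < k \<longrightarrow> G i \<in> holo d \<and>
      mult_bound ?B ?K (G i) (\<beta> * Q1 ^ (m - 1)) \<and> (\<lambda>z. F i z - G i z) \<in> ann m" ..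
  have G: "G i \<in> holo d" "mult_bound ?B ?K (G i) (\<beta> * Q1 ^ (m - 1))" "(\<lambda>z. F i z - G i z) \<in> ann m"
    if "i < k" for i using G' that by auto
  define g where "g = (\<lambda>z. \<Sum>i<k. \<psi> i z * G i z)"
  have gh: "g \<in> holo d" unfolding g_def by (intro holo_sum holo_mult \<psi>h G) auto
  have "mult_bound ?B ?K g (sqrt (real k) * M * (\<beta> * Q1 ^ (m - 1)))"
    unfolding g_def
  proof (rule mult_bound_row[OF _ G(2)])
    have M2: "1 \<le> M\<^sup>2" using a(2) by simp
    fix F c assume "finite F" "F \<subseteq> ?B"
    thus "(\<Sum>i<k. kquad ?K F (\<lambda>x. c x * cnj (\<psi> i x))) \<le> M\<^sup>2 * kquad ?K F c"
      unfolding \<psi>_def using fr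
      by (intro kquad_row_le[OF pd a(1) M2 a(3)]) (auto simp: good_frame_def)
  qed
  moreover have "sqrt (real k) * M * (\<beta> * Q1 ^ (m - 1)) = 1"
  proof -
    have "Q = Q1 * Q1 ^ (m - 1)" using m(1) by (simp add: Q_def power_eq_if)
    moreover have "Q1 \<noteq> 0" using Q12 by simp
    ultimately have "sqrt (real k) * M * (\<beta> * Q1 ^ (m - 1)) = (2 * (C k * sqrt (real k)) * M) / Q1"
      by (simp add: \<beta>_def)
    thus ?thesis using \<open>Q1 \<noteq> 0\<close> Q1 by simp
  qed
  ultimately have g1: "mult_bound ?B ?K g 1" by simp
  have g_le: "cmod (g z) \<le> 1" if "z \<in> ?B" for z
    by (rule mult_bound_imp_norm_le[OF g1 _ that Kpos[OF that]]) simp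
  have hg: "(\<lambda>z. h z - g z) \<in> ann (Suc m)"
  proof -
    have "(\<lambda>z. (h z - (\<Sum>i<k. \<psi> i z * F i z)) + (\<Sum>i<k. (F i z - G i z) * \<psi> i z)) \<in> ann (Suc m)"
    proof (rule ann_add[OF _ _ mn(2)])
      show "(\<lambda>z. h z - (\<Sum>i<k. \<psi> i z * F i z)) \<in> ann (Suc m)" using F(2) ann_mono[OF mn(2)] by blast
      show "(\<lambda>z. \<Sum>i<k. (F i z - G i z) * \<psi> i z) \<in> ann (Suc m)"
      proof (rule ann_sum[OF _ mn(2)])
        fix i assume "i \<in> {..<k}"
        thus "(\<lambda>z. (F i z - G i z) * \<psi> i z) \<in> ann (Suc m)"
          by (intro ann_step[OF G(3) \<psi>h _ m(2)]) (simp_all add: \<psi>_def chi_coords[OF m(2)])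
      qed
    qed
    thus ?thesis
    proof (rule ann_cong[OF _ mn(2)])
      fix z
      show "(h z - (\<Sum>i<k. \<psi> i z * F i z)) + (\<Sum>i<k. (F i z - G i z) * \<psi> i z) = h z - g z"
      proof -
        have "(\<Sum>i<k. (F i z - G i z) * \<psi> i z) = (\<Sum>i<k. \<psi> i z * F i z) - g z"
          unfolding g_def sum_subtractf[symmetric]
          by (intro sum.cong refl) (simp add: algebra_simps)
        thus ?thesis by simp
      qed
    qed
  qed
  have nz2: "1 + cnj c * v \<noteq> 0" if "cmod v \<le> 1" for v
  proof
    assume "1 + cnj c * v = 0"
    hence "cnj c * v = -1" by (simp add: add_eq_0_iff)
    hence "cmod (cnj c * v) = 1" by simp
    moreover have "cmod (cnj c * v) \<le> (1 / 2) * 1"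
      unfolding norm_mult complex_mod_cnj using c_le that by (intro mult_mono) auto
    ultimately show False by simp
  qed
  have h_le: "cmod (h z) \<le> 1" if "z \<in> ?B" for z
  proof -
    have "2 / Q \<le> 1" using Q2 by simp
    thus ?thesis using hb[OF that] by linarith
  qed
  define w where "w = (\<lambda>z. of_real Q * ((c + g z) / (1 + cnj c * g z)))"
  have wh: "w \<in> holo d" unfolding w_def
    by (intro holo_scale holo_divide holo_add holo_const gh nz2 g_le)
  have "mult_bound ?B ?K (\<lambda>z. (c + g z) / (1 + cnj c * g z)) 1" (is "mult_bound _ _ ?m _")
    using c_le by (intro mult_bound_moebius[OF g1] nz2 g_le) auto
  then have wQ: "mult_bound ?B ?K w (Q1 ^ m)"
  proof -
    assume "mult_bound ?B ?K ?m 1"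
    hence "mult_bound ?B ?K w (cmod (of_real Q) * 1)" unfolding w_def by (rule mult_bound_scale)
    hence "mult_bound ?B ?K w Q" using Q2 by simp
    thus ?thesis by (simp only: Q_def)
  qed
  have inv: "(\<lambda>z. of_real Q * (1 - c * cnj c) * inverse ((1 + cnj c * h z) * (1 + cnj c * g z))) \<in> holo d"
    by (intro holo_mult holo_const holo_inverse holo_add holo_scale hh gh)
       (use nz2 h_le g_le in auto)
  have "(\<lambda>z. (h z - g z) * (of_real Q * (1 - c * cnj c) * inverse ((1 + cnj c * h z) * (1 + cnj c * g z)))) \<in> ann (Suc m)"
    by (rule ann_mult_right[OF hg inv mn(2)])
  hence "(\<lambda>z. f z - w z) \<in> ann (Suc m)"
  proof (rule ann_cong[OF _ mn(2)])
    fix z assume z: "z \<in> ?B"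
    let ?X = "1 + cnj c * h z" and ?Y = "1 + cnj c * g z"
    have n: "?X \<noteq> 0" "?Y \<noteq> 0" using nz2 h_le[OF z] g_le[OF z] by auto
    have "h z * (1 - cnj c * u z) = u z - c" using nz1[OF z] by (simp add: h_def)
    hence "u z * ?X = c + h z" by (simp add: algebra_simps)
    hence "u z = (c + h z) / ?X" using n(1) by (simp add: eq_divide_eq)
    moreover have "f z = of_real Q * u z" using Q2 by (simp add: u_def)
    ultimately have "f z - w z = of_real Q * ((c + h z) / ?X - (c + g z) / ?Y)"
      by (simp add: w_def right_diff_distrib)
    also have "(c + h z) / ?X - (c + g z) / ?Y = ((c + h z) * ?Y - (c + g z) * ?X) / (?X * ?Y)"
      by (rule diff_frac_eq[OF n])
    also have "(c + h z) * ?Y - (c + g z) * ?X = (h z - g z) * (1 - c * cnj c)"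
      by (simp add: algebra_simps)
    finally show "(h z - g z) * (of_real Q * (1 - c * cnj c) * inverse (?X * ?Y)) = f z - w z"
      by (simp add: divide_inverse mult_ac)
  qed
  with wh wQ show ?thesis by blast
qed

theorem approximation:
  assumes k: "1 \<le> k" and fr: "\<And>m. m < n \<Longrightarrow> \<exists>r e. good_frame m k r e"
    and pd: "pd_kernel (unit_ball d) (Da_kernel a d)" and a: "0 < a" "1 \<le> M" "1 / a \<le> M\<^sup>2"
    and Kpos: "\<And>x. x \<in> unit_ball d \<Longrightarrow> 0 < Re (Da_kernel a d x x)"
    and m: "1 \<le> m" "m \<le> n"
    and f: "f \<in> holo d" "\<And>z. z \<in> unit_ball d \<Longrightarrow> cmod (f z) \<le> 1"
  shows "\<exists>g\<in>holo d. mult_bound (unit_ball d) (Da_kernel a d) g ((2 * (C k * sqrt (real k)) * M) ^ (m - 1))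
      \<and> (\<lambda>z. f z - g z) \<in> ann m"
  using m f
proof (induction m arbitrary: f rule: dec_induct)
  case base
  interpret pd_kernel "unit_ball d" "Da_kernel a d" by (rule pd)
  have 0: "0 < n" using base by simp
  have b1: "mult_bound (unit_ball d) (Da_kernel a d) (\<lambda>_. f (spectral_point 0)) 1"
    by (rule mult_bound_const) (rule base(3)[OF spectral_point_in_ball[OF 0]])
  have b2: "(\<lambda>z. f z - f (spectral_point 0)) \<in> ann 1"
    unfolding ann_def
  proof (intro CollectI conjI allI impI)
    show hol: "(\<lambda>z. f z - f (spectral_point 0)) \<in> holo d" by (rule holo_diff[OF base(2) holo_const])
    fix r s :: nat assume r: "r < n" and s: "s < 1"
    show "\<rho> (\<lambda>z. f z - f (spectral_point 0)) r s = 0"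
    proof (cases "r = 0")
      case True
      have "chi 0 (\<lambda>z. f z - f (spectral_point 0)) = 0"
        using chi_diff[OF base(2) holo_const 0] chi_const[OF 0] chi_eval[OF 0 base(2,3)] by simp
      thus ?thesis using True s by simp
    next
      case False
      thus ?thesis using rep_upper[OF hol _ r, of s] s by simp
    qed
  qed
  show ?case
  proof (intro bexI[of _ "\<lambda>_. f (spectral_point 0)"] conjI holo_const)
    show "mult_bound (unit_ball d) (Da_kernel a d) (\<lambda>_. f (spectral_point 0)) ((2 * (C k * sqrt (real k)) * M) ^ (1 - 1))"
      using b1 by simp
  qed (rule b2)
next
  case (step m)
  have mn: "m < n" "m \<le> n" using step.prems(1) by auto
  obtain r e where fr': "good_frame m k r e" using fr[OF mn(1)] by blast
  have "\<exists>g\<in>holo d. mult_bound (unit_ball d) (Da_kernel a d) g ((2 * (C k * sqrt (real k)) * M) ^ m)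
      \<and> (\<lambda>z. f z - g z) \<in> ann (Suc m)"
  proof (rule approximation_step[OF step.hyps(1) mn(1) k fr' pd a Kpos refl _ step.prems(2,3)])
    fix h :: "(nat \<Rightarrow> complex) \<Rightarrow> complex"
    assume "h \<in> holo d" "\<And>z. z \<in> unit_ball d \<Longrightarrow> cmod (h z) \<le> 1"
    thus "\<exists>g\<in>holo d. mult_bound (unit_ball d) (Da_kernel a d) g ((2 * (C k * sqrt (real k)) * M) ^ (m - 1))
      \<and> (\<lambda>z. h z - g z) \<in> ann m" by (rule step.IH[OF mn(2)])
  qed
  thus ?case by (simp only: diff_Suc_1)
qed

end

section \<open>The functional calculus of a commuting tuple\<close>

locale calculus =
  fixes d n :: nat and T :: "nat \<Rightarrow> complex mat"
    and \<Phi> :: "((nat \<Rightarrow> complex) \<Rightarrow> complex) \<Rightarrow> complex mat"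
  assumes T: "commuting_tuple d n T" and calc: "functional_calculus d n T \<Phi>"
begin

lemma calc_carrier: "f \<in> holo d \<Longrightarrow> \<Phi> f \<in> carrier_mat n n"
  using calc unfolding functional_calculus_def by (elim conjE) blast

lemma calc_add: "f \<in> holo d \<Longrightarrow> g \<in> holo d \<Longrightarrow> \<Phi> (\<lambda>z. f z + g z) = \<Phi> f + \<Phi> g"
  using calc unfolding functional_calculus_def by (elim conjE) blast

lemma calc_mult: "f \<in> holo d \<Longrightarrow> g \<in> holo d \<Longrightarrow> \<Phi> (\<lambda>z. f z * g z) = \<Phi> f * \<Phi> g"
  using calc unfolding functional_calculus_def by (elim conjE) blast

lemma calc_scale: "f \<in> holo d \<Longrightarrow> \<Phi> (\<lambda>z. c * f z) = c \<cdot>\<^sub>m \<Phi> f"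
  using calc unfolding functional_calculus_def by (elim conjE) blast

lemma calc_one: "\<Phi> (\<lambda>_. 1) = 1\<^sub>m n"
proof -
  have "\<Phi> (poly_fun d {\<lambda>_. 0} (\<lambda>_. 1)) = poly_mat d n T {\<lambda>_. 0} (\<lambda>_. 1)"
    using calc unfolding functional_calculus_def by (elim conjE) blast
  moreover have "poly_fun d {\<lambda>_. 0} (\<lambda>_. 1) = (\<lambda>_. 1)" by (simp add: poly_fun_def fun_eq_iff)
  moreover have "mat_monomial d n T (\<lambda>_. 0) = 1\<^sub>m n"
  proof -
    have "foldr (\<lambda>i B. (T i ^\<^sub>m 0) * B) xs (1\<^sub>m n) = 1\<^sub>m n" if "set xs \<subseteq> {..<d}" for xs
      using that T by (induction xs) (auto simp: commuting_tuple_def)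
    thus ?thesis by (simp add: mat_monomial_def atLeast0LessThan)
  qed
  moreover have "poly_mat d n T {\<lambda>_. 0} (\<lambda>_. 1) = mat_monomial d n T (\<lambda>_. 0)"
    unfolding calculation(3) by (rule eq_matI) (auto simp: poly_mat_def calculation(3))
  ultimately show ?thesis by simp
qed

text \<open>
  Continuity along a constant sequence.
\<close>

lemma calc_local:
  assumes f: "f \<in> holo d" and g: "g \<in> holo d" and eq: "\<And>z. z \<in> unit_ball d \<Longrightarrow> f z = g z"
  shows "\<Phi> f = \<Phi> g"
proof -
  have cont: "\<forall>u. \<forall>f\<in>holo d. (\<forall>m. u m \<in> holo d) \<and>
        (\<forall>S. compact S \<and> S \<subseteq> unit_ball d \<longrightarrow> uniform_limit S u f sequentially) \<longrightarrow>
        (\<forall>r<n. \<forall>s<n. (\<lambda>m. \<Phi> (u m) $$ (r, s)) \<longlonglongrightarrow> \<Phi> f $$ (r, s))"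
    using calc unfolding functional_calculus_def by (elim conjE)
  have "uniform_limit S (\<lambda>_ :: nat. g) f sequentially" if "S \<subseteq> unit_ball d" for S
    using eq that by (intro uniform_limitI always_eventually allI ballI) auto
  hence "\<forall>r<n. \<forall>s<n. (\<lambda>m :: nat. \<Phi> g $$ (r, s)) \<longlonglongrightarrow> \<Phi> f $$ (r, s)"
    using cont[THEN spec, of "\<lambda>_. g", THEN bspec, OF f] g by simp
  hence "\<Phi> g $$ (r, s) = \<Phi> f $$ (r, s)" if "r < n" "s < n" for r s
    using that LIMSEQ_const_iff by blast
  thus ?thesis using calc_carrier[OF f] calc_carrier[OF g] by (intro eq_matI) auto
qed

lemma triangular_form:
  assumes "1 \<le> d" "\<And>k. 1 \<le> k \<Longrightarrow> gleason_constant k (C k)"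
  obtains \<rho> where "triangular_calculus d n \<rho> C"
    "\<And>f g. f \<in> holo d \<Longrightarrow> g \<in> holo d \<Longrightarrow> (\<And>r s. r < n \<Longrightarrow> s < n \<Longrightarrow> \<rho> f r s = \<rho> g r s) \<Longrightarrow> \<Phi> f = \<Phi> g"
proof -
  interpret commuting_family n "holo d" "\<lambda>f i j. \<Phi> f $$ (i, j)"
  proof
    fix f g i k assume f: "f \<in> holo d" and g: "g \<in> holo d" and ik: "i < n" "k < n"
    have "\<Phi> f * \<Phi> g = \<Phi> g * \<Phi> f"
      using calc_mult[OF f g] calc_mult[OF g f] by (simp add: mult.commute)
    hence "(\<Phi> f * \<Phi> g) $$ (i, k) = (\<Phi> g * \<Phi> f) $$ (i, k)" by simp
    thus "(\<Sum>j<n. \<Phi> f $$ (i, j) * \<Phi> g $$ (j, k)) = (\<Sum>j<n. \<Phi> g $$ (i, j) * \<Phi> f $$ (j, k))"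
      using calc_carrier[OF f] calc_carrier[OF g] ik
      by (simp add: scalar_prod_def atLeast0LessThan)
  qed
  obtain p q :: "nat \<Rightarrow> nat \<Rightarrow> complex" where pq:
    "\<And>i j. i < n \<Longrightarrow> j < n \<Longrightarrow> (\<Sum>k<n. p i k * q k j) = (if i = j then 1 else 0)"
    "\<And>i j. i < n \<Longrightarrow> j < n \<Longrightarrow> (\<Sum>k<n. q i k * p k j) = (if i = j then 1 else 0)"
    "\<And>f r s. f \<in> holo d \<Longrightarrow> s < r \<Longrightarrow> r < n \<Longrightarrow> (\<Sum>i<n. \<Sum>j<n. q r i * \<Phi> f $$ (i, j) * p j s) = 0"
    using simultaneous_triangularization by blast
  define P where "P = Matrix.mat n n (\<lambda>(i, j). p i j)"
  define Q where "Q = Matrix.mat n n (\<lambda>(i, j). q i j)"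
  have car: "P \<in> carrier_mat n n" "Q \<in> carrier_mat n n" by (auto simp: P_def Q_def)
  have PQ: "P * Q = 1\<^sub>m n" and QP: "Q * P = 1\<^sub>m n"
    by (rule eq_matI; use pq in \<open>simp add: P_def Q_def scalar_prod_def atLeast0LessThan\<close>)+
  define R where "R = (\<lambda>f. Q * \<Phi> f * P)"
  have R_car: "R f \<in> carrier_mat n n" if "f \<in> holo d" for f
    using calc_carrier[OF that] car by (simp add: R_def)
  have R_mult: "R (\<lambda>z. f z * g z) = R f * R g" if f: "f \<in> holo d" and g: "g \<in> holo d" for f g
  proof -
    note c = calc_carrier[OF f] calc_carrier[OF g] car
    have "R f * R g = Q * \<Phi> f * (P * Q) * \<Phi> g * P"
      using c by (simp add: R_def assoc_mult_mat[of _ n n _ n _ n])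
    also have "\<dots> = R (\<lambda>z. f z * g z)"
      using c unfolding PQ R_def calc_mult[OF f g] by (simp add: assoc_mult_mat[of _ n n _ n _ n])
    finally show ?thesis by simp
  qed
  have R_upper: "R f $$ (r, s) = 0" if f: "f \<in> holo d" and rs: "s < r" "r < n" for f r s
  proof -
    have "R f $$ (r, s) = (\<Sum>j<n. (\<Sum>i<n. q r i * \<Phi> f $$ (i, j)) * p j s)"
      using rs calc_carrier[OF f] by (simp add: R_def P_def Q_def scalar_prod_def atLeast0LessThan)
    also have "\<dots> = (\<Sum>i<n. \<Sum>j<n. q r i * \<Phi> f $$ (i, j) * p j s)"
      unfolding sum_distrib_right by (rule sum.swap)
    finally show ?thesis using pq(3)[OF f rs] by simp
  qed
  have R_inj: "\<Phi> f = \<Phi> g" if f: "f \<in> holo d" and g: "g \<in> holo d" and eq: "R f = R g" for f g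
  proof -
    have "\<Phi> h = P * R h * Q" if h: "h \<in> holo d" for h
    proof -
      note c = calc_carrier[OF h] car
      have "P * R h * Q = (P * Q) * \<Phi> h * (P * Q)"
        using c by (simp add: R_def assoc_mult_mat[of _ n n _ n _ n])
      thus ?thesis using c by (simp add: PQ)
    qed
    thus ?thesis using f g eq by simp
  qed
  have tri: "triangular_calculus d n (\<lambda>f r s. R f $$ (r, s)) C"
  proof
    fix f g r s c
    assume f: "f \<in> holo d" and rs: "r < n" "s < n"
    note cf = calc_carrier[OF f] car
    show "R (\<lambda>z. c * f z) $$ (r, s) = c * R f $$ (r, s)"
    proof -
      have "R (\<lambda>z. c * f z) = c \<cdot>\<^sub>m R f"
        unfolding R_def calc_scale[OF f] using cf by (simp add: mult_smult_distrib[of _ n n _ n] mult_smult_assoc_mat[of _ n n _ n])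
      thus ?thesis using R_car[OF f] rs by simp
    qed
    assume g: "g \<in> holo d"
    note c = cf calc_carrier[OF g]
    show "R (\<lambda>z. f z + g z) $$ (r, s) = R f $$ (r, s) + R g $$ (r, s)"
    proof -
      have "R (\<lambda>z. f z + g z) = R f + R g"
        unfolding R_def calc_add[OF f g]
        using c by (simp add: mult_add_distrib_mat[of _ n n _ n] add_mult_distrib_mat[of _ n n _ _ n])
      thus ?thesis using R_car[OF f] R_car[OF g] rs by simp
    qed
    show "R (\<lambda>z. f z * g z) $$ (r, s) = (\<Sum>t<n. R f $$ (r, t) * R g $$ (t, s))"
      unfolding R_mult[OF f g] using R_car[OF f] R_car[OF g] rs
      by (simp add: scalar_prod_def atLeast0LessThan)
    assume "\<And>z. z \<in> unit_ball d \<Longrightarrow> f z = g z"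
    thus "R f $$ (r, s) = R g $$ (r, s)" using calc_local[OF f g] by (simp add: R_def)
  next
    fix r s assume "r < n" "s < n"
    moreover have "R (\<lambda>_. 1) = 1\<^sub>m n" using car by (simp add: R_def calc_one QP)
    ultimately show "R (\<lambda>_. 1) $$ (r, s) = (if r = s then 1 else 0)" by simp
  qed (use assms R_upper in auto)
  show thesis
  proof (rule that[OF tri])
    fix f g assume f: "f \<in> holo d" and g: "g \<in> holo d"
      and eq: "\<And>r s. r < n \<Longrightarrow> s < n \<Longrightarrow> R f $$ (r, s) = R g $$ (r, s)"
    have "R f = R g" using R_car[OF f] R_car[OF g] eq by (intro eq_matI) auto
    thus "\<Phi> f = \<Phi> g" by (rule R_inj[OF f g])
  qed
qed

end

theorem lemma4p6:
  fixes d n n' :: nat and a :: real and C :: "nat \<Rightarrow> real"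
    and f :: "(nat \<Rightarrow> complex) \<Rightarrow> complex"
    and T :: "nat \<Rightarrow> complex mat"
    and \<Phi> :: "((nat \<Rightarrow> complex) \<Rightarrow> complex) \<Rightarrow> complex mat"
    and H :: "((nat \<Rightarrow> complex) \<Rightarrow> complex) set"
    and ip :: "((nat \<Rightarrow> complex) \<Rightarrow> complex) \<Rightarrow> ((nat \<Rightarrow> complex) \<Rightarrow> complex) \<Rightarrow> complex"
  assumes "d \<ge> 1" and "n \<ge> 1" and "a > 0"
    and "\<forall>k\<ge>1. gleason_constant k (C k)"
    and "n' = n\<^sup>2 div 4 + 1"
    and "f \<in> Hinf d"
    and "commuting_tuple d n T"
    and "joint_spectrum d n T \<subseteq> unit_ball d"
    and "functional_calculus d n T \<Phi>"
    and "rkhs (unit_ball d) (Da_kernel a d) H ip"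
  shows "\<exists>g \<in> Mult H. \<Phi> f = \<Phi> g \<and>
    mult_norm H ip g
      \<le> (2 * min (C d * sqrt (real d)) (C n' * sqrt (real n')) * max 1 (a powr (- 1 / 2))) ^ (n - 1)
          * supnorm d f"
proof -
  interpret rkhs "unit_ball d" "Da_kernel a d" H ip by fact
  have cal: "calculus d n T \<Phi>" using assms by unfold_locales
  obtain \<rho> where tri: "triangular_calculus d n \<rho> C" and inj:
    "\<And>f g. f \<in> holo d \<Longrightarrow> g \<in> holo d \<Longrightarrow> (\<And>r s. r < n \<Longrightarrow> s < n \<Longrightarrow> \<rho> f r s = \<rho> g r s) \<Longrightarrow> \<Phi> f = \<Phi> g"
    using calculus.triangular_form[OF cal assms(1), of C] assms(4) by metis
  interpret triangular_calculus d n \<rho> C by (rule tri)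
  \<comment> \<open>a bound for the norm of the row formed by the coordinates of an automorphism\<close>
  define M where "M = max 1 (a powr (- 1 / 2))"
  define \<kappa> where "\<kappa> = min (C d * sqrt (real d)) (C n' * sqrt (real n'))"
  define R where "R = (2 * \<kappa> * M) ^ (n - 1)"
  have M: "1 \<le> M" "1 / a \<le> M\<^sup>2"
  proof -
    show "1 \<le> M" by (simp add: M_def)
    have "1 / a = (a powr (- 1 / 2))\<^sup>2"
      using assms(3) by (simp add: powr_minus_divide powr_half_sqrt power_divide)
    also have "\<dots> \<le> M\<^sup>2" by (intro power_mono) (auto simp: M_def)
    finally show "1 / a \<le> M\<^sup>2" .
  qed
  have Kpos: "0 < Re (Da_kernel a d x x)" if x: "x \<in> unit_ball d" for x
  proof -
    have "0 < 1 - (cnorm d x)\<^sup>2"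
      using x cnorm_nonneg[of d x] by (simp add: unit_ball_def abs_square_less_1)
    hence "Da_kernel a d x x = of_real (1 / (1 - (cnorm d x)\<^sup>2) powr a)"
      using powr_of_real[of "1 - (cnorm d x)\<^sup>2" a] by (simp add: Da_kernel_def cinner_self)
    thus ?thesis using \<open>0 < 1 - _\<close> by simp
  qed
  \<comment> \<open>the smaller of the two constants decides in how many variables to divide\<close>
  obtain k where k: "1 \<le> k" "\<kappa> = C k * sqrt (real k)" "\<And>m. m < n \<Longrightarrow> \<exists>r e. good_frame m k r e"
  proof (cases "C d * sqrt (real d) \<le> C n' * sqrt (real n')")
    case True
    show ?thesis by (rule that[of d]) (use True assms(1) standard_frame in \<open>auto simp: \<kappa>_def\<close>)
  next
    case False
    show ?thesis
      by (rule that[of n']) (use False assms(5) schur_frame in \<open>auto simp: \<kappa>_def\<close>)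
  qed
  have "0 \<le> \<kappa>" using gleason_constant_ge_1[OF k(1)] assms(4) k(1,2) by (smt (verit) mult_nonneg_nonneg real_sqrt_ge_zero of_nat_0_le_iff)
  hence R0: "0 \<le> R" using M(1) by (simp add: R_def)
  note fH = Hinf_holo[OF assms(6)] and fle = Hinf_norm_le_supnorm[OF assms(6)]
  define S where "S = supnorm d f"
  have S0: "0 \<le> S" using supnorm_nonneg[OF assms(6)] by (simp add: S_def)
  have "\<exists>g\<in>holo d. mult_bound (unit_ball d) (Da_kernel a d) g (R * S) \<and> (\<lambda>z. f z - g z) \<in> ann n"
  proof (cases "S = 0")
    case True
    have "(\<lambda>z. f z - 0) \<in> ann n"
      by (rule ann_cong[OF ann_zero]) (use fle True in \<open>auto simp: S_def\<close>)
    moreover have "mult_bound (unit_ball d) (Da_kernel a d) (\<lambda>_. 0) (R * S)"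
      by (rule mult_bound_const) (simp add: True)
    ultimately show ?thesis by (intro bexI[OF _ holo_const] conjI)
  next
    case False
    hence S: "0 < S" using S0 by simp
    have "\<exists>g\<in>holo d. mult_bound (unit_ball d) (Da_kernel a d) g ((2 * (C k * sqrt (real k)) * M) ^ (n - 1))
      \<and> (\<lambda>z. of_real (1 / S) * f z - g z) \<in> ann n"
    proof (rule approximation[OF k(1,3) pd_kernel_axioms assms(3) M Kpos assms(2) order.refl])
      show "(\<lambda>z. of_real (1 / S) * f z) \<in> holo d" by (rule holo_scale[OF fH])
      show "cmod (of_real (1 / S) * f z) \<le> 1" if "z \<in> unit_ball d" for z
        using fle[OF that] S by (simp add: norm_mult norm_divide divide_le_eq S_def)
    qed
    then obtain g where g: "g \<in> holo d" "mult_bound (unit_ball d) (Da_kernel a d) g R"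
        "(\<lambda>z. of_real (1 / S) * f z - g z) \<in> ann n" unfolding R_def k(2) by blast
    have "mult_bound (unit_ball d) (Da_kernel a d) (\<lambda>z. of_real S * g z) (R * S)"
      using mult_bound_scale[OF g(2), of "of_real S"] S by (simp add: mult.commute)
    moreover have "(\<lambda>z. f z - of_real S * g z) \<in> ann n"
      by (rule ann_cong[OF ann_scale[OF g(3) order.refl, of "of_real S"] order.refl])
         (use S in \<open>simp add: right_diff_distrib\<close>)
    ultimately show ?thesis using holo_scale[OF g(1)] by blast
  qed
  then obtain g where g: "g \<in> holo d" "mult_bound (unit_ball d) (Da_kernel a d) g (R * S)"
      "(\<lambda>z. f z - g z) \<in> ann n" by blast
  have "\<rho> f r s = \<rho> g r s" if "r < n" "s < n" for r s
  proof -
    have "\<rho> (\<lambda>z. (f z - g z) + g z) r s = \<rho> (\<lambda>z. f z - g z) r s + \<rho> g r s"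
      by (rule rep_add[OF ann_holo[OF g(3)] g(1) that])
    thus ?thesis using g(3) that by (simp add: ann_def)
  qed
  hence "\<Phi> f = \<Phi> g" by (rule inj[OF fH g(1)])
  moreover have "0 \<le> R * S" using R0 S0 by simp
  ultimately show ?thesis
    using mult_bound_imp_Mult[OF g(2)] unfolding R_def S_def \<kappa>_def M_def by blast
qed

end
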